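(* Let $$S:=\Big\{\alpha\in[0,1):\ \liminf_{N\to\infty}P_N(\alpha)>0,\ \limsup_{N\to\infty}\frac{P_N(\alpha)}{N}<\infty\Big\}.$$ Then the Hausdorff dimension of $S$ satisfies $0.7056\leqslant \dim_H(S)\leqslant 0.8677$.
   Context: For $\alpha\in\mathbb{R}$ and $N\in\mathbb{N}$, the Sudler product is $P_N(\alpha)=\prod_{r=1}^{N}2\lvert\sin(\pi r\alpha)\rvert$. $\dim_H$ denotes Hausdorff dimension. *)

theory Defs
  imports "HOL-Analysis.Analysis"
begin

definition sudler :: "nat \<Rightarrow> real \<Rightarrow> real" where
  "sudler N \<alpha> = (\<Prod>r=1..N. 2 * \<bar>sin (pi * real r * \<alpha>)\<bar>)"

text \<open>
  The case distinction implements the usual conventions for the \<open>s\<close>-th power of a diameter: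
  the empty set always has weight \<open>0\<close>, and for \<open>s = 0\<close> every nonempty set has weight \<open>1\<close>
  (whereas \<open>0 powr 0 = 0\<close>).
\<close>

definition diam_weight :: "real \<Rightarrow> 'a::metric_space set \<Rightarrow> ennreal" where
  "diam_weight s U =
     (if U = {} then 0 else if s = 0 then 1 else ennreal (diameter U powr s))"

text \<open>
  Boundedness is required explicitly because \<open>diameter\<close> is real-valued and has no meaningful
  value on unbounded sets.
\<close>

definition hausdorff_pre_measure :: "real \<Rightarrow> real \<Rightarrow> 'a::metric_space set \<Rightarrow> ennreal" where
  "hausdorff_pre_measure s \<delta> A =
     (INF U \<in> {U :: nat \<Rightarrow> 'a set. A \<subseteq> (\<Union>i. U i) \<and>
                  (\<forall>i. bounded (U i) \<and> diameter (U i) \<le> \<delta>)}.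
        \<Sum>i. diam_weight s (U i))"

definition hausdorff_measure :: "real \<Rightarrow> 'a::metric_space set \<Rightarrow> ennreal" where
  "hausdorff_measure s A = (SUP \<delta> \<in> {0<..}. hausdorff_pre_measure s \<delta> A)"

definition hausdorff_dim :: "'a::metric_space set \<Rightarrow> ereal" where
  "hausdorff_dim A = (INF s \<in> {s. 0 \<le> s \<and> hausdorff_measure s A = 0}. ereal s)"

end

theory Submission
  imports Defs "HOL-Real_Asymp.Real_Asymp"
begin

text \<open>
  The logarithm \<open>f(\<alpha>, y)\<close> of a normalised double sine function satisfies
  \<open>P\<^sub>N(\<alpha>) = exp (f(\<alpha>, y)) P\<^sub>M(1/\<alpha>)\<close> for \<open>y = (N+1)\<alpha> - M \<in> (0, 1 + \<alpha>)\<close>. Since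
  \<open>P\<^sub>M(1/\<alpha>) = P\<^sub>M({1/\<alpha>})\<close>, the Sudler product is a telescoping product along the orbit of \<open>\<alpha>\<close> under
  the Gauss map. A potential \<open>V\<close> with \<open>f(\<alpha>, y) \<ge> V(d) - V(d')\<close> for the deviations \<open>d = y - \<alpha>\<close> at two
  consecutive levels exists when all partial quotients are at most 3, and gives both
  \<open>P\<^sub>N \<ge> 1\<close> and \<open>P\<^sub>N = O(N)\<close>. Conversely, along a suitable choice of \<open>N\<close> each partial quotient
  that is at least 7 lowers the product by a fixed factor, while the others do no harm up to a bounded potential;
  hence infinitely many of them force \<open>liminf P\<^sub>N = 0\<close>. So the set lies between
  the numbers with all partial quotients at most 3 and those with all but finitely many at most 6.
  The dimensions of these two sets are bounded by explicit trial functions \<open>h\<close> for the transfer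
  operators \<open>L\<close> of the two continued fraction systems: \<open>L h < h\<close> makes the cylinder covers
  summable to zero, \<open>L h \<ge> h\<close> yields a mass distribution on the limit set.
\<close>

text \<open>The double sine function is explicit only at a few points. What makes it tractable is
  its shape: \<open>log_dsine\<close> is convex up to the centre (1/\<alpha> + 1)/2 and concave
  beyond it, and without its \<open>ln_Gamma\<close> part it is concave from 1/2 on. So each
  one-level inequality becomes a comparison with chords and tangents through explicit values. A
  potential enters because a single level can lower the product; only telescoped sums are bounded
  below. The two directions differ. The lower bound concerns every N, so its inequality must hold on
  a whole window of arguments. For the other one, a single N per depth is enough; it keeps the
  argument near 1 at ordinary digits and near 2 at a digit at least seven, where the factor is about
  2 sin (pi \<alpha>). For \<alpha> up to 1/2 this is below 1 only if \<alpha> < 1/6, and the digit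
  seven leaves a proved gain of only 1/2000 in the logarithm after the cost of the deviations. The
  bounds 0.7056 and 0.8677 are within 0.0001 of the dimensions of the two digit sets, so the trial
  functions are nearly eigenfunctions and their powers are enclosed to six decimals.\<close>

lemma ln_mult_gt_0: "x > 0 \<Longrightarrow> y > 0 \<Longrightarrow> ln (x * y) = ln x + ln y" for x y :: real
  by (simp add: ln_mult)

section \<open>Convexity and increments of ln Gamma\<close>

lemma ln_Gamma_plus1: "ln_Gamma (x + 1) = ln_Gamma x + ln x" if "x > 0" for x :: real
proof -
  have "x \<notin> \<int>\<^sub>\<le>\<^sub>0" using that by (auto elim!: nonpos_Ints_cases)
  then have "Gamma (x + 1) = x * Gamma x" by (rule Gamma_plus1)
  then show ?thesis using that by (simp add: ln_Gamma_real_pos ln_mult_gt_0)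
qed

lemma ln_Gamma_1 [simp]: "ln_Gamma (1::real) = 0"
  by (simp add: ln_Gamma_real_pos)

lemma convex_on_ln_Gamma: "convex_on {0<..} (ln_Gamma :: real \<Rightarrow> real)"
  by (rule convex_on_realI[of _ _ Digamma])
     (auto intro!: derivative_eq_intros Polygamma_real_mono elim!: nonpos_Ints_cases')

text \<open>Convexity with the denominator cleared: x = z is allowed, and instances combine by
  linear arithmetic. The chord estimates for \<open>log_dsine\<close> all take this form.\<close>

lemma convex_on_three_point:
  fixes g :: "real \<Rightarrow> real"
  assumes "convex_on S g" "x \<in> S" "z \<in> S" "x \<le> y" "y \<le> z"
  shows "(z - x) * g y \<le> (z - y) * g x + (y - x) * g z"
proof (cases "x = z")
  case False
  then have xz: "x < z" using assms by simp
  define u where "u = (y - x) / (z - x)"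
  have u: "0 \<le> u" "u \<le> 1" using assms xz by (auto simp: u_def field_simps)
  have uz: "u * (z - x) = y - x" using xz by (simp add: u_def)
  have "y = (1 - u) *\<^sub>R x + u *\<^sub>R z" using uz by (simp add: algebra_simps)
  then have "g y \<le> (1 - u) * g x + u * g z"
    using convex_onD[OF assms(1) u assms(2,3)] by simp
  then have "(z - x) * g y \<le> (z - x) * ((1 - u) * g x + u * g z)"
    using xz by (intro mult_left_mono) auto
  also have "\<dots> = ((z - x) - u * (z - x)) * g x + (u * (z - x)) * g z" by (simp add: algebra_simps)
  also have "\<dots> = (z - y) * g x + (y - x) * g z" unfolding uz by simp
  finally show ?thesis .
qed (use assms in auto)

text \<open>Convexity compares the slope over [n, n + \<theta>] with the slopes over [n - 1, n] and
  [n, n + 1], which by the functional equation are ln (n - 1) and ln n.\<close>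

lemma ln_Gamma_between:
  assumes "n \<ge> (2::real)" "0 \<le> \<theta>" "\<theta> \<le> 1"
  shows "ln_Gamma (n + \<theta>) \<le> ln_Gamma n + \<theta> * ln n"
    and "ln_Gamma n + \<theta> * ln (n - 1) \<le> ln_Gamma (n + \<theta>)"
proof -
  have "ln_Gamma (n+1) = ln_Gamma n + ln n" "ln_Gamma n = ln_Gamma (n-1) + ln (n-1)"
    using ln_Gamma_plus1[of n] ln_Gamma_plus1[of "n-1"] assms by auto
  note e = this
  show "ln_Gamma (n + \<theta>) \<le> ln_Gamma n + \<theta> * ln n"
    using convex_on_three_point[OF convex_on_ln_Gamma, of n "n+1" "n+\<theta>"] assms e
    by (simp add: algebra_simps)
  show "ln_Gamma n + \<theta> * ln (n - 1) \<le> ln_Gamma (n + \<theta>)"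
  proof -
    have "(1 + \<theta>) * ln_Gamma n \<le> \<theta> * ln_Gamma (n-1) + ln_Gamma (n+\<theta>)"
      using convex_on_three_point[OF convex_on_ln_Gamma, of "n-1" "n+\<theta>" n] assms by (simp add: add.commute)
    then show ?thesis using e by (simp add: algebra_simps)
  qed
qed

section \<open>Stirling's formula\<close>

text \<open>The constant ln (2 pi) / 2 is not subtracted: it is the limit of this function and is
  identified in \<open>stirling_rem_nat\<close>.\<close>

definition stirling_rem :: "real \<Rightarrow> real" where
  "stirling_rem x = ln_Gamma x - (x - 1/2) * ln x + x"

lemma stirling_rem_shift:
  assumes "n \<ge> (2::real)" "0 \<le> \<theta>" "\<theta> \<le> 1"
  shows "\<bar>stirling_rem (n + \<theta>) - stirling_rem n\<bar> \<le> 4 / (n - 1)"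
proof -
  have n: "n > 1" using assms by simp
  define u where "u = \<theta> / n"
  have u: "0 \<le> u" "u \<le> 1 / n" using assms by (auto simp: u_def field_simps)
  have lnn: "ln (n + \<theta>) = ln n + ln (1 + u)"
  proof -
    have "n + \<theta> = n * (1 + u)" using assms by (simp add: u_def field_simps)
    then show ?thesis using assms u by (simp add: ln_mult)
  qed
  have lu1: "ln (1 + u) \<le> u" using u by (intro ln_add_one_self_le_self) auto
  have lu2: "u - u\<^sup>2 \<le> ln (1 + u)"
  proof -
    have "1 / n \<le> 1" using n by simp
    then show ?thesis using ln_one_plus_pos_lower_bound[of u] u by linarith
  qed
  have m1: "ln n - ln (n - 1) \<le> 1 / (n - 1)"
  proof -
    have "n = (n - 1) * (1 + 1/(n-1))" using n by (simp add: field_simps)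
    then have "ln n = ln (n-1) + ln (1 + 1/(n-1))" using n ln_mult_gt_0[of "n-1" "1 + 1/(n-1)"]
      by (simp add: add_pos_pos)
    then have "ln n - ln (n-1) = ln (1 + 1/(n-1))" by simp
    also have "\<dots> \<le> 1/(n-1)" using n by (intro ln_add_one_self_le_self) auto
    finally show ?thesis .
  qed
  have eq: "stirling_rem (n + \<theta>) - stirling_rem n
     = ln_Gamma (n+\<theta>) - ln_Gamma n - \<theta> * ln n - (n + \<theta> - 1/2) * ln (1+u) + \<theta>"
    unfolding stirling_rem_def lnn by (simp add: algebra_simps)
  have nu: "n * u = \<theta>" using n by (simp add: u_def)
  have up: "(n + \<theta> - 1/2) * ln (1+u) \<le> (n + 1) * u"
    using lu1 assms u by (intro mult_mono) auto
  have lo: "(n - 1/2) * (u - u\<^sup>2) \<le> (n + \<theta> - 1/2) * ln (1+u)"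
  proof -
    have "(n - 1/2) * (u - u\<^sup>2) \<le> (n - 1/2) * ln (1+u)" using lu2 n by (intro mult_left_mono) auto
    also have "\<dots> \<le> (n + \<theta> - 1/2) * ln (1+u)" using u assms by (intro mult_right_mono) auto
    finally show ?thesis .
  qed
  have un: "u \<le> 1 / (n - 1)" using u n by (smt (verit) frac_le)
  have u2: "n * u\<^sup>2 \<le> 1/(n-1)"
  proof -
    have "n * u\<^sup>2 = \<theta> * u" using nu by (simp add: power2_eq_square mult.assoc[symmetric])
    also have "\<dots> \<le> 1 * u" using assms u by (intro mult_right_mono) auto
    finally show ?thesis using un by simp
  qed
  have "stirling_rem (n + \<theta>) - stirling_rem n \<le> \<theta> - (n - 1/2) * (u - u\<^sup>2)"
    using ln_Gamma_between(1)[OF assms] lo unfolding eq by linarith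
  also have "\<dots> = n*u\<^sup>2 + u/2 - u\<^sup>2/2" using nu by (simp add: algebra_simps)
  also have "\<dots> \<le> 1/(n-1) + 1/(n-1)" using u2 un u zero_le_power2[of u] by linarith
  finally have a: "stirling_rem (n + \<theta>) - stirling_rem n \<le> 4/(n-1)" using n by (simp add: field_simps)
  have t1: "\<theta> * (ln n - ln (n-1)) \<le> 1 * (1/(n-1))" using m1 assms n by (intro mult_mono) auto
  have "stirling_rem (n + \<theta>) - stirling_rem n \<ge> - (1/(n-1)) - (n+1)*u + \<theta>"
    using ln_Gamma_between(2)[OF assms] up t1 unfolding eq right_diff_distrib by linarith
  then have "stirling_rem (n + \<theta>) - stirling_rem n \<ge> - (1/(n-1)) - u" using nu by (simp add: algebra_simps)
  then have b: "stirling_rem (n + \<theta>) - stirling_rem n \<ge> - (4/(n-1))" using un n by (simp add: field_simps)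
  show ?thesis using a b by linarith
qed

text \<open>Consecutive differences are - d n with d n = O(1/n^2), so the sequence telescopes into a
  convergent series. This does not yet reveal the limit.\<close>

lemma stirling_rem_nat_convergent: "convergent (\<lambda>n. stirling_rem (real n))"
proof -
  define d where "d = (\<lambda>n::nat. (real n + 1/2) * ln (1 + 1/real n) - 1)"
  have "summable (\<lambda>n. d n)"
  proof (rule summable_comparison_test_bigo)
    show "summable (\<lambda>n. norm (1 / real n ^ 2))"
      using inverse_power_summable[of 2, where 'a=real] by (simp add: field_simps)
    show "d \<in> O(\<lambda>n. 1 / real n ^ 2)" unfolding d_def by real_asymp
  qed
  then have sm: "summable (\<lambda>n. d (Suc n))" using summable_Suc_iff by blast
  have st: "stirling_rem (real (Suc (Suc n))) - stirling_rem (real (Suc n)) = - d (Suc n)" for n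
  proof -
    have l: "ln (1 + 1/(1 + real n)) = ln (2 + real n) - ln (1 + real n)"
    proof -
      have "2 + real n = (1 + real n) * (1 + 1/(1 + real n))" by (simp add: field_simps)
      then show ?thesis by (simp add: ln_mult_gt_0 add_pos_pos)
    qed
    have g: "ln_Gamma (2 + real n) = ln_Gamma (1 + real n) + ln (1 + real n)"
      using ln_Gamma_plus1[of "1 + real n"] by (simp add: add_ac)
    have e: "real (Suc (Suc n)) = 2 + real n" "real (Suc n) = 1 + real n" by simp_all
    show ?thesis unfolding stirling_rem_def d_def e l g by (simp add: algebra_simps)
  qed
  have "stirling_rem (real (Suc n)) = stirling_rem 1 - (\<Sum>k<n. d (Suc k))" for n
  proof (induction n)
    case (Suc n) then show ?case using st[of n] by simp
  qed simp
  then have "(\<lambda>n. stirling_rem (real (Suc n))) = (\<lambda>n. stirling_rem 1 - (\<Sum>k<n. d (Suc k)))" by blast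
  moreover have "convergent (\<lambda>n. stirling_rem 1 - (\<Sum>k<n. d (Suc k)))"
    using sm by (intro convergent_diff convergent_const) (simp add: summable_iff_convergent)
  ultimately have "convergent (\<lambda>n. stirling_rem (real (Suc n)))" by metis
  then show ?thesis using convergent_Suc_iff[of "\<lambda>n. stirling_rem (real n)"] by simp
qed

lemma ln_Gamma_duplication:
  assumes "x > (0::real)"
  shows "ln_Gamma x + ln_Gamma (x + 1/2) = (1 - 2*x) * ln 2 + ln pi / 2 + ln_Gamma (2*x)"
proof -
  have ni: "complex_of_real x \<notin> \<int>\<^sub>\<le>\<^sub>0" "complex_of_real x + 1/2 \<notin> \<int>\<^sub>\<le>\<^sub>0"
    using assms by (auto elim!: nonpos_Ints_cases simp: complex_eq_iff)
  have "complex_of_real (Gamma x * Gamma (x + 1/2))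
        = of_real (exp ((1 - 2*x) * ln 2) * sqrt pi * Gamma (2*x))"
    using Gamma_legendre_duplication[OF ni]
    by (simp add: Gamma_complex_of_real[symmetric] exp_of_real[symmetric])
  then have "Gamma x * Gamma (x + 1/2) = exp ((1 - 2*x) * ln 2) * sqrt pi * Gamma (2*x)"
    using of_real_eq_iff by blast
  then have "ln (Gamma x * Gamma (x + 1/2)) = ln (exp ((1 - 2*x) * ln 2) * sqrt pi * Gamma (2*x))"
    by simp
  then show ?thesis using assms by (simp add: ln_mult_gt_0 ln_Gamma_real_pos ln_sqrt)
qed

text \<open>Legendre duplication fixes the constant L: R(n) + R(n + 1/2) - R(2n) tends to L + L - L
  = L, and duplication evaluates the same combination as ln (2 pi) / 2 + o(1).\<close>

lemma stirling_rem_nat: "(\<lambda>n. stirling_rem (real n)) \<longlonglongrightarrow> ln (2 * pi) / 2"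
proof -
  obtain L where L: "(\<lambda>n. stirling_rem (real n)) \<longlonglongrightarrow> L"
    using stirling_rem_nat_convergent by (auto simp: convergent_def)
  have L2: "(\<lambda>n. stirling_rem (real (2*n))) \<longlonglongrightarrow> L"
    using LIMSEQ_subseq_LIMSEQ[OF L, of "\<lambda>n. 2*n"] by (simp add: strict_mono_def o_def)
  have dif: "(\<lambda>n. stirling_rem (real n + 1/2) - stirling_rem (real n)) \<longlonglongrightarrow> 0"
  proof (rule Lim_null_comparison)
    show "\<forall>\<^sub>F n in sequentially. norm (stirling_rem (real n + 1/2) - stirling_rem (real n)) \<le> 4/(real n - 1)"
      using eventually_ge_at_top[of 2] by eventually_elim (auto intro!: stirling_rem_shift)
    show "(\<lambda>n. 4/(real n - 1)) \<longlonglongrightarrow> 0" by real_asymp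
  qed
  have "(\<lambda>n. stirling_rem (real n) + (stirling_rem (real n) + (stirling_rem (real n + 1/2) - stirling_rem (real n)))
        - stirling_rem (real (2*n))) \<longlonglongrightarrow> L + (L + 0) - L"
    by (intro tendsto_intros L L2 dif)
  then have c: "(\<lambda>n. stirling_rem (real n) + stirling_rem (real n + 1/2) - stirling_rem (real (2*n))) \<longlonglongrightarrow> L"
    by (simp add: algebra_simps)
  have ev: "\<forall>\<^sub>F n in sequentially. stirling_rem (real n) + stirling_rem (real n + 1/2) - stirling_rem (real (2*n))
     = ln (2*pi)/2 + (1/2 - real n * ln (1 + 1/(2*real n)))"
    using eventually_gt_at_top[of 0]
  proof eventually_elim
    case (elim n)
    have n: "real n > 0" using elim by simp
    have l1: "ln (real n + 1/2) = ln (real n) + ln (1 + 1/(2*real n))"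
    proof -
      have "real n + 1/2 = real n * (1 + 1/(2*real n))" using n by (simp add: field_simps)
      then show ?thesis using n by (simp add: ln_mult_gt_0 add_pos_pos)
    qed
    have l2: "ln (2 * real n) = ln 2 + ln (real n)" using n by (simp add: ln_mult)
    have l3: "ln (2*pi) = ln 2 + ln pi" by (simp add: ln_mult)
    show ?case using ln_Gamma_duplication[OF n] unfolding stirling_rem_def
      by (simp add: l1 l2 l3) (simp add: algebra_simps)
  qed
  have "(\<lambda>n. ln (2*pi)/2 + (1/2 - real n * ln (1 + 1/(2*real n)))) \<longlonglongrightarrow> ln (2*pi)/2 + 0"
    by (intro tendsto_add tendsto_const) real_asymp
  then have "(\<lambda>n. stirling_rem (real n) + stirling_rem (real n + 1/2) - stirling_rem (real (2*n))) \<longlonglongrightarrow> ln (2*pi)/2"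
    using tendsto_cong[OF ev] by simp
  with c have "L = ln (2*pi)/2" by (rule LIMSEQ_unique)
  with L show ?thesis by simp
qed

theorem stirling_rem_tendsto: "(stirling_rem \<longlongrightarrow> ln (2 * pi) / 2) at_top"
proof -
  define n where "n = (\<lambda>x::real. nat \<lfloor>x\<rfloor>)"
  have nlim: "filterlim n at_top at_top" unfolding n_def
    by (rule filterlim_compose[OF filterlim_nat_sequentially filterlim_floor_sequentially])
  have a: "((\<lambda>x. stirling_rem (real (n x))) \<longlongrightarrow> ln (2*pi)/2) at_top"
    using filterlim_compose[OF stirling_rem_nat nlim] by simp
  have b: "((\<lambda>x. stirling_rem x - stirling_rem (real (n x))) \<longlongrightarrow> 0) at_top"
  proof (rule Lim_null_comparison)
    show "\<forall>\<^sub>F x in at_top. norm (stirling_rem x - stirling_rem (real (n x))) \<le> 4/(x - 2)"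
      using eventually_gt_at_top[of 3]
    proof eventually_elim
      case (elim x)
      have r: "real (n x) \<le> x" "x < real (n x) + 1" using elim unfolding n_def by linarith+
      have "\<bar>stirling_rem (real (n x) + (x - real (n x))) - stirling_rem (real (n x))\<bar> \<le> 4/(real (n x) - 1)"
        using r elim by (intro stirling_rem_shift) auto
      also have "\<dots> \<le> 4/(x-2)" using r elim by (intro divide_left_mono mult_pos_pos) auto
      finally show ?case by simp
    qed
    show "((\<lambda>x::real. 4/(x-2)) \<longlongrightarrow> 0) at_top" by real_asymp
  qed
  show ?thesis using tendsto_add[OF a b] by simp
qed

section \<open>The logarithm of the double sine function\<close>

lemma deriv_Gamma_diff:
  assumes "p + t > 0" "q - t > (0::real)"
  shows "((\<lambda>t. ln_Gamma (p + t) - ln_Gamma (q - t)) has_real_derivative Digamma (p + t) + Digamma (q - t)) (at t)"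
    "((\<lambda>t. Digamma (p + t) + Digamma (q - t)) has_real_derivative Polygamma 1 (p + t) - Polygamma 1 (q - t)) (at t)"
  using assms by (auto intro!: derivative_eq_intros elim!: nonpos_Ints_cases)

lemma Polygamma_1_antimono: "0 < x \<Longrightarrow> x \<le> y \<Longrightarrow> Polygamma 1 y \<le> Polygamma 1 (x::real)"
  using Polygamma_real_strict_antimono[of x y 1] by (cases "x = y") auto

text \<open>The second derivative is the difference of the trigamma values at p + t and q - t.
  Trigamma decreases on the positive axis, so the sign depends only on which argument is smaller;
  \<open>ln_Gamma_diff_concave\<close> is the opposite order.\<close>

lemma ln_Gamma_diff_convex:
  assumes "p + a > 0" "q - b > (0::real)" "p + b \<le> q - b"
  shows "convex_on {a..b} (\<lambda>t. ln_Gamma (p + t) - ln_Gamma (q - t))"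
proof (rule f''_ge0_imp_convex)
  fix t assume t: "t \<in> {a..b}"
  show "((\<lambda>t. ln_Gamma (p + t) - ln_Gamma (q - t)) has_real_derivative Digamma (p + t) + Digamma (q - t)) (at t)"
    "((\<lambda>t. Digamma (p + t) + Digamma (q - t)) has_real_derivative Polygamma 1 (p + t) - Polygamma 1 (q - t)) (at t)"
    using t assms by (intro deriv_Gamma_diff; auto)+
  show "0 \<le> Polygamma 1 (p + t) - Polygamma 1 (q - t)"
    using t assms Polygamma_1_antimono[of "p + t" "q - t"] by auto
qed simp

lemma ln_Gamma_diff_concave:
  assumes "p + a > 0" "q - b > (0::real)" "q - a \<le> p + a"
  shows "concave_on {a..b} (\<lambda>t. ln_Gamma (p + t) - ln_Gamma (q - t))"
proof (rule f''_le0_imp_concave)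
  fix t assume t: "t \<in> {a..b}"
  show "((\<lambda>t. ln_Gamma (p + t) - ln_Gamma (q - t)) has_real_derivative Digamma (p + t) + Digamma (q - t)) (at t)"
    "((\<lambda>t. Digamma (p + t) + Digamma (q - t)) has_real_derivative Polygamma 1 (p + t) - Polygamma 1 (q - t)) (at t)"
    using t assms by (intro deriv_Gamma_diff; auto)+
  show "Polygamma 1 (p + t) - Polygamma 1 (q - t) \<le> 0"
    using t assms Polygamma_1_antimono[of "q - t" "p + t"] by auto
qed simp

text \<open>Logarithm of Gamma(x + t) / Gamma(x + 1 - t) divided by its leading growth x^(2t - 1).
  At x = m/\<alpha> it is the m-th factor of the product for the double sine function; the
  normalisation makes that product converge.\<close>

definition gamma_ratio_rem :: "real \<Rightarrow> real \<Rightarrow> real" where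
  "gamma_ratio_rem t x = ln_Gamma (x + t) - ln_Gamma (x + 1 - t) - (2 * t - 1) * ln x"

lemma concave_three_point:
  fixes g :: "real \<Rightarrow> real"
  assumes "concave_on S g" "x \<in> S" "z \<in> S" "x \<le> y" "y \<le> z"
  shows "(z - x) * g y \<ge> (z - y) * g x + (y - x) * g z"
  using convex_on_three_point[OF assms(1)[unfolded concave_on_def] assms(2-5)] by simp

lemma gamma_ratio_rem_concave:
  assumes "x > 0" "1/2 \<le> a" "a \<le> b" "b \<le> c" "c < x + 1"
  shows "(c - a) * gamma_ratio_rem b x \<ge> (c - b) * gamma_ratio_rem a x + (b - a) * gamma_ratio_rem c x"
proof -
  have "concave_on {a..c} (\<lambda>t. ln_Gamma (x + t) - ln_Gamma (x + 1 - t))"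
    using assms by (intro ln_Gamma_diff_concave) auto
  from concave_three_point[OF this, of a c b] show ?thesis
    using assms by (simp add: gamma_ratio_rem_def algebra_simps)
qed

text \<open>The unit shift contributes 1 - t^2/x^2; over all x = m/\<alpha> these are the factors of
  Euler's product for sin (pi \<alpha> t). This is the source of the difference equation
  \<open>log_dsine_plus_1\<close>.\<close>

lemma gamma_ratio_rem_plus1:
  assumes "0 < t" "t < x"
  shows "gamma_ratio_rem (t + 1) x = gamma_ratio_rem t x + ln (1 - t\<^sup>2 / x\<^sup>2)"
proof -
  have "1 - t\<^sup>2 / x\<^sup>2 = (x + t) * (x - t) / x\<^sup>2" using assms by (simp add: field_simps power2_eq_square)
  then have "ln (1 - t\<^sup>2 / x\<^sup>2) = ln (x + t) + ln (x - t) - 2 * ln x"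
    using assms by (simp add: ln_div ln_mult_gt_0 ln_realpow)
  then show ?thesis
    using ln_Gamma_plus1[of "x + t"] ln_Gamma_plus1[of "x - t"] assms
    by (simp add: gamma_ratio_rem_def algebra_simps)
qed

lemma gamma_ratio_rem_half [simp]: "gamma_ratio_rem (1/2) x = 0"
  by (simp add: gamma_ratio_rem_def add.commute)

lemma gamma_ratio_rem_1 [simp]: "x > 0 \<Longrightarrow> gamma_ratio_rem 1 x = 0"
  using ln_Gamma_plus1[of x] by (simp add: gamma_ratio_rem_def)

lemma gamma_ratio_rem_refl: "gamma_ratio_rem (1 - t) x = - gamma_ratio_rem t x"
  by (simp add: gamma_ratio_rem_def algebra_simps)

text \<open>As a function of t it is concave on [1/2, 2] with zeros at 1/2 and 1 and value ln (1 -
  1/x^2) at 2, so chords bound it uniformly in t by a summable term.\<close>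

lemma gamma_ratio_rem_bound:
  assumes "x > 1" "1/2 \<le> t" "t \<le> 2"
  shows "\<bar>gamma_ratio_rem t x\<bar> \<le> - ln (1 - 1 / x\<^sup>2)"
proof -
  define l where "l = ln (1 - 1 / x\<^sup>2)"
  have r2: "gamma_ratio_rem 2 x = l"
    using gamma_ratio_rem_plus1[of 1 x] assms by (simp add: l_def)
  have l0: "l \<le> 0" unfolding l_def using assms
    by (intro ln_le_zero_iff[THEN iffD2]) (auto simp: field_simps one_less_power)
  show ?thesis
  proof (cases "t \<le> 1")
    case True
    have "(1 - 1/2) * gamma_ratio_rem t x \<ge> 0"
      using gamma_ratio_rem_concave[of x "1/2" t 1] assms True by simp
    moreover have "(2 - t) * gamma_ratio_rem 1 x \<ge> gamma_ratio_rem t x + (1 - t) * gamma_ratio_rem 2 x"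
      using gamma_ratio_rem_concave[of x t 1 2] assms True by simp
    moreover have "(1 - t) * l \<ge> 1 * l" using l0 assms True by (intro mult_right_mono_neg) auto
    ultimately show ?thesis using assms r2 unfolding l_def[symmetric] by simp
  next
    case False
    have "gamma_ratio_rem t x \<ge> (t - 1) * l"
      using gamma_ratio_rem_concave[of x 1 t 2] assms False r2 by simp
    moreover have "(t - 1/2) * gamma_ratio_rem 1 x \<ge> 1/2 * gamma_ratio_rem t x"
      using gamma_ratio_rem_concave[of x "1/2" 1 t] assms False by simp
    moreover have "(t - 1) * l \<ge> 1 * l" using l0 assms False by (intro mult_right_mono_neg) auto
    ultimately show ?thesis using assms unfolding l_def[symmetric] by simp
  qed
qed

lemma ln_sin_product_sums:
  assumes "0 < x" "x < (1::real)"
  shows "(\<lambda>m. ln (1 - x\<^sup>2 / (real (Suc m))\<^sup>2)) sums ln (sin (pi * x) / (pi * x))"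
proof -
  have pos: "1 - x\<^sup>2 / (real (Suc m))\<^sup>2 > 0" for m
  proof -
    have "x\<^sup>2 < 1" using assms by (simp add: power_less_one_iff abs_square_less_1)
    also have "1 \<le> (real (Suc m))\<^sup>2" by simp
    finally show ?thesis by simp
  qed
  have s: "sin (pi * x) > 0" using assms by (intro sin_gt_zero) auto
  have eq: "(\<Prod>k=1..n. 1 - x^2 / of_nat k^2) = exp (\<Sum>m<n. ln (1 - x\<^sup>2 / (real (Suc m))\<^sup>2))" for n
    by (induction n) (use pos in \<open>auto simp: exp_add mult_ac simp del: of_nat_Suc\<close>)
  have "(\<lambda>n. exp (\<Sum>m<n. ln (1 - x\<^sup>2 / (real (Suc m))\<^sup>2))) \<longlonglongrightarrow> sin (pi * x) / (pi * x)"
    using sin_product_formula_real'[of x] assms unfolding eq by simp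
  then have "(\<lambda>n. ln (exp (\<Sum>m<n. ln (1 - x\<^sup>2 / (real (Suc m))\<^sup>2)))) \<longlonglongrightarrow> ln (sin (pi * x) / (pi * x))"
    using s assms by (intro tendsto_ln) auto
  then show ?thesis by (simp add: sums_def)
qed

text \<open>The linear term is exactly what turns sin z / z with z = pi \<alpha> t, together with
  the ln t coming from \<open>ln_Gamma\<close>, into ln (2 sin z) under a unit shift.\<close>

definition log_dsine_rem :: "real \<Rightarrow> real \<Rightarrow> real" where
  "log_dsine_rem \<alpha> t = (t - 1) * ln (2 * pi * \<alpha>) + (\<Sum>m. gamma_ratio_rem t (real (Suc m) / \<alpha>))"

text \<open>In terms of the double sine function with periods \<open>1\<close> and \<open>\<alpha>\<close>, normalised to vanish
  at \<open>0\<close>, this is \<open>- ln S\<^sub>2(\<alpha>t) - ln \<alpha> / 2\<close>. Taking \<open>t\<close> rather than \<open>\<alpha>t\<close> as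
  the argument makes the comparison with \<open>ln \<Gamma>(t)\<close> visible.\<close>

definition log_dsine :: "real \<Rightarrow> real \<Rightarrow> real" where
  "log_dsine \<alpha> t = ln_Gamma t + log_dsine_rem \<alpha> t"

text \<open>The uniform bound settles [1/2, 2]. Larger t are reached by unit shifts, each adding a
  convergent sine series, and t < 1/2 by the antisymmetry under t to 1 - t.\<close>

lemma gamma_ratio_rem_summable:
  assumes "0 < \<alpha>" "\<alpha> < 1" "0 < t" "t < 1 / \<alpha> + 1"
  shows "summable (\<lambda>m. gamma_ratio_rem t (real (Suc m) / \<alpha>))"
proof -
  have base: "summable (\<lambda>m. gamma_ratio_rem t (real (Suc m) / \<alpha>))" if "1/2 \<le> t" "t \<le> 2" for t
  proof (rule summable_comparison_test')
    show "summable (\<lambda>m. - ln (1 - \<alpha>\<^sup>2 / (real (Suc m))\<^sup>2))"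
      using ln_sin_product_sums[OF assms(1,2)] by (intro summable_minus) (auto simp: sums_iff)
    fix m :: nat
    have "real (Suc m) / \<alpha> > 1" using assms by (simp add: field_simps)
    from gamma_ratio_rem_bound[OF this that]
    show "norm (gamma_ratio_rem t (real (Suc m) / \<alpha>)) \<le> - ln (1 - \<alpha>\<^sup>2 / (real (Suc m))\<^sup>2)"
      using assms by (simp add: power_divide)
  qed
  have ind: "summable (\<lambda>m. gamma_ratio_rem t (real (Suc m) / \<alpha>))"
    if "1/2 \<le> t" "t \<le> 2 + real n" "t < 1/\<alpha> + 1" for n t
    using that
  proof (induction n arbitrary: t)
    case (Suc n)
    show ?case
    proof (cases "t \<le> 2")
      case True then show ?thesis using base Suc.prems by blast
    next
      case False
      define u where "u = t - 1"
      have u: "1 < u" "u < 1/\<alpha>" using False Suc.prems by (auto simp: u_def)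
      have a: "summable (\<lambda>m. gamma_ratio_rem u (real (Suc m) / \<alpha>))"
        using Suc.prems False by (intro Suc.IH) (auto simp: u_def)
      have b: "summable (\<lambda>m. ln (1 - (u*\<alpha>)\<^sup>2 / (real (Suc m))\<^sup>2))"
        using ln_sin_product_sums[of "u*\<alpha>"] u assms by (auto simp: sums_iff field_simps)
      have "gamma_ratio_rem t (real (Suc m) / \<alpha>) = gamma_ratio_rem u (real (Suc m) / \<alpha>)
           + ln (1 - (u*\<alpha>)\<^sup>2 / (real (Suc m))\<^sup>2)" for m
      proof -
        have "1/\<alpha> \<le> real (Suc m)/\<alpha>" using assms by (intro divide_right_mono) auto
        then have "gamma_ratio_rem (u+1) (real (Suc m) / \<alpha>) = gamma_ratio_rem u (real (Suc m) / \<alpha>)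
            + ln (1 - u\<^sup>2 / (real (Suc m) / \<alpha>)\<^sup>2)"
          using u by (intro gamma_ratio_rem_plus1) linarith+
        then show ?thesis using assms by (simp add: u_def power_divide power_mult_distrib)
      qed
      then show ?thesis using summable_add[OF a b] by simp
    qed
  qed (use base in auto)
  show ?thesis
  proof (cases "t < 1/2")
    case True
    have "summable (\<lambda>m. - gamma_ratio_rem (1 - t) (real (Suc m) / \<alpha>))"
      using True assms by (intro summable_minus base) auto
    then show ?thesis by (simp add: gamma_ratio_rem_refl)
  next
    case False
    obtain n where "t < real n" using reals_Archimedean2 by blast
    then show ?thesis using False assms by (intro ind[of t n]) auto
  qed
qed

lemma log_dsine_plus_1:
  assumes "0 < \<alpha>" "\<alpha> < 1" "0 < t" "t < 1 / \<alpha>"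
  shows "log_dsine \<alpha> (t + 1) = log_dsine \<alpha> t + ln (2 * sin (pi * \<alpha> * t))"
proof -
  have ta: "0 < \<alpha> * t" "\<alpha> * t < 1" using assms by (auto simp: field_simps)
  have s: "sin (pi * (\<alpha> * t)) > 0" using ta by (intro sin_gt_zero) auto
  have eq: "gamma_ratio_rem (t+1) (real (Suc m) / \<alpha>)
     = gamma_ratio_rem t (real (Suc m) / \<alpha>) + ln (1 - (\<alpha>*t)\<^sup>2 / (real (Suc m))\<^sup>2)" for m
  proof -
    have "1/\<alpha> \<le> real (Suc m)/\<alpha>" using assms by (intro divide_right_mono) auto
    then have "gamma_ratio_rem (t+1) (real (Suc m) / \<alpha>) = gamma_ratio_rem t (real (Suc m) / \<alpha>)
            + ln (1 - t\<^sup>2 / (real (Suc m) / \<alpha>)\<^sup>2)"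
      using assms by (intro gamma_ratio_rem_plus1) linarith+
    then show ?thesis using assms by (simp add: power_divide power_mult_distrib mult.commute)
  qed
  have "(\<Sum>m. gamma_ratio_rem (t+1) (real (Suc m) / \<alpha>))
     = (\<Sum>m. gamma_ratio_rem t (real (Suc m) / \<alpha>)) + ln (sin (pi * (\<alpha>*t)) / (pi * (\<alpha>*t)))"
    unfolding eq using ln_sin_product_sums[OF ta] gamma_ratio_rem_summable[OF assms(1-3)] assms
    by (subst suminf_add[symmetric]) (auto simp: sums_iff)
  then show ?thesis unfolding log_dsine_def log_dsine_rem_def using assms s ta ln_Gamma_plus1[of t]
    by (simp add: ln_div ln_mult_gt_0 algebra_simps)
qed

lemma log_dsine_1 [simp]: "0 < \<alpha> \<Longrightarrow> log_dsine \<alpha> 1 = 0"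
  by (simp add: log_dsine_def log_dsine_rem_def)

text \<open>The same partial sums regrouped: Gamma(mX + t) is paired with Gamma((m + 1)X + 1 - t)
  instead of Gamma(mX + 1 - t). Now every summand is convex up to the centre (X + 1)/2 and changes
  sign under t to X + 1 - t, which yields both the convexity and the reflection formula.\<close>

definition log_dsine_partial :: "real \<Rightarrow> nat \<Rightarrow> real \<Rightarrow> real" where
  "log_dsine_partial X M t = (\<Sum>m<M. ln_Gamma (real m * X + t) - ln_Gamma (real (Suc m) * X + 1 - t))
     + ln_Gamma (real M * X + t)"

lemma log_dsine_partial_eq:
  "ln_Gamma t + (t - 1) * c + (\<Sum>m<M. gamma_ratio_rem t (real (Suc m) * X))
    = log_dsine_partial X M t + (t - 1) * c - (2 * t - 1) * (\<Sum>m<M. ln (real (Suc m) * X))"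
  by (induction M) (simp_all add: log_dsine_partial_def gamma_ratio_rem_def algebra_simps)

lemma log_dsine_LIMSEQ:
  assumes "0 < \<alpha>" "\<alpha> < 1" "0 < t" "t < 1 / \<alpha> + 1"
  shows "(\<lambda>M. log_dsine_partial (1/\<alpha>) M t + (t - 1) * ln (2*pi*\<alpha>)
      - (2 * t - 1) * (\<Sum>m<M. ln (real (Suc m) / \<alpha>))) \<longlonglongrightarrow> log_dsine \<alpha> t"
proof -
  have "(\<lambda>M. ln_Gamma t + (t - 1) * ln (2*pi*\<alpha>) + (\<Sum>m<M. gamma_ratio_rem t (real (Suc m) / \<alpha>)))
     \<longlonglongrightarrow> ln_Gamma t + (t - 1) * ln (2*pi*\<alpha>) + (\<Sum>m. gamma_ratio_rem t (real (Suc m) / \<alpha>))"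
    by (intro tendsto_intros summable_LIMSEQ gamma_ratio_rem_summable assms)
  moreover have "ln_Gamma t + (t - 1) * ln (2*pi*\<alpha>) + (\<Sum>m<M. gamma_ratio_rem t (real (Suc m) / \<alpha>))
     = log_dsine_partial (1/\<alpha>) M t + (t - 1) * ln (2*pi*\<alpha>)
      - (2 * t - 1) * (\<Sum>m<M. ln (real (Suc m) / \<alpha>))" for M
    using log_dsine_partial_eq[where t = t and c = "ln (2*pi*\<alpha>)" and X = "1/\<alpha>" and M = M] by simp
  ultimately show ?thesis unfolding log_dsine_def log_dsine_rem_def by (simp only: add.assoc)
qed

lemma convex_on_affine: "convex_on {a..b} (\<lambda>t. u * t + v)" for a b u v :: real
  by (rule f''_ge0_imp_convex[where f' = "\<lambda>_. u" and f'' = "\<lambda>_. 0"]) (auto intro!: derivative_eq_intros)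

lemma log_dsine_partial_convex:
  assumes "X > 0" "0 < a" "2 * b \<le> X + 1" "b < X + 1"
  shows "convex_on {a..b} (log_dsine_partial X M)"
proof -
  have summand: "convex_on {a..b} (\<lambda>t. ln_Gamma (real m * X + t) - ln_Gamma (real (Suc m) * X + 1 - t))" for m
  proof -
    have "real m * X \<ge> 0" using assms by simp
    moreover have "real (Suc m) * X = real m * X + X" by (simp add: algebra_simps)
    ultimately show ?thesis using assms by (intro ln_Gamma_diff_convex) linarith+
  qed
  have g: "convex_on {a..b} (\<lambda>t. ln_Gamma (real M * X + t))" for M
  proof (rule f''_ge0_imp_convex[where f' = "\<lambda>t. Digamma (real M * X + t)" and f'' = "\<lambda>t. Polygamma 1 (real M * X + t)"])
    fix t assume t: "t \<in> {a..b}"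
    then have p: "real M * X + t > 0" using assms by (intro add_nonneg_pos) auto
    then have p': "real M * X + t \<notin> \<int>\<^sub>\<le>\<^sub>0" by (auto elim!: nonpos_Ints_cases)
    show "((\<lambda>t. ln_Gamma (real M * X + t)) has_real_derivative Digamma (real M * X + t)) (at t)"
      "((\<lambda>t. Digamma (real M * X + t)) has_real_derivative Polygamma 1 (real M * X + t)) (at t)"
      using p p' by (auto intro!: derivative_eq_intros)
    show "0 \<le> Polygamma 1 (real M * X + t)" using Polygamma_real_odd_pos[OF p'] by (simp add: less_imp_le)
  qed simp
  have "convex_on {a..b} (\<lambda>t. \<Sum>m<N. ln_Gamma (real m * X + t) - ln_Gamma (real (Suc m) * X + 1 - t))" for N
  proof (induction N)
    case 0 then show ?case using convex_on_affine[of a b 0 0] by simp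
  next
    case (Suc N) then show ?case using convex_on_add[OF Suc summand[of N]] by simp
  qed
  from convex_on_add[OF this g] show ?thesis unfolding log_dsine_partial_def[abs_def] by simp
qed

text \<open>A limit of convex functions: the partial sums differ from
  \<open>log_dsine_partial\<close> only by terms affine in t, which drop out of the three-point
  inequality.\<close>

theorem log_dsine_convex:
  assumes "0 < \<alpha>" "\<alpha> < 1" "0 < x" "x \<le> y" "y \<le> z" "2 * z \<le> 1 / \<alpha> + 1"
  shows "(z - x) * log_dsine \<alpha> y \<le> (z - y) * log_dsine \<alpha> x + (y - x) * log_dsine \<alpha> z"
proof -
  define P where "P = (\<lambda>M t. log_dsine_partial (1/\<alpha>) M t + (t - 1) * ln (2*pi*\<alpha>)
      - (2 * t - 1) * (\<Sum>m<M. ln (real (Suc m) / \<alpha>)))"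
  have z: "z < 1/\<alpha> + 1" using assms by (smt (verit) divide_pos_pos)
  have lim: "(\<lambda>M. P M t) \<longlonglongrightarrow> log_dsine \<alpha> t" if "x \<le> t" "t \<le> z" for t
    unfolding P_def using that assms z by (intro log_dsine_LIMSEQ) auto
  have "(z - x) * P M y \<le> (z - y) * P M x + (y - x) * P M z" for M
    using convex_on_three_point[OF log_dsine_partial_convex[of "1/\<alpha>" x z M], of x z y] assms z
    by (simp add: P_def algebra_simps)
  then show ?thesis
    by (intro LIMSEQ_le[of "\<lambda>M. (z - x) * P M y" _ "\<lambda>M. (z - y) * P M x + (y - x) * P M z"])
       (use assms in \<open>auto intro!: tendsto_intros lim\<close>)
qed

text \<open>For t \<ge> 1/2 every summand is concave because x + 1 - t \<le> x + t, and the
  three-point inequality passes to the series.\<close>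

theorem log_dsine_rem_concave:
  assumes "0 < \<alpha>" "\<alpha> < 1" "1/2 \<le> x" "x \<le> y" "y \<le> z" "z < 1 / \<alpha> + 1"
  shows "(z - x) * log_dsine_rem \<alpha> y \<ge> (z - y) * log_dsine_rem \<alpha> x + (y - x) * log_dsine_rem \<alpha> z"
proof -
  define P where "P = (\<lambda>M t. (\<Sum>m<M. gamma_ratio_rem t (real (Suc m) / \<alpha>)))"
  define Q where "Q = (\<lambda>t. \<Sum>m. gamma_ratio_rem t (real (Suc m) / \<alpha>))"
  have lim: "(\<lambda>M. P M t) \<longlonglongrightarrow> Q t" if "x \<le> t" "t \<le> z" for t
    unfolding P_def Q_def using that assms by (intro summable_LIMSEQ gamma_ratio_rem_summable) auto
  have "(z - x) * P M y \<ge> (z - y) * P M x + (y - x) * P M z" for M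
  proof (induction M)
    case (Suc M)
    have "1/\<alpha> \<le> real (Suc M)/\<alpha>" using assms by (intro divide_right_mono) auto
    then have "z < real (Suc M)/\<alpha> + 1" "real (Suc M) / \<alpha> > 0" using assms by auto
    then have "(z - x) * gamma_ratio_rem y (real (Suc M) / \<alpha>) \<ge>
       (z - y) * gamma_ratio_rem x (real (Suc M) / \<alpha>) + (y - x) * gamma_ratio_rem z (real (Suc M) / \<alpha>)"
      using assms by (intro gamma_ratio_rem_concave) auto
    then show ?case using Suc by (simp add: P_def algebra_simps)
  qed (simp add: P_def)
  then have "(z - x) * Q y \<ge> (z - y) * Q x + (y - x) * Q z"
    by (intro LIMSEQ_le[of "\<lambda>M. (z - y) * P M x + (y - x) * P M z" _ "\<lambda>M. (z - x) * P M y"])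
       (use assms in \<open>auto intro!: tendsto_intros lim\<close>)
  note Qc = this
  have Qeq: "log_dsine_rem \<alpha> t = (t - 1) * ln (2 * pi * \<alpha>) + Q t" for t
    by (simp add: log_dsine_rem_def Q_def)
  show ?thesis unfolding Qeq using Qc by (simp add: algebra_simps)
qed

text \<open>Evaluates by Stirling's formula the two boundary terms that survive when the partial
  sums at t and X + 1 - t are added.\<close>

lemma ln_Gamma_sum_limit:
  assumes "X > 0" "s > 0" "r > 0" "s + r = X + 1"
  shows "(\<lambda>M. ln_Gamma (real M * X + s) + ln_Gamma (real M * X + r) - 2 * X * (\<Sum>m<M. ln (real (Suc m) * X)))
     \<longlonglongrightarrow> X * ln X - (X - 1) * ln (2 * pi)"
proof -
  have fl: "filterlim (\<lambda>M. real M * X + u) at_top sequentially" for u using assms by real_asymp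
  define R where "R = (\<lambda>M. stirling_rem (real M * X + s) + stirling_rem (real M * X + r) - 2 * X * stirling_rem (real M))"
  define T where "T = (\<lambda>M. X * ln X + ((real M * X + s - 1/2) * ln (1 + s / (real M * X)) - s)
       + ((real M * X + r - 1/2) * ln (1 + r / (real M * X)) - r))"
  have l: "(\<lambda>M. (real M * X + u - 1/2) * ln (1 + u / (real M * X)) - u) \<longlonglongrightarrow> 0" if "u > 0" for u
    using that assms by real_asymp
  have T: "T \<longlonglongrightarrow> X * ln X + 0 + 0" unfolding T_def
    using assms by (intro tendsto_add tendsto_const l) auto
  have R: "R \<longlonglongrightarrow> ln (2*pi)/2 + ln (2*pi)/2 - 2 * X * (ln (2*pi)/2)" unfolding R_def
    by (intro tendsto_intros filterlim_compose[OF stirling_rem_tendsto fl] stirling_rem_nat)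
  have lf: "(\<Sum>m<M. ln (real (Suc m) * X)) = ln_Gamma (real M) + ln (real M) + real M * ln X" if "M > 0" for M
    using that
  proof (induction M)
    case (Suc M)
    then show ?case
    proof (cases "M = 0")
      case False
      have "ln_Gamma (real (Suc M)) = ln_Gamma (real M) + ln (real M)"
        using ln_Gamma_plus1[of "real M"] False by (simp add: add.commute)
      moreover have "ln (real (Suc M) * X) = ln (real (Suc M)) + ln X"
        using assms by (intro ln_mult_gt_0) auto
      ultimately show ?thesis using Suc False by (simp add: algebra_simps del: of_nat_Suc)
        (simp add: algebra_simps)
    qed (simp add: assms)
  qed simp
  have eq: "\<forall>\<^sub>F M in sequentially. R M + T M =
     ln_Gamma (real M * X + s) + ln_Gamma (real M * X + r) - 2 * X * (\<Sum>m<M. ln (real (Suc m) * X))"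
    using eventually_gt_at_top[of 0]
  proof eventually_elim
    case (elim M)
    have M: "real M > 0" using elim by simp
    have le: "ln (real M * X + u) = ln (real M) + ln X + ln (1 + u / (real M * X))" if "u > 0" for u
    proof -
      have "real M * X + u = real M * X * (1 + u / (real M * X))" using M assms by (simp add: field_simps)
      then show ?thesis using M assms that by (simp add: ln_mult_gt_0 add_pos_pos)
    qed
    have r: "r = X + 1 - s" using assms by simp
    show ?case unfolding R_def T_def stirling_rem_def lf[OF elim] le[OF assms(2)] le[OF assms(3)]
      by (simp add: r algebra_simps)
  qed
  have "(\<lambda>M. R M + T M) \<longlonglongrightarrow> ln (2*pi)/2 + ln (2*pi)/2 - 2 * X * (ln (2*pi)/2) + (X * ln X + 0 + 0)"
    by (intro tendsto_add R T)
  then show ?thesis using tendsto_cong[OF eq] by (simp add: algebra_simps)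
qed

text \<open>The paired summands cancel between t and X + 1 - t. Only two Gamma factors at the far
  end remain, and their normalised limit does not depend on t.\<close>

theorem log_dsine_refl:
  assumes "0 < \<alpha>" "\<alpha> < 1" "0 < t" "t < 1 / \<alpha> + 1"
  shows "log_dsine \<alpha> t + log_dsine \<alpha> (1 / \<alpha> + 1 - t) = - ln \<alpha>"
proof -
  define X where "X = 1/\<alpha>"
  have X: "X > 0" and lX: "ln X = - ln \<alpha>" using assms by (auto simp: X_def ln_div)
  define c where "c = (\<lambda>M. \<Sum>m<M. ln (real (Suc m) * X))"
  define L where "L = ln (2 * pi * \<alpha>)"
  have Lv: "L = ln (2*pi) - ln X" using assms by (simp add: L_def lX ln_mult_gt_0)
  have a: "(\<lambda>M. log_dsine_partial X M t + (t - 1) * L - (2 * t - 1) * c M) \<longlonglongrightarrow> log_dsine \<alpha> t"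
    using log_dsine_LIMSEQ[OF assms] by (simp add: X_def L_def c_def)
  have b: "(\<lambda>M. log_dsine_partial X M (X + 1 - t) + (X + 1 - t - 1) * L - (2 * (X + 1 - t) - 1) * c M)
      \<longlonglongrightarrow> log_dsine \<alpha> (X + 1 - t)"
    using log_dsine_LIMSEQ[OF assms(1,2), of "X + 1 - t"] assms by (simp add: X_def L_def c_def)
  have p: "log_dsine_partial X M t + log_dsine_partial X M (X + 1 - t)
     = ln_Gamma (real M * X + t) + ln_Gamma (real M * X + (X + 1 - t))" for M
  proof -
    have "(\<Sum>m<M. ln_Gamma (real m * X + t) - ln_Gamma (real (Suc m) * X + 1 - t))
        + (\<Sum>m<M. ln_Gamma (real m * X + (X + 1 - t)) - ln_Gamma (real (Suc m) * X + 1 - (X + 1 - t))) = 0"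
      by (induction M) (auto simp: algebra_simps)
    then show ?thesis unfolding log_dsine_partial_def by linarith
  qed
  have "(\<lambda>M. (ln_Gamma (real M * X + t) + ln_Gamma (real M * X + (X + 1 - t)) - 2 * X * c M) + (X - 1) * L)
     \<longlonglongrightarrow> X * ln X - (X - 1) * ln (2 * pi) + (X - 1) * L"
    unfolding c_def using assms X by (intro tendsto_add tendsto_const ln_Gamma_sum_limit) (auto simp: X_def)
  moreover have "(\<lambda>M. (log_dsine_partial X M t + (t - 1) * L - (2 * t - 1) * c M)
      + (log_dsine_partial X M (X + 1 - t) + (X + 1 - t - 1) * L - (2 * (X + 1 - t) - 1) * c M))
     = (\<lambda>M. (ln_Gamma (real M * X + t) + ln_Gamma (real M * X + (X + 1 - t)) - 2 * X * c M) + (X - 1) * L)"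
  proof
    fix M
    have "(t - 1) * L - (2 * t - 1) * c M + ((X + 1 - t - 1) * L - (2 * (X + 1 - t) - 1) * c M)
       = (X - 1) * L - 2 * X * c M" by (simp add: algebra_simps)
    then show "(log_dsine_partial X M t + (t - 1) * L - (2 * t - 1) * c M)
      + (log_dsine_partial X M (X + 1 - t) + (X + 1 - t - 1) * L - (2 * (X + 1 - t) - 1) * c M)
     = (ln_Gamma (real M * X + t) + ln_Gamma (real M * X + (X + 1 - t)) - 2 * X * c M) + (X - 1) * L"
      using p[of M] by linarith
  qed
  ultimately have "(\<lambda>M. (log_dsine_partial X M t + (t - 1) * L - (2 * t - 1) * c M)
      + (log_dsine_partial X M (X + 1 - t) + (X + 1 - t - 1) * L - (2 * (X + 1 - t) - 1) * c M))
      \<longlonglongrightarrow> X * ln X - (X - 1) * ln (2 * pi) + (X - 1) * L" by simp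
  from LIMSEQ_unique[OF tendsto_add[OF a b] this]
  have "log_dsine \<alpha> t + log_dsine \<alpha> (X + 1 - t) = X * ln X - (X - 1) * ln (2 * pi) + (X - 1) * L" .
  then show ?thesis unfolding Lv using lX by (simp add: X_def algebra_simps)
qed

text \<open>The second difference equation. Reflection takes t + 1/\<alpha> to 1 - t, and Euler's
  reflection formula links 1 - t with t because the \<open>gamma_ratio_rem\<close> series at these
  two points cancel.\<close>

lemma log_dsine_plus_period:
  assumes "0 < \<alpha>" "\<alpha> < 1" "0 < t" "t < 1"
  shows "log_dsine \<alpha> (t + 1 / \<alpha>) = log_dsine \<alpha> t + ln (2 * sin (pi * t))"
proof -
  have s: "sin (pi * t) > 0" using assms by (intro sin_gt_zero) auto
  have "1 - t < 1/\<alpha> + 1" using assms by (smt (verit) divide_pos_pos)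
  then have r: "log_dsine \<alpha> (1 - t) + log_dsine \<alpha> (t + 1/\<alpha>) = - ln \<alpha>"
    using log_dsine_refl[of \<alpha> "1 - t"] assms by (simp add: add.commute)
  have "(\<Sum>m. gamma_ratio_rem (1 - t) (real (Suc m) / \<alpha>)) = - (\<Sum>m. gamma_ratio_rem t (real (Suc m) / \<alpha>))"
    unfolding gamma_ratio_rem_refl using assms
    by (intro suminf_minus gamma_ratio_rem_summable) (auto intro: add_strict_increasing2)
  then have "log_dsine \<alpha> t + log_dsine \<alpha> (1 - t) = ln_Gamma t + ln_Gamma (1 - t) - ln (2*pi*\<alpha>)"
    by (simp add: log_dsine_def log_dsine_rem_def algebra_simps)
  also have "ln_Gamma t + ln_Gamma (1 - t) = ln (pi / sin (pi * t))"
  proof -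
    have "complex_of_real (Gamma t * Gamma (1 - t)) = of_real (pi / sin (pi * t))"
      using Gamma_reflection_complex[of "of_real t"]
      by (simp add: Gamma_complex_of_real[symmetric] sin_of_real[symmetric])
    then have "Gamma t * Gamma (1 - t) = pi / sin (pi * t)" using of_real_eq_iff by blast
    then show ?thesis using assms ln_mult_gt_0[of "Gamma t" "Gamma (1 - t)"] by (simp add: ln_Gamma_real_pos)
  qed
  finally show ?thesis using r assms s by (simp add: ln_div ln_mult_gt_0)
qed

text \<open>All values come from the two difference equations and the reflection at points that
  these maps exchange: 1/2 and 1/\<alpha> + 1/2, for instance, are one period apart and also mirror
  images, which determines both values.\<close>

lemma
  assumes "0 < \<alpha>" "\<alpha> < 1"
  shows log_dsine_period: "log_dsine \<alpha> (1 / \<alpha>) = - ln \<alpha>"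
    and log_dsine_half: "log_dsine \<alpha> (1 / 2) = - ln (2 * \<alpha>) / 2"
    and log_dsine_period_half: "log_dsine \<alpha> (1 / \<alpha> + 1 / 2) = ln (2 / \<alpha>) / 2"
    and log_dsine_half_period: "log_dsine \<alpha> (1 / (2 * \<alpha>) + 1) = ln (2 / \<alpha>) / 2"
    and log_dsine_centre: "log_dsine \<alpha> ((1 / \<alpha> + 1) / 2) = - ln \<alpha> / 2"
    and log_dsine_2: "log_dsine \<alpha> 2 = ln (2 * sin (pi * \<alpha>))"
proof -
  have X: "1 / \<alpha> > 1" using assms by simp
  show "log_dsine \<alpha> (1 / \<alpha>) = - ln \<alpha>" using log_dsine_refl[OF assms, of 1] X assms by simp
  have "log_dsine \<alpha> (1/2 + 1/\<alpha>) = log_dsine \<alpha> (1/2) + ln 2"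
    using log_dsine_plus_period[OF assms, of "1/2"] by simp
  moreover have "log_dsine \<alpha> (1/2) + log_dsine \<alpha> (1/\<alpha> + 1/2) = - ln \<alpha>"
    using log_dsine_refl[OF assms, of "1/2"] X by (simp add: algebra_simps)
  ultimately show "log_dsine \<alpha> (1 / 2) = - ln (2 * \<alpha>) / 2" "log_dsine \<alpha> (1 / \<alpha> + 1 / 2) = ln (2 / \<alpha>) / 2"
    using assms by (simp_all add: add.commute ln_mult_gt_0 ln_div)
  have "log_dsine \<alpha> (1/(2*\<alpha>) + 1) = log_dsine \<alpha> (1/(2*\<alpha>)) + ln 2"
    using log_dsine_plus_1[OF assms, of "1/(2*\<alpha>)"] assms by (simp add: field_simps)
  moreover have "log_dsine \<alpha> (1/(2*\<alpha>)) + log_dsine \<alpha> (1/(2*\<alpha>) + 1) = - ln \<alpha>"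
  proof -
    have "1/\<alpha> + 1 - 1/(2*\<alpha>) = 1/(2*\<alpha>) + 1" using assms by (simp add: field_simps)
    moreover have "1/(2*\<alpha>) < 1/\<alpha> + 1" using assms by (simp add: field_simps)
    ultimately show ?thesis using log_dsine_refl[OF assms, of "1/(2*\<alpha>)"] assms by simp
  qed
  ultimately show "log_dsine \<alpha> (1 / (2 * \<alpha>) + 1) = ln (2 / \<alpha>) / 2"
    using assms by (simp add: ln_div)
  have "1/\<alpha> + 1 - (1/\<alpha> + 1)/2 = (1/\<alpha> + 1)/2" by (simp add: field_simps)
  moreover have "log_dsine \<alpha> ((1/\<alpha> + 1)/2) + log_dsine \<alpha> (1/\<alpha> + 1 - (1/\<alpha> + 1)/2) = - ln \<alpha>"
    using X by (intro log_dsine_refl assms) auto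
  ultimately show "log_dsine \<alpha> ((1 / \<alpha> + 1) / 2) = - ln \<alpha> / 2" by (simp only:)
  show "log_dsine \<alpha> 2 = ln (2 * sin (pi * \<alpha>))"
    using log_dsine_plus_1[OF assms, of 1] X assms by simp
qed

lemma log_dsine_concave:
  assumes "0 < \<alpha>" "\<alpha> < 1" "1 / \<alpha> + 1 \<le> 2 * x" "x \<le> y" "y \<le> z" "z < 1 / \<alpha> + 1"
  shows "(z - x) * log_dsine \<alpha> y \<ge> (z - y) * log_dsine \<alpha> x + (y - x) * log_dsine \<alpha> z"
proof -
  define m where "m = 1 / \<alpha> + 1"
  have p: "0 < 1/\<alpha>" using assms by simp
  have r: "log_dsine \<alpha> (m - t) = - ln \<alpha> - log_dsine \<alpha> t" if "x \<le> t" "t \<le> z" for t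
    using log_dsine_refl[OF assms(1,2), of t] that assms p by (simp add: m_def)
  have "((m - x) - (m - z)) * log_dsine \<alpha> (m - y)
     \<le> ((m - x) - (m - y)) * log_dsine \<alpha> (m - z) + ((m - y) - (m - z)) * log_dsine \<alpha> (m - x)"
    using assms by (intro log_dsine_convex) (auto simp: m_def)
  then show ?thesis using assms by (simp add: r algebra_simps)
qed

section \<open>Numerical constants\<close>

lemma ln_2_bounds: "ln (2::real) > 6931/10000" "ln (2::real) < 69315/100000"
proof -
  have "ln (2::real) \<ge> 6931/10000 + 1/100000 \<and> ln 2 \<le> (693148/1000000::real)"
    using ln_approx_bounds[of 2 5] by (simp add: lessThan_nat_numeral lessThan_Suc power_divide)
  then show "ln (2::real) > 6931/10000" "ln (2::real) < 69315/100000" by linarith+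
qed

lemma euler_mascheroni_less: "(euler_mascheroni :: real) < 29/50"
  and euler_mascheroni_gt: "(euler_mascheroni :: real) > 57/100"
proof -
  have "ln (real (Suc 15)) = 4 * ln 2" using ln_realpow[of 2 4] by simp
  then have "ln (real (Suc 15)) \<in> {4*(6931/10000)<..<4*(69315/100000)}" using ln_2_bounds by simp
  from euler_mascheroni_bounds'[OF _ this]
  show "(euler_mascheroni :: real) < 29/50" by (simp add: harm_expand)
  show "(euler_mascheroni :: real) > 57/100" using euler_mascheroni_gt_19_over_33 by simp
qed

lemma ln_pi_bounds: "ln pi > 109/100" "ln pi < 1146/1000"
proof -
  have "ln (22/7 :: real) \<le> 11459/10000"
    using ln_approx_bounds[of "22/7" 4] by (simp add: lessThan_nat_numeral lessThan_Suc power_divide)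
  moreover have "ln (3::real) \<ge> 1095/1000"
    using ln_approx_bounds[of 3 3] by (simp add: lessThan_nat_numeral lessThan_Suc power_divide)
  moreover have "ln (3::real) \<le> ln pi" "ln pi \<le> ln (22/7::real)" using pi_approx by simp_all
  ultimately show "ln pi > 109/100" "ln pi < 1146/1000" by linarith+
qed

lemma ln_Gamma_tangent:
  assumes "x > 0" "t > (0::real)"
  shows "ln_Gamma t \<ge> ln_Gamma x + Digamma x * (t - x)"
proof -
  have d: "(ln_Gamma has_real_derivative Digamma x) (at x within {0<..})"
    using assms by (intro has_field_derivative_at_within[OF has_field_derivative_ln_Gamma_real])
  have "x \<in> interior {0<..}" using assms by (simp add: interior_open)
  then have "ln_Gamma t - ln_Gamma x \<ge> Digamma x * (t - x)"
    using convex_on_imp_above_tangent[OF convex_on_ln_Gamma _ _ _ d, of t] assms by simp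
  then show ?thesis by linarith
qed

lemma ln_Gamma_2 [simp]: "ln_Gamma (2::real) = 0"
  using ln_Gamma_plus1[of 1] by simp

lemma ln_Gamma_three_halves: "ln_Gamma (3/2 :: real) < - 12/100"
proof -
  have "ln_Gamma (3/2 :: real) = ln pi / 2 - ln 2"
    using ln_Gamma_plus1[of "1/2"] by (simp add: ln_Gamma_real_pos Gamma_one_half_real ln_sqrt ln_div)
  then show ?thesis using ln_pi_bounds ln_2_bounds by linarith
qed

lemma Digamma_2: "Digamma (2::real) = 1 - euler_mascheroni"
  using Digamma_plus1[of "1::real"] by simp

text \<open>Trapezoidal rule for the integral of 1/u over [1, x], an overestimate because 1/u is
  convex; \<open>ln_lower_sym\<close> is the midpoint rule, an underestimate.\<close>

lemma ln_upper_sym: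
  assumes "x \<ge> (1::real)" shows "ln x \<le> (x - 1) * (x + 1) / (2 * x)"
proof -
  have "ln (1 + (x - 1)) - ln 1 \<le> (x - 1) * (inverse 1 + inverse (1 + (x - 1))) / 2"
    using assms ln_inverse_approx_le[of 1 "x - 1"] by (cases "x = 1") auto
  then show ?thesis using assms by (simp add: field_simps)
qed

lemma ln_lower_sym:
  assumes "x \<ge> (1::real)" shows "ln x \<ge> 2 * (x - 1) / (x + 1)"
  using ln_inverse_approx_ge[of 1 x] assms by (cases "x = 1") (auto simp: add.commute)

lemma ln_two_sin_concave:
  assumes "0 < x" "x \<le> y" "y \<le> z" "z < (1::real)"
  shows "(z - x) * ln (2 * sin (pi * y)) \<ge> (z - y) * ln (2 * sin (pi * x)) + (y - x) * ln (2 * sin (pi * z))"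
proof -
  have p: "sin (pi * t) > 0" if "t \<in> {0<..<1}" for t using that by (intro sin_gt_zero) auto
  have "concave_on {0<..<1} (\<lambda>t. ln (2 * sin (pi * t)))"
  proof (rule f''_le0_imp_concave[where f' = "\<lambda>t. pi * (cos (pi * t) / sin (pi * t))"
        and f'' = "\<lambda>t. - (pi\<^sup>2 / (sin (pi * t))\<^sup>2)"])
    fix t :: real assume t: "t \<in> {0<..<1}"
    show "((\<lambda>t. ln (2 * sin (pi * t))) has_real_derivative pi * (cos (pi * t) / sin (pi * t))) (at t)"
      using p[OF t] by (auto intro!: derivative_eq_intros simp: field_simps)
    define s c where "s = sin (pi * t)" and "c = cos (pi * t)"
    have s: "s > 0" using p[OF t] by (simp add: s_def)
    have "((\<lambda>t. pi * (cos (pi * t) / sin (pi * t))) has_real_derivative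
        pi * (((- sin (pi * t) * pi) * sin (pi * t) - cos (pi * t) * (cos (pi * t) * pi)) / (sin (pi * t) * sin (pi * t)))) (at t)"
      using p[OF t] by (auto intro!: derivative_eq_intros simp: field_simps)
    moreover have "pi * (((- s * pi) * s - c * (c * pi)) / (s * s)) = - (pi\<^sup>2 * ((s * s + c * c) / (s * s)))"
      using s by (simp add: field_simps power2_eq_square)
    moreover have "s * s + c * c = 1"
      using sin_cos_squared_add[of "pi * t"] by (simp add: s_def c_def power2_eq_square)
    ultimately show "((\<lambda>t. pi * (cos (pi * t) / sin (pi * t))) has_real_derivative - (pi\<^sup>2 / (sin (pi * t))\<^sup>2)) (at t)"
      unfolding s_def c_def by (simp add: power2_eq_square)
    show "- (pi\<^sup>2 / (sin (pi * t))\<^sup>2) \<le> 0" by simp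
  qed simp
  from concave_three_point[OF this, of x z y] show ?thesis using assms by simp
qed

lemma ln_two_sin_ge:
  assumes "1/4 \<le> \<alpha>" "\<alpha> \<le> (1/2::real)"
  shows "ln (2 * sin (pi * \<alpha>)) \<ge> 138/100 * \<alpha>"
proof -
  have a: "ln (2 * sin (pi * (1/4))) = ln 2 / 2"
    by (simp add: sin_45 ln_sqrt)
  have b: "ln (2 * sin (pi * (1/2))) = ln 2" by simp
  have A: "(1/2 - 1/4) * ln (2 * sin (pi * \<alpha>)) \<ge> (1/2 - \<alpha>) * (ln 2 / 2) + (\<alpha> - 1/4) * ln 2"
    using ln_two_sin_concave[of "1/4" \<alpha> "1/2"] assms unfolding a b by simp
  have B: "(1/2 - 1/4) * (2 * \<alpha> * ln 2) = (1/2 - \<alpha>) * (ln 2 / 2) + (\<alpha> - 1/4) * ln 2"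
    by (simp add: field_simps)
  have "ln (2 * sin (pi * \<alpha>)) \<ge> 2 * \<alpha> * ln 2" using ord_eq_le_trans[OF B A] by simp
  moreover have "2 * \<alpha> * ln 2 \<ge> 2 * \<alpha> * (69/100)" using assms ln_2_bounds by (intro mult_left_mono) auto
  ultimately show ?thesis by simp
qed

section \<open>The lower bound for digits at most three\<close>

text \<open>The potential of the lower bound: \<open>pot_lower\<close> is evaluated at \<open>d = y - \<alpha>\<close>. The slopes
  are dictated by the linearisation at \<open>d = 0\<close>; the cap keeps it below
  \<open>ln (2/\<alpha>) / 2\<close>.\<close>

definition pot_lower :: "real \<Rightarrow> real" where
  "pot_lower d = (if d < 0 then - (29/50) * d else min (138/100 * d) (461/1000))"

lemma pot_lower_nonneg: "0 \<le> pot_lower d"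
  by (simp add: pot_lower_def)

lemma pot_lower_le_cap: "d \<ge> 0 \<Longrightarrow> pot_lower d \<le> 461/1000"
  by (simp add: pot_lower_def)

lemma pot_lower_le_lin: "d \<ge> 0 \<Longrightarrow> pot_lower d \<le> 138/100 * d"
  by (simp add: pot_lower_def)

lemma log_dsine_rem_at:
  assumes "0 < \<alpha>" "\<alpha> < 1"
  shows "log_dsine_rem \<alpha> 1 = 0" "log_dsine_rem \<alpha> 2 = ln (2 * sin (pi * \<alpha>))"
    "log_dsine_rem \<alpha> (1/2) = - ln (2 * pi * \<alpha>) / 2"
    "log_dsine_rem \<alpha> (1/\<alpha>) = - ln \<alpha> - ln_Gamma (1/\<alpha>)"
  using log_dsine_1[of \<alpha>] log_dsine_2[OF assms] log_dsine_half[OF assms] log_dsine_period[OF assms] assms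
  by (simp_all add: log_dsine_def ln_Gamma_real_pos Gamma_one_half_real ln_sqrt ln_mult_gt_0)

lemma log_dsine_ge_between_1_2:
  assumes "0 < \<alpha>" "\<alpha> < 1" "1 \<le> t" "t \<le> 2"
  shows "log_dsine \<alpha> t \<ge> ln_Gamma t + (t - 1) * ln (2 * sin (pi * \<alpha>))"
proof -
  have "2 < 1/\<alpha> + 1" using assms by simp
  then show ?thesis
    using log_dsine_rem_concave[of \<alpha> 1 t 2] assms by (simp add: log_dsine_rem_at log_dsine_def)
qed

text \<open>Both ends of the range carry the same explicit value, and \<open>log_dsine\<close> is
  concave between them.\<close>

lemma log_dsine_plateau:
  assumes "0 < \<alpha>" "\<alpha> < 1" "1 / \<alpha> / 2 + 1 \<le> t" "t \<le> 1 / \<alpha> + 1/2"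
  shows "log_dsine \<alpha> t \<ge> ln (2 / \<alpha>) / 2"
proof -
  define X v where "X = 1 / \<alpha>" and "v = ln (2 / \<alpha>) / 2"
  have X: "X > 1" using assms by (simp add: X_def)
  have v: "log_dsine \<alpha> (X/2 + 1) = v" "log_dsine \<alpha> (X + 1/2) = v"
    using log_dsine_half_period[OF assms(1,2)] log_dsine_period_half[OF assms(1,2)]
    by (simp_all add: X_def v_def mult.commute)
  have "(X + 1/2 - (X/2 + 1)) * log_dsine \<alpha> t
     \<ge> (X + 1/2 - t) * log_dsine \<alpha> (X/2 + 1) + (t - (X/2 + 1)) * log_dsine \<alpha> (X + 1/2)"
    using assms X by (intro log_dsine_concave) (auto simp: X_def)
  then have "(X/2 - 1/2) * log_dsine \<alpha> t \<ge> (X/2 - 1/2) * v" unfolding v by (linarith | (simp; fail) | (simp add: algebra_simps; fail) | (simp add: field_simps; fail) | (simp add: algebra_simps, linarith) | (simp add: field_simps, linarith))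
  then show ?thesis using X by (simp add: mult_le_cancel_left v_def)
qed

lemma pot_lower_step_small_digit_jump:
  assumes a: "1/4 \<le> \<alpha>" "\<alpha> \<le> 1/2" and t: "2 < t" "t \<le> 1/\<alpha> + 1/2"
  shows "log_dsine \<alpha> t \<ge> pot_lower (\<alpha> * (t - 1))"
proof -
  define X where "X = 1/\<alpha>"
  have al: "0 < \<alpha>" "\<alpha> < 1" using a by auto
  have X: "X \<ge> 2" "\<alpha> * X = 1" using a by (auto simp: X_def field_simps)
  have lnX: "ln X = - ln \<alpha>" using al by (simp add: X_def ln_div)
  have l4: "ln (2/\<alpha>) / 2 \<ge> 69/100"
  proof -
    have "ln 4 \<le> ln (2/\<alpha>)" using a by (intro ln_mono) (auto simp: field_simps)
    moreover have "ln (4::real) = 2 * ln 2" using ln_realpow[of 2 2] by simp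
    ultimately show ?thesis using ln_2_bounds by linarith
  qed
  have d0: "\<alpha> * (t - 1) \<ge> 0" using al t by simp
  have s1: "log_dsine \<alpha> 2 \<ge> 138/100 * \<alpha>" using ln_two_sin_ge[OF a] log_dsine_2[OF al] by simp
  show ?thesis
  proof (cases "t \<ge> X/2 + 1")
    case True
    have "log_dsine \<alpha> t \<ge> ln (2/\<alpha>)/2"
      using True t by (intro log_dsine_plateau al) (simp_all add: X_def)
    then show ?thesis using l4 pot_lower_le_cap[OF d0] by linarith
  next
    case False
    have "log_dsine \<alpha> t \<ge> 138/100 * (\<alpha> * (t - 1))"
    proof (cases "2 * t \<le> X + 1")
      case True
      have "(t - 1) * log_dsine \<alpha> 2 \<le> log_dsine \<alpha> t"
        using log_dsine_convex[OF al, of 1 2 t] True t al by (simp add: X_def)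
      moreover have "(t - 1) * (138/100 * \<alpha>) \<le> (t - 1) * log_dsine \<alpha> 2"
        using s1 t by (intro mult_left_mono) auto
      moreover have "(t - 1) * (138/100 * \<alpha>) = 138/100 * (\<alpha> * (t - 1))" by simp
      ultimately show ?thesis by linarith
    next
      case tT: False
      have *: "log_dsine \<alpha> t \<ge> 138/100 * (\<alpha> * (t - 1))"
        if x: "X + 1 \<le> 2 * x" "x \<le> t" "x < X/2+1" and lx: "log_dsine \<alpha> x \<ge> 138/100 * (\<alpha> * (x - 1))" for x
      proof -
        define z where "z = X/2 + 1"
        have lz: "log_dsine \<alpha> z \<ge> 138/100 * (\<alpha> * (z - 1))"
        proof -
          have "\<alpha> * (z - 1) = 1/2" using X by (simp add: z_def)
          moreover have "log_dsine \<alpha> z = ln (2/\<alpha>)/2"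
            using log_dsine_half_period[OF al] by (simp add: z_def X_def mult.commute)
          ultimately show ?thesis using l4 by linarith
        qed
        have "(z - x) * log_dsine \<alpha> t \<ge> (z - t) * log_dsine \<alpha> x + (t - x) * log_dsine \<alpha> z"
          using log_dsine_concave[OF al, of x t z] x False X by (simp add: X_def z_def)
        moreover have "(z - t) * log_dsine \<alpha> x \<ge> (z - t) * (138/100 * (\<alpha> * (x - 1)))"
          using lx False by (intro mult_left_mono) (auto simp: z_def)
        moreover have "(t - x) * log_dsine \<alpha> z \<ge> (t - x) * (138/100 * (\<alpha> * (z - 1)))"
          using lz x by (intro mult_left_mono) auto
        ultimately have "(z - x) * log_dsine \<alpha> t \<ge> (z - x) * (138/100 * (\<alpha> * (t - 1)))"
          by (linarith | (simp; fail) | (simp add: algebra_simps; fail) | (simp add: field_simps; fail) | (simp add: algebra_simps, linarith) | (simp add: field_simps, linarith))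
        then show ?thesis using x by (simp add: mult_le_cancel_left z_def)
      qed
      \<comment> \<open>The chord must start in the concave range: at 2 if the centre is at most 2,
        otherwise at the centre T itself.\<close>
      show ?thesis
      proof (cases "X + 1 \<le> 4")
        case True
        then show ?thesis using *[of 2] s1 t X False by simp
      next
        case F: False
        define T where "T = (X + 1)/2"
        have lT: "log_dsine \<alpha> T = ln X / 2" using log_dsine_centre[OF al] lnX by (simp add: T_def X_def)
        have lnXq: "ln X \<ge> ln 2 + 2 * (X/2 - 1) / (X/2 + 1)"
        proof -
          have "ln X = ln 2 + ln (X/2)" using X by (simp add: ln_mult_gt_0[symmetric])
          then show ?thesis using ln_lower_sym[of "X/2"] X by simp
        qed
        have q: "2 * (X/2 - 1) / (X/2 + 1) \<ge> 138/100 * (1 - \<alpha>) - 69/100"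
        proof -
          have "2 * (X/2 - 1) / (X/2 + 1) = 2 * (1 - 2 * \<alpha>) / (1 + 2 * \<alpha>)"
          proof -
            have "X/2 - 1 = (1 - 2 * \<alpha>) / (2 * \<alpha>)" "X/2 + 1 = (1 + 2 * \<alpha>) / (2 * \<alpha>)"
              using al by (simp_all add: X_def field_simps)
            then show ?thesis using al by simp
          qed
          moreover have "(138/100 * (1 - \<alpha>) - 69/100) * (1 + 2 * \<alpha>) \<le> 2 * (1 - 2 * \<alpha>)"
          proof -
            have "(1 - 2*\<alpha>) * (69/100 * (1 + 2 * \<alpha>)) \<le> (1 - 2*\<alpha>) * 2" using a by (intro mult_left_mono) auto
            then show ?thesis by (linarith | (simp; fail) | (simp add: algebra_simps; fail) | (simp add: field_simps; fail) | (simp add: algebra_simps, linarith) | (simp add: field_simps, linarith))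
          qed
          ultimately show ?thesis using al by (simp add: pos_le_divide_eq)
        qed
        have "log_dsine \<alpha> T \<ge> 138/100 * (\<alpha> * (T - 1))"
        proof -
          have "\<alpha> * (T - 1) = (\<alpha> * X - \<alpha>)/2" by (simp add: T_def field_simps)
          then have "\<alpha> * (T - 1) = (1 - \<alpha>)/2" unfolding X(2) .
          then show ?thesis using ln_2_bounds lT lnXq q by linarith
        qed
        then show ?thesis using *[of T] tT F by (simp add: T_def)
      qed
    qed
    then show ?thesis using pot_lower_le_lin[OF d0] by linarith
  qed
qed

text \<open>The one-level inequality of the lower bound. The integer c couples the levels, since c -
  t is the deviation on the next one; hence the cases on c and t fix the signs of both
  deviations.\<close>

lemma pot_lower_step:
  assumes a: "2637/10000 \<le> \<alpha>" "\<alpha> \<le> 7914/10000" and a': "0 < \<alpha>'" "\<alpha>' < 1"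
    and al: "1 / \<alpha> = real n + \<alpha>'" and t: "1/2 \<le> t" "t \<le> 1 / \<alpha> + 1/2"
    and d': "- (\<alpha>'/2) \<le> real_of_int c - t" "real_of_int c - t \<le> 1 - \<alpha>'/2"
  shows "log_dsine \<alpha> t \<ge> pot_lower (\<alpha> * (t - 1)) - pot_lower (real_of_int c - t)"
proof -
  define X where "X = 1/\<alpha>"
  have al01: "0 < \<alpha>" "\<alpha> < 1" using a by auto
  have X: "X > 1" "\<alpha> * X = 1" using a by (auto simp: X_def field_simps)
  have lnX: "ln X = - ln \<alpha>" using al01 by (simp add: X_def ln_div)
  note eg = euler_mascheroni_less euler_mascheroni_gt
  have X2: "X = 1 + \<alpha>'" if "\<alpha> > 1/2"
  proof -
    have "X < 2" using that by (simp add: X_def field_simps)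
    then have "n < 2" using al a' by (simp add: X_def)
    moreover have "n \<noteq> 0" using al a' X by (auto simp: X_def)
    ultimately show ?thesis using al by (auto simp: X_def less_2_cases_iff)
  qed
  have cap: "ln (2/\<alpha>) / 2 \<ge> 461/1000"
  proof -
    have r: "2/\<alpha> \<ge> 20000/7914" using a by (simp add: field_simps)
    have "ln (20000/7914 :: real) = ln 2 + ln (10000/7914)" by (subst ln_mult_gt_0[symmetric]) auto
    moreover have "ln (10000/7914 :: real) \<ge> 2338/10000"
      using ln_approx_bounds[of "10000/7914" 2] by (simp add: lessThan_nat_numeral lessThan_Suc power_divide)
    ultimately have "ln (20000/7914 :: real) \<ge> 926/1000" using ln_2_bounds by linarith
    moreover have "ln (20000/7914 :: real) \<le> ln (2/\<alpha>)" using r al01 by (intro ln_mono) auto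
    ultimately show ?thesis by linarith
  qed
  \<comment> \<open>c \<le> 0 cannot occur: with t \<ge> 1/2 it would put c - t below -
    \<alpha>'/2.\<close>
  consider "c \<le> 0" | "c = 1" "t \<ge> 1" | "c = 1" "t < 1" | "c \<ge> 2" by linarith
  then show ?thesis
  proof cases
    case 1
    then have "real_of_int c \<le> 0" by simp
    then show ?thesis using d' t a' by linarith
  next
    case 2
    have tu: "t \<le> 1 + \<alpha>'/2" using d' 2 by simp
    have d0: "\<alpha> * (t - 1) \<ge> 0" using al01 2 by simp
    have V': "pot_lower (real_of_int c - t) = 29/50 * (t - 1)"
      using 2 by (cases "t = 1") (auto simp: pot_lower_def field_simps)
    \<comment> \<open>The tangent of \<open>ln_Gamma\<close> at 1 has slope minus Euler's constant,
      which is below 29/50, the left slope of \<open>pot_lower\<close>. So the potential of the next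
      level pays for this part.\<close>
    have lg: "ln_Gamma t \<ge> - (29/50) * (t - 1)"
    proof -
      have "ln_Gamma t \<ge> - euler_mascheroni * (t - 1)" using ln_Gamma_tangent[of 1 t] 2 by simp
      moreover have "euler_mascheroni * (t - 1) \<le> 29/50 * (t - 1)"
        using eg 2 by (intro mult_right_mono) auto
      ultimately show ?thesis by (linarith | (simp; fail) | (simp add: algebra_simps; fail) | (simp add: field_simps; fail) | (simp add: algebra_simps, linarith) | (simp add: field_simps, linarith))
    qed
    have "log_dsine \<alpha> t \<ge> ln_Gamma t + 138/100 * (\<alpha> * (t - 1))"
    proof (cases "\<alpha> \<le> 1/2")
      case True
      have "log_dsine \<alpha> t \<ge> ln_Gamma t + (t - 1) * ln (2 * sin (pi * \<alpha>))"
        using tu a' 2 al01 by (intro log_dsine_ge_between_1_2) auto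
      moreover have "(t - 1) * ln (2 * sin (pi * \<alpha>)) \<ge> (t - 1) * (138/100 * \<alpha>)"
        using ln_two_sin_ge[of \<alpha>] True a 2 by (intro mult_left_mono) auto
      ultimately show ?thesis by (linarith | (simp; fail) | (simp add: algebra_simps; fail) | (simp add: field_simps; fail) | (simp add: algebra_simps, linarith) | (simp add: field_simps, linarith))
    next
      case False
      then have Xe: "X = 1 + \<alpha>'" using X2 by simp
      have tX: "t \<le> X" using tu Xe a' by simp
      \<comment> \<open>For \<alpha> > 1/2 the chord of \<open>log_dsine_rem\<close> from 1 to 2 is
        too flat. Here t \<le> X < 2, so the chord ends at X, where the value is ln X -
        \<open>ln_Gamma X\<close>; as \<alpha> (X - 1) = 1 - \<alpha>, the claim is the required
        slope.\<close>
      have key: "ln X - ln_Gamma X \<ge> 138/100 * (1 - \<alpha>)"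
      proof (cases "X \<le> 3/2")
        case True
        have "(1/2) * ln_Gamma X \<le> (X - 1) * ln_Gamma (3/2)"
          using convex_on_three_point[OF convex_on_ln_Gamma, of 1 "3/2" X] True X by simp
        also have "\<dots> \<le> (X - 1) * (- 12/100)" using ln_Gamma_three_halves X by (intro mult_left_mono) auto
        finally have g: "ln_Gamma X \<le> - (24/100) * (X - 1)" by simp
        have lo: "X \<ge> 12635/10000" using a by (simp add: X_def field_simps)
        have "(X - 1) * (2 / (X + 1) + 24/100) \<ge> (X - 1) * (138/100 * \<alpha>)"
        proof (intro mult_left_mono)
          have "138/100 * (X + 1) \<le> 2 * X + 24/100 * (X * (X + 1))"
          proof -
            have "X * (X + 1) \<ge> 12635/10000 * (22635/10000)" using lo by (intro mult_mono) auto
            then show ?thesis using lo by simp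
          qed
          then have "138/100 * (X + 1) * \<alpha> \<le> (2 * X + 24/100 * (X * (X + 1))) * \<alpha>"
            using al01 by (intro mult_right_mono) auto
          also have "\<dots> = 2 * (\<alpha> * X) + 24/100 * ((\<alpha> * X) * (X + 1))" by (simp add: algebra_simps)
          also have "\<dots> = 2 + 24/100 * (X + 1)" unfolding X(2) by simp
          finally show "138/100 * \<alpha> \<le> 2 / (X + 1) + 24/100" using X by (simp add: field_simps)
        qed (use X in simp)
        moreover have "(X - 1) * (138/100 * \<alpha>) = 138/100 * (1 - \<alpha>)"
        proof -
          have "(X - 1) * (138/100 * \<alpha>) = 138/100 * (\<alpha> * X - \<alpha>)" by (simp add: algebra_simps)
          then show ?thesis unfolding X(2) .
        qed
        moreover have "(X - 1) * (2 / (X + 1) + 24/100) \<le> ln X - ln_Gamma X"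
        proof -
          define r where "r = 2 / (X + 1)"
          have "ln X \<ge> (X - 1) * r" using ln_lower_sym[of X] X by (simp add: r_def algebra_simps)
          moreover have "(X - 1) * (r + 24/100) = (X - 1) * r + 24/100 * (X - 1)"
            by (simp only: distrib_left mult.commute)
          ultimately show ?thesis using g unfolding r_def[symmetric] by linarith
        qed
        ultimately show ?thesis by (metis order.trans)
      next
        case F: False
        have X2': "X \<le> 2" using Xe a' by simp
        have "(1/2) * ln_Gamma X \<le> (2 - X) * ln_Gamma (3/2)"
          using convex_on_three_point[OF convex_on_ln_Gamma, of "3/2" 2 X] F X2' by simp
        also have "\<dots> \<le> (2 - X) * (- 12/100)" using ln_Gamma_three_halves X2' by (intro mult_left_mono) auto
        finally have g: "ln_Gamma X \<le> - (24/100) * (2 - X)" by simp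
        have "ln (2/X) \<le> 2/X - 1" using X by (intro ln_le_minus_one) auto
        then have lx: "ln X \<ge> ln 2 - (2 * \<alpha> - 1)" using X al01 lnX by (simp add: ln_mult_gt_0 X_def)
        have "62/100 * \<alpha> \<le> 24/100 * (2 - X) + 31/100"
        proof -
          have "(X - 2) * (24/100 * X - 31/100) \<le> 0" using F X2' by (intro mult_nonpos_nonneg) auto
          then have "\<alpha> * ((X - 2) * (24/100 * X - 31/100)) \<le> 0"
            using al01 by (rule_tac mult_nonneg_nonpos) simp_all
          also have "\<alpha> * ((X - 2) * (24/100 * X - 31/100))
             = (\<alpha> * X) * (24/100 * X) - 31/100 * (\<alpha> * X) - 48/100 * (\<alpha> * X) + 62/100 * \<alpha>"
            by (simp add: field_simps)
          finally show ?thesis unfolding X(2) by ((simp; fail) | (simp add: field_simps; fail) | (simp add: algebra_simps; fail) | (simp add: algebra_simps, linarith) | (simp add: field_simps, linarith) | argo)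
        qed
        then show ?thesis using g lx ln_2_bounds by (linarith | (simp; fail) | (simp add: algebra_simps; fail) | (simp add: field_simps; fail) | (simp add: algebra_simps, linarith) | (simp add: field_simps, linarith))
      qed
      have "(X - 1) * log_dsine_rem \<alpha> t \<ge> (t - 1) * (ln X - ln_Gamma X)"
        using log_dsine_rem_concave[OF al01, of 1 t X] log_dsine_rem_at[OF al01] 2 tX lnX X
        by (simp add: X_def)
      moreover have "(t - 1) * (ln X - ln_Gamma X) \<ge> (t - 1) * (138/100 * (1 - \<alpha>))"
        using key 2 by (intro mult_left_mono) auto
      moreover have "1 - \<alpha> = \<alpha> * (X - 1)" using X(2) by (linarith | (simp; fail) | (simp add: algebra_simps; fail) | (simp add: field_simps; fail) | (simp add: algebra_simps, linarith) | (simp add: field_simps, linarith))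
      ultimately have "(X - 1) * log_dsine_rem \<alpha> t \<ge> (X - 1) * (138/100 * (\<alpha> * (t - 1)))"
        by (linarith | (simp; fail) | (simp add: algebra_simps; fail) | (simp add: field_simps; fail) | (simp add: algebra_simps, linarith) | (simp add: field_simps, linarith))
      then have "log_dsine_rem \<alpha> t \<ge> 138/100 * (\<alpha> * (t - 1))" using X by (simp add: mult_le_cancel_left)
      then show ?thesis by (simp add: log_dsine_def)
    qed
    then show ?thesis using lg pot_lower_le_lin[OF d0] unfolding V' by linarith
  next
    case 3
    define x where "x = 1 - t"
    have x: "0 < x" "x \<le> 1/2" and tx: "t = 1 - x" using 3 t by (auto simp: x_def)
    have V: "pot_lower (\<alpha> * (t - 1)) = 29/50 * (\<alpha> * x)"
      using al01 x by (simp add: pot_lower_def tx mult_less_0_iff)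
    \<comment> \<open>Below the cap, convexity through t, 1 and the centre suffices. Above it, the
      two parts are bounded separately: \<open>ln_Gamma\<close> by its tangent at 1/2, the remainder
      by its chord from 1/2 to 1.\<close>
    show ?thesis
    proof (cases "138/100 * x \<le> 461/1000")
      case True
      have V': "pot_lower (real_of_int c - t) = 138/100 * x" using 3 True x by (simp add: pot_lower_def tx)
      define T where "T = (X + 1)/2"
      have lT: "log_dsine \<alpha> T = ln X / 2" using log_dsine_centre[OF al01] lnX by (simp add: T_def X_def)
      have "(T - t) * log_dsine \<alpha> 1 \<le> (T - 1) * log_dsine \<alpha> t + (1 - t) * log_dsine \<alpha> T"
        using t 3 X by (intro log_dsine_convex al01) (auto simp: T_def X_def)
      then have "0 \<le> (T - 1) * log_dsine \<alpha> t + (1 - t) * (ln X / 2)" unfolding lT using al01 by simp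
      also have "\<dots> = ((X - 1) * log_dsine \<alpha> t + x * ln X) / 2" by (simp add: T_def x_def field_simps)
      finally have "(X - 1) * log_dsine \<alpha> t \<ge> - (x * ln X)" by simp
      moreover have "x * ln X \<le> x * ((X - 1) * ((1 + \<alpha>)/2))"
      proof (intro mult_left_mono)
        have "(X - 1) * (X + 1) / (2 * X) = (X - 1) * ((1 + \<alpha>)/2)" using X al01 by (simp add: X_def field_simps)
        then show "ln X \<le> (X - 1) * ((1 + \<alpha>)/2)" using ln_upper_sym[of X] X by simp
      qed (use x in simp)
      moreover have "x * ((X - 1) * ((1 + \<alpha>)/2)) = - ((X - 1) * (- x * ((1 + \<alpha>)/2)))" by simp
      ultimately have "(X - 1) * log_dsine \<alpha> t \<ge> (X - 1) * (- x * ((1 + \<alpha>)/2))" by linarith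
      then have "log_dsine \<alpha> t \<ge> - x * ((1 + \<alpha>)/2)" using X by (simp only: mult_le_cancel_left)
      \<comment> \<open>Amounts to 1/2 + \<alpha>/2 + 29/50 \<alpha> \<le> 138/100, true for
        \<alpha> up to about 0.81.\<close>
      moreover have "x * ((1 + \<alpha>)/2) \<le> x * (138/100 - 29/50 * \<alpha>)" using x a by (intro mult_left_mono) auto
      moreover have "x * (138/100 - 29/50 * \<alpha>) = 138/100 * x - 29/50 * (\<alpha> * x)" by (simp add: algebra_simps)
      ultimately show ?thesis unfolding V V' by simp
    next
      case False
      have V': "pot_lower (real_of_int c - t) = 461/1000" using 3 False x by (simp add: pot_lower_def tx)
      define u where "u = ln (2 * pi * \<alpha>) + 29/50 * \<alpha>"
      have "(1/2) * log_dsine_rem \<alpha> t \<ge> (1 - t) * (- ln (2 * pi * \<alpha>) / 2)"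
        using log_dsine_rem_concave[OF al01, of "1/2" t 1] log_dsine_rem_at[OF al01] t 3 X al01
        by (simp add: X_def)
      moreover have "(1 - t) * (- ln (2 * pi * \<alpha>) / 2) = 1/2 * (- x * ln (2 * pi * \<alpha>))"
        by (simp add: x_def field_simps)
      ultimately have k: "log_dsine_rem \<alpha> t \<ge> - x * ln (2 * pi * \<alpha>)" by linarith
      have "ln_Gamma t \<ge> ln_Gamma (1/2) + Digamma (1/2) * (t - 1/2)" using t by (intro ln_Gamma_tangent) auto
      moreover have "ln_Gamma (1/2 :: real) = ln pi / 2" by (simp add: ln_Gamma_real_pos Gamma_one_half_real ln_sqrt)
      moreover have "Digamma (1/2 :: real) = - euler_mascheroni - 2 * ln 2" using Digamma_one_half[where 'a=real] by simp
      ultimately have g: "ln_Gamma t \<ge> ln pi / 2 - (euler_mascheroni + 2 * ln 2) * (1/2 - x)"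
        by (simp add: tx algebra_simps)
      define w where "w = (euler_mascheroni + 2 * ln 2 :: real)"
      have w: "w \<le> 19663/10000" using eg ln_2_bounds by (simp add: w_def)
      \<comment> \<open>Linear in x on [0, 1/2], so x = 1/2 is decisive if u \<ge> w and x = 0
        otherwise. With these bounds the largest \<alpha> requires a cap of about 0.4592 at x = 1/2,
        while the plateau ln (2/\<alpha>) / 2 permits about 0.463; 461/1000 lies between.\<close>
      have main: "ln pi / 2 - w * (1/2 - x) - x * u + 461/1000 \<ge> 0"
      proof (cases "u \<ge> w")
        case True
        have "ln \<alpha> \<le> - (2338/10000)"
        proof -
          have "ln (10000/7914 :: real) \<ge> 2338/10000"
            using ln_approx_bounds[of "10000/7914" 2] by (simp add: lessThan_nat_numeral lessThan_Suc power_divide)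
          moreover have "ln (10000/7914 :: real) \<le> ln X" using a by (intro ln_mono) (auto simp: X_def field_simps)
          ultimately show ?thesis using lnX by linarith
        qed
        then have "u \<le> ln 2 + ln pi - 2338/10000 + 29/50 * (7914/10000)"
          using a al01 by (simp add: u_def ln_mult_gt_0)
        then have "ln pi / 2 - u/2 + 461/1000 \<ge> 0" using ln_2_bounds by simp
        moreover have "(u - w) * (1/2 - x) \<ge> 0" using True x by (intro mult_nonneg_nonneg) auto
        ultimately show ?thesis by (linarith | (simp; fail) | (simp add: algebra_simps; fail) | (simp add: field_simps; fail) | (simp add: algebra_simps, linarith) | (simp add: field_simps, linarith))
      next
        case F: False
        have "(w - u) * x \<ge> 0" using F x by (intro mult_nonneg_nonneg) auto
        then show ?thesis using w ln_pi_bounds by (linarith | (simp; fail) | (simp add: algebra_simps; fail) | (simp add: field_simps; fail) | (simp add: algebra_simps, linarith) | (simp add: field_simps, linarith))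
      qed
      have "log_dsine \<alpha> t \<ge> ln pi / 2 - w * (1/2 - x) - x * ln (2 * pi * \<alpha>)"
        using k g by (simp add: log_dsine_def w_def)
      moreover have "x * u = x * ln (2 * pi * \<alpha>) + 29/50 * (\<alpha> * x)" by (simp add: u_def algebra_simps)
      ultimately show ?thesis using main unfolding V V' by linarith
    qed
  next
    case 4
    have c2: "real_of_int c \<ge> 2" using 4 by linarith
    have tl: "t \<ge> 1 + \<alpha>'/2" using d' c2 by linarith
    have d0: "\<alpha> * (t - 1) \<ge> 0" using al01 tl a' by simp
    have ceq: "c = 2" if "t \<le> 2"
    proof -
      have "real_of_int c < 3" using that d' a' by linarith
      then show ?thesis using 4 by linarith
    qed
    show ?thesis
    proof (cases "\<alpha> \<le> 1/2")
      case True
      show ?thesis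
      proof (cases "t \<le> 2")
        case t2: True
        have "log_dsine \<alpha> t \<ge> ln_Gamma t + (t - 1) * ln (2 * sin (pi * \<alpha>))"
          using t2 tl a' al01 by (intro log_dsine_ge_between_1_2) auto
        moreover have "(t - 1) * ln (2 * sin (pi * \<alpha>)) \<ge> (t - 1) * (138/100 * \<alpha>)"
          using ln_two_sin_ge[of \<alpha>] True a tl a' by (intro mult_left_mono) auto
        moreover have "ln_Gamma t \<ge> (1 - euler_mascheroni) * (t - 2)"
          using ln_Gamma_tangent[of 2 t] t by (simp add: Digamma_2)
        moreover have "(1 - euler_mascheroni) * (2 - t) \<le> 43/100 * (2 - t)"
          using eg t2 by (intro mult_right_mono) auto
        \<comment> \<open>The next deviation 2 - t lies in [0, 1), so its potential dominates even
          when capped, because 43/100 < 461/1000.\<close>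
        moreover have "43/100 * (2 - t) \<le> pot_lower (real_of_int c - t)"
          using ceq[OF t2] t2 tl a' by (auto simp: pot_lower_def)
        ultimately show ?thesis using pot_lower_le_lin[OF d0] by (linarith | (simp; fail) | (simp add: algebra_simps; fail) | (simp add: field_simps; fail) | (simp add: algebra_simps, linarith) | (simp add: field_simps, linarith))
      next
        case False
        then show ?thesis using pot_lower_step_small_digit_jump[of \<alpha> t] True a t pot_lower_nonneg[of "real_of_int c - t"]
          by simp
      qed
    next
      case False
      then have Xe: "X = 1 + \<alpha>'" using X2 by simp
      \<comment> \<open>With digit 1 the lower end 1 + \<alpha>'/2 of this case is exactly the
        centre (X + 1)/2, so only the concave half is visited.\<close>
      have tT: "X + 1 \<le> 2 * t" using tl Xe by simp
      show ?thesis
      proof (cases "t \<ge> X/2 + 1")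
        case True
        have "log_dsine \<alpha> t \<ge> ln (2/\<alpha>)/2"
          using True t by (intro log_dsine_plateau al01) (simp_all add: X_def)
        then show ?thesis using cap pot_lower_le_cap[OF d0] pot_lower_nonneg[of "real_of_int c - t"] by linarith
      next
        case F: False
        define T where "T = (X + 1)/2"
        define z where "z = X/2 + 1"
        have lT: "log_dsine \<alpha> T \<ge> 0" using log_dsine_centre[OF al01] al01 by (simp add: T_def X_def)
        have lz: "log_dsine \<alpha> z \<ge> 461/1000" using log_dsine_half_period[OF al01] cap by (simp add: z_def X_def mult.commute)
        have Tz: "T < z" "z < X + 1" using X by (auto simp: T_def z_def)
        have X2': "X < 2" using Xe a' by simp
        have pos: "log_dsine \<alpha> s \<ge> 0" if "T \<le> s" "s \<le> z" for s
        proof -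
          have "(z - T) * log_dsine \<alpha> s \<ge> (z - s) * log_dsine \<alpha> T + (s - T) * log_dsine \<alpha> z"
            using that Tz by (intro log_dsine_concave al01) (auto simp: T_def X_def z_def)
          moreover have "(z - s) * log_dsine \<alpha> T \<ge> 0" "(s - T) * log_dsine \<alpha> z \<ge> 0"
            using that lT lz by (auto intro!: mult_nonneg_nonneg)
          ultimately have "(z - T) * log_dsine \<alpha> s \<ge> 0" by linarith
          then show ?thesis using Tz by (simp add: zero_le_mult_iff)
        qed
        have t2: "t \<le> 2" using F X2' by simp
        have c: "c = 2" using ceq[OF t2] .
        show ?thesis
        proof (cases "138/100 * (2 - t) \<ge> 461/1000")
          case True
          then have "pot_lower (real_of_int c - t) = 461/1000" using c t2 by (simp add: pot_lower_def)
          then show ?thesis using pos[of t] tT F pot_lower_le_cap[OF d0] by (simp add: T_def z_def)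
        next
          case G: False
          have V': "pot_lower (real_of_int c - t) = 138/100 * (2 - t)" using c t2 G by (simp add: pot_lower_def)
          \<comment> \<open>Here 138/100 (2 - s) equals the cap. The needed bound 461/1000 - 138/100
            (2 - t) vanishes at s and stays below the chord from s to z, because z \<le> 2.\<close>
          define s where "s = (2 - 461/1380 :: real)"
          have st: "s < t" using G by (simp add: s_def)
          have sT: "T \<le> s" using X2' by (simp add: T_def s_def)
          have "(z - s) * log_dsine \<alpha> t \<ge> (z - t) * log_dsine \<alpha> s + (t - s) * log_dsine \<alpha> z"
            using st sT F Tz by (intro log_dsine_concave al01) (auto simp: T_def X_def z_def)
          moreover have "(z - t) * log_dsine \<alpha> s \<ge> 0" using pos[of s] sT st F by (intro mult_nonneg_nonneg) (auto simp: z_def)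
          moreover have "(t - s) * log_dsine \<alpha> z \<ge> (t - s) * (461/1000)" using lz st by (intro mult_left_mono) auto
          moreover have "(t - s) * (461/1000) \<ge> (z - s) * (461/1000 - 138/100 * (2 - t))"
          proof -
            have e: "461/1000 - 138/100 * (2 - t) = 138/100 * (t - s)" by (simp add: s_def field_simps)
            have "z - s \<le> 461/1380" using X2' by (simp add: z_def s_def)
            then have "(z - s) * (138/100 * (t - s)) \<le> 461/1380 * (138/100 * (t - s))"
              using st by (intro mult_right_mono) auto
            then show ?thesis unfolding e by simp
          qed
          ultimately have "(z - s) * log_dsine \<alpha> t \<ge> (z - s) * (461/1000 - 138/100 * (2 - t))" by linarith
          moreover have "z - s > 0" using st F by (simp add: z_def)
          ultimately have "log_dsine \<alpha> t \<ge> 461/1000 - 138/100 * (2 - t)" by (simp add: mult_le_cancel_left)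
          then show ?thesis using pot_lower_le_cap[OF d0] unfolding V' by linarith
        qed
      qed
    qed
  qed
qed

section \<open>The upper bound at digits at least seven\<close>

text \<open>Keeps the first term of the series and compares 1/z^2 with 1/(z^2 - 1/4) = 1/(z - 1/2) -
  1/(z + 1/2) in the others, which telescopes.\<close>

lemma Polygamma_1_le:
  assumes "x > (0::real)"
  shows "Polygamma 1 x \<le> 1 / x\<^sup>2 + 1 / (x + 1/2)"
proof -
  define h where "h = (\<lambda>k::nat. 1 / (x + real k + 1/2))"
  have lim: "h \<longlonglongrightarrow> 0" unfolding h_def using assms by real_asymp
  have tel: "(\<lambda>k. h k - h (Suc k)) sums (h 0 - 0)" using telescope_sums'[OF lim] by simp
  have sm: "summable (\<lambda>k. inverse ((x + real k)\<^sup>2))"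
    using Polygamma_converges'[of x 2] assms by auto
  have "Polygamma 1 x = (\<Sum>k. inverse ((x + real k)\<^sup>2))"
    by (simp add: Polygamma_def numeral_2_eq_2)
  also have "\<dots> = inverse (x\<^sup>2) + (\<Sum>k. inverse ((x + real (Suc k))\<^sup>2))"
    using suminf_split_head[OF sm] by simp
  also have "(\<Sum>k. inverse ((x + real (Suc k))\<^sup>2)) \<le> (\<Sum>k. h k - h (Suc k))"
  proof (rule suminf_le)
    fix k
    define z where "z = x + real k + 1"
    have z: "z > 1" using assms by (simp add: z_def)
    have "h k - h (Suc k) = 1 / (z - 1/2) - 1 / (z + 1/2)" by (simp add: h_def z_def add_ac)
    also have "\<dots> = 1 / (z\<^sup>2 - 1/4)" using z by (simp add: field_simps power2_eq_square)
    also have "\<dots> \<ge> inverse (z\<^sup>2)"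
    proof -
      have "z\<^sup>2 > 1" using z by (simp add: one_less_power)
      then have "z\<^sup>2 - 1/4 > 0" by simp
      then show ?thesis using z by (simp add: inverse_eq_divide frac_le)
    qed
    finally show "inverse ((x + real (Suc k))\<^sup>2) \<le> h k - h (Suc k)" by (simp add: z_def add_ac)
  qed (use sm tel in \<open>auto simp: summable_Suc_iff sums_iff simp del: of_nat_Suc intro: summable_Suc_iff[THEN iffD2, OF sm]\<close>)
  also have "(\<Sum>k. h k - h (Suc k)) = 1 / (x + 1/2)" using tel by (simp add: sums_iff h_def)
  finally show ?thesis by (simp add: inverse_eq_divide)
qed

text \<open>Second-order expansion at d = 0: the second derivative is trigamma at 1 - d, at most
  210/100 on the range. The end 1432/10000 is slightly above 1/7, so that the deviations at a digit
  at least seven stay inside.\<close>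

lemma ln_Gamma_1_minus_le:
  assumes "0 \<le> d" "d \<le> (1432/10000::real)"
  shows "ln_Gamma (1 - d) \<le> 29/50 * d + 105/100 * d\<^sup>2"
proof -
  define g where "g = (\<lambda>d. ln_Gamma (1 - d) - euler_mascheroni * d - 105/100 * d\<^sup>2 :: real)"
  define g' where "g' = (\<lambda>d. - Digamma (1 - d) - euler_mascheroni - 210/100 * d :: real)"
  have pg: "Polygamma 1 (1 - e) \<le> 210/100" if "0 \<le> e" "e \<le> 1432/10000" for e :: real
  proof -
    have "Polygamma 1 (1 - e) \<le> Polygamma 1 (8568/10000)" using that by (intro Polygamma_1_antimono) auto
    also have "\<dots> \<le> 1 / (8568/10000)\<^sup>2 + 1 / (8568/10000 + 1/2)" by (intro Polygamma_1_le) simp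
    also have "\<dots> \<le> 210/100" by (simp add: power2_eq_square)
    finally show ?thesis .
  qed
  have g'0: "g' e \<le> 0" if "0 \<le> e" "e \<le> 1432/10000" for e
  proof -
    have "g' e \<le> g' 0"
    proof (rule DERIV_nonpos_imp_nonincreasing[OF that(1)])
      fix u assume u: "0 \<le> u" "u \<le> e"
      have "(g' has_real_derivative Polygamma 1 (1 - u) - 210/100) (at u)"
        unfolding g'_def using u that by (auto intro!: derivative_eq_intros elim!: nonpos_Ints_cases)
      moreover have "Polygamma 1 (1 - u) - 210/100 \<le> 0" using pg[of u] u that by simp
      ultimately show "\<exists>y. (g' has_real_derivative y) (at u) \<and> y \<le> 0" by blast
    qed
    then show ?thesis by (simp add: g'_def)
  qed
  have "g d \<le> g 0"
  proof (rule DERIV_nonpos_imp_nonincreasing[OF assms(1)])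
    fix u assume u: "0 \<le> u" "u \<le> d"
    have "(g has_real_derivative g' u) (at u)"
      unfolding g_def g'_def using u assms by (auto intro!: derivative_eq_intros elim!: nonpos_Ints_cases)
    then show "\<exists>y. (g has_real_derivative y) (at u) \<and> y \<le> 0" using g'0[of u] u assms by auto
  qed
  then have "ln_Gamma (1 - d) \<le> euler_mascheroni * d + 105/100 * d\<^sup>2" by (simp add: g_def)
  moreover have "euler_mascheroni * d \<le> 29/50 * d" using euler_mascheroni_less assms by (intro mult_right_mono) auto
  ultimately show ?thesis by linarith
qed

text \<open>Repeated integration starting from sin v \<le> v: each difference vanishes at 0 and has
  the preceding one as derivative, up to sign.\<close>

lemma sin_bounds_taylor:
  assumes "0 \<le> (x::real)"
  shows "x - x^3/6 \<le> sin x" "sin x \<le> x - x^3/6 + x^5/120"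
proof -
  have c2: "0 \<le> cos u - 1 + u\<^sup>2/2" if "u \<ge> 0" for u :: real
  proof -
    have "(\<lambda>u. cos u - 1 + u\<^sup>2/2) 0 \<le> (\<lambda>u. cos u - 1 + u\<^sup>2/2) u"
    proof (rule DERIV_nonneg_imp_nondecreasing[OF that])
      fix v :: real assume "0 \<le> v"
      moreover have "((\<lambda>u. cos u - 1 + u\<^sup>2/2) has_real_derivative - sin v + v) (at v)"
        by (auto intro!: derivative_eq_intros)
      ultimately show "\<exists>y. ((\<lambda>u. cos u - 1 + u\<^sup>2/2) has_real_derivative y) (at v) \<and> 0 \<le> y"
        using sin_x_le_x[of v] by (intro exI[of _ "- sin v + v"]) auto
    qed
    then show ?thesis by simp
  qed
  have s3: "0 \<le> sin u - u + u^3/6" if "u \<ge> 0" for u :: real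
  proof -
    have "(\<lambda>u. sin u - u + u^3/6) 0 \<le> (\<lambda>u. sin u - u + u^3/6) u"
    proof (rule DERIV_nonneg_imp_nondecreasing[OF that])
      fix v :: real assume "0 \<le> v"
      moreover have "((\<lambda>u. sin u - u + u^3/6) has_real_derivative cos v - 1 + v\<^sup>2/2) (at v)"
        by (auto intro!: derivative_eq_intros)
      ultimately show "\<exists>y. ((\<lambda>u. sin u - u + u^3/6) has_real_derivative y) (at v) \<and> 0 \<le> y"
        using c2[of v] by blast
    qed
    then show ?thesis by simp
  qed
  have c4: "cos u - 1 + u\<^sup>2/2 - u^4/24 \<le> 0" if "u \<ge> 0" for u :: real
  proof -
    have "(\<lambda>u. cos u - 1 + u\<^sup>2/2 - u^4/24) u \<le> (\<lambda>u. cos u - 1 + u\<^sup>2/2 - u^4/24) 0"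
    proof (rule DERIV_nonpos_imp_nonincreasing[OF that])
      fix v :: real assume "0 \<le> v"
      moreover have "((\<lambda>u. cos u - 1 + u\<^sup>2/2 - u^4/24) has_real_derivative - (sin v - v + v^3/6)) (at v)"
        by (auto intro!: derivative_eq_intros)
      ultimately show "\<exists>y. ((\<lambda>u. cos u - 1 + u\<^sup>2/2 - u^4/24) has_real_derivative y) (at v) \<and> y \<le> 0"
        using s3[of v] by (intro exI[of _ "- (sin v - v + v^3/6)"]) auto
    qed
    then show ?thesis by simp
  qed
  have s5: "sin u - u + u^3/6 - u^5/120 \<le> 0" if "u \<ge> 0" for u :: real
  proof -
    have "(\<lambda>u. sin u - u + u^3/6 - u^5/120) u \<le> (\<lambda>u. sin u - u + u^3/6 - u^5/120) 0"
    proof (rule DERIV_nonpos_imp_nonincreasing[OF that])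
      fix v :: real assume "0 \<le> v"
      moreover have "((\<lambda>u. sin u - u + u^3/6 - u^5/120) has_real_derivative cos v - 1 + v\<^sup>2/2 - v^4/24) (at v)"
        by (auto intro!: derivative_eq_intros)
      ultimately show "\<exists>y. ((\<lambda>u. sin u - u + u^3/6 - u^5/120) has_real_derivative y) (at v) \<and> y \<le> 0"
        using c4[of v] by blast
    qed
    then show ?thesis by simp
  qed
  show "x - x^3/6 \<le> sin x" "sin x \<le> x - x^3/6 + x^5/120" using s3[OF assms] s5[OF assms] by linarith+
qed

lemma ln_two_sin_seventh: "ln (2 * sin (pi * (1/7))) \<ge> - 15/100"
proof -
  have "448/1000 \<le> pi * (1/7)" "pi * (1/7) \<le> pi/2" using pi_approx by auto
  then have "sin (448/1000) \<le> sin (pi * (1/7))" by (intro sin_monotone_2pi_le) auto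
  moreover have "448/1000 - (448/1000)^3/6 \<le> sin (448/1000 :: real)" by (rule sin_bounds_taylor) auto
  ultimately have "2 * sin (pi * (1/7)) \<ge> 866/1000" by (simp add: power3_eq_cube)
  then have "ln (866/1000) \<le> ln (2 * sin (pi * (1/7)))" by (intro ln_mono) auto
  moreover have "ln (866/1000 :: real) = - ln (1000/866)" by (simp add: ln_div)
  moreover have "ln (1000/866 :: real) \<le> (1000/866 - 1) * (1000/866 + 1) / (2 * (1000/866))" by (rule ln_upper_sym) simp
  ultimately show ?thesis by simp
qed

lemma ln_two_sin_small:
  assumes "0 < \<alpha>" "\<alpha> \<le> 14/100"
  shows "ln (2 * sin (pi * \<alpha>)) \<le> - 158/1000"
proof -
  have "pi * \<alpha> \<le> 439823/1000000"
  proof -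
    have "pi * \<alpha> \<le> 3.1415927 * (14/100)" using pi_approx assms by (intro mult_mono) auto
    then show ?thesis by simp
  qed
  then have "sin (pi * \<alpha>) \<le> sin (439823/1000000)"
    using assms pi_gt3 by (intro sin_monotone_2pi_le) (auto intro: order.trans[of _ 0])
  also have "\<dots> \<le> 439823/1000000 - (439823/1000000)^3/6 + (439823/1000000)^5/120" by (rule sin_bounds_taylor) auto
  also have "\<dots> \<le> 4259/10000" by (simp add: power3_eq_cube power_divide)
  finally have "2 * sin (pi * \<alpha>) \<le> 8518/10000" by simp
  moreover have "sin (pi * \<alpha>) > 0" using assms by (intro sin_gt_zero) auto
  ultimately have "ln (2 * sin (pi * \<alpha>)) \<le> ln (8518/10000)" by (intro ln_mono) auto
  also have "ln (8518/10000 :: real) = - ln (10000/8518)" by (simp add: ln_div)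
  finally show ?thesis using ln_lower_sym[of "10000/8518"] by simp
qed

text \<open>63/10 = (15/100) / (1/6 - 1/7) is the slope of the chord from the bound at 1/7 to the
  exact zero at 1/6.\<close>

lemma ln_two_sin_ge_small:
  assumes "1/7 \<le> \<alpha>" "\<alpha> \<le> 1/6"
  shows "ln (2 * sin (pi * \<alpha>)) \<ge> - 15/100 + 63/10 * (\<alpha> - 1/7)"
proof -
  have "(1/6 - 1/7) * ln (2 * sin (pi * \<alpha>)) \<ge> (1/6 - \<alpha>) * ln (2 * sin (pi * (1/7))) + (\<alpha> - 1/7) * ln (2 * sin (pi * (1/6)))"
    using assms by (intro ln_two_sin_concave) auto
  moreover have "ln (2 * sin (pi * (1/6))) = 0" by (simp add: sin_30)
  moreover have "(1/6 - \<alpha>) * ln (2 * sin (pi * (1/7))) \<ge> (1/6 - \<alpha>) * (- 15/100)"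
    using ln_two_sin_seventh assms by (intro mult_left_mono) auto
  ultimately have "(1/6 - 1/7) * ln (2 * sin (pi * \<alpha>)) \<ge> (1/6 - \<alpha>) * (- 15/100)"
    by (smt (verit) mult_eq_0_iff)
  then show ?thesis by argo
qed

text \<open>2079/1000 is three times 693/1000, a lower bound for the chord slope ln 2 / (1/2 -
  1/6).\<close>

lemma ln_two_sin_ge_medium:
  assumes "1/6 \<le> \<alpha>" "\<alpha> \<le> 1/2"
  shows "ln (2 * sin (pi * \<alpha>)) \<ge> 2079/1000 * (\<alpha> - 1/6)"
proof -
  have "(1/2 - 1/6) * ln (2 * sin (pi * \<alpha>)) \<ge> (1/2 - \<alpha>) * ln (2 * sin (pi * (1/6))) + (\<alpha> - 1/6) * ln (2 * sin (pi * (1/2)))"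
    using assms by (intro ln_two_sin_concave) auto
  moreover have "ln (2 * sin (pi * (1/6))) = 0" by (simp add: sin_30)
  moreover have "ln (2 * sin (pi * (1/2))) = ln 2" by simp
  moreover have "(\<alpha> - 1/6) * ln 2 \<ge> (\<alpha> - 1/6) * (693/1000)" using assms ln_2_bounds by (intro mult_left_mono) auto
  ultimately have "(1/2 - 1/6) * ln (2 * sin (pi * \<alpha>)) \<ge> (\<alpha> - 1/6) * (693/1000)" by simp
  then show ?thesis by simp
qed

text \<open>Slope of the potential on negative deviations; positive ones have slope 115/100. At a
  level with digit 1, where \<alpha> = 1/(1 + \<alpha>'), its value at \<alpha>' must dominate (1 +
  \<alpha>)/2 + 115/100 \<alpha>. That it decreases keeps the product with \<alpha> moderate for
  \<alpha> near 1.\<close>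

definition upper_slope :: "real \<Rightarrow> real" where
  "upper_slope x = 22/10 - 85/100 * x"

text \<open>The three ranges correspond to a level that follows a digit at least seven, where the
  potential is constant, and to levels reached from it, where it is linear in \<open>\<bar>d\<bar>\<close>.\<close>

lemma log_dsine_upper_neg:
  assumes "0 < \<alpha>" "\<alpha> < 1" "0 < \<alpha>'" "\<alpha>' < 1" "1 / \<alpha> = real n + \<alpha>'" "n > 0" "0 \<le> e" "e \<le> 1432/10000 * \<alpha>'"
  shows "log_dsine \<alpha> (1 + e) + 115/100 * (\<alpha> * e) \<le> upper_slope \<alpha>' * e"
proof -
  define X where "X = 1/\<alpha>"
  have X: "X > 1" "\<alpha> * X = 1" unfolding X_def using assms(1,2) by simp_all
  have lnX: "ln X = - ln \<alpha>" unfolding X_def using assms(1,2) by (simp add: ln_div)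
  define T where "T = (X + 1)/2"
  have lT: "log_dsine \<alpha> T = ln X / 2" using log_dsine_centre[of \<alpha>] assms lnX by (simp add: T_def X_def)
  have X': "X \<ge> 1 + \<alpha>'" using assms by (simp add: X_def)
  have eT: "1 + e \<le> T" using X' assms by (simp add: T_def)
  have "(T - 1) * log_dsine \<alpha> (1 + e) \<le> (T - (1 + e)) * log_dsine \<alpha> 1 + (1 + e - 1) * log_dsine \<alpha> T"
    using assms eT by (intro log_dsine_convex) (auto simp: T_def X_def)
  then have "(X - 1)/2 * log_dsine \<alpha> (1 + e) \<le> e * (ln X / 2)"
    unfolding lT using assms by (simp add: T_def diff_divide_distrib add_divide_distrib)
  also have "e * (ln X / 2) \<le> e * ((X - 1)/2 * ((1 + \<alpha>)/2))"
  proof (intro mult_left_mono)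
    have "(X - 1) * (X + 1) / (2 * X) = (X - 1) * ((1 + \<alpha>)/2)" using X assms by (simp add: X_def field_simps)
    then show "ln X / 2 \<le> (X - 1)/2 * ((1 + \<alpha>)/2)" using ln_upper_sym[of X] X by simp
  qed (use assms in simp)
  also have "e * ((X - 1)/2 * ((1 + \<alpha>)/2)) = (X - 1)/2 * (e * ((1 + \<alpha>)/2))" by simp
  finally have l: "log_dsine \<alpha> (1 + e) \<le> e * ((1 + \<alpha>)/2)" using X by (simp only: mult_le_cancel_left) auto
  \<comment> \<open>For n \<ge> 2 the left side is at most 1.325 and the slope at least 1.35. For n
    = 1, \<alpha>' = 1/\<alpha> - 1 reduces the claim to (1 - \<alpha>)(\<alpha> - 1/2) \<ge> 0 with
    some slack.\<close>
  have "(1 + \<alpha>)/2 + 115/100 * \<alpha> \<le> upper_slope \<alpha>'"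
  proof (cases "n \<ge> 2")
    case True
    then have "X \<ge> 2" using assms by (simp add: X_def)
    then have "\<alpha> * 2 \<le> \<alpha> * X" using assms(1) by (intro mult_left_mono) auto
    then have "\<alpha> \<le> 1/2" unfolding X(2) by simp
    then show ?thesis using assms(3,4) unfolding upper_slope_def by argo
  next
    case False
    then have "X = 1 + \<alpha>'" using assms by (simp add: X_def)
    then have a': "\<alpha>' = X - 1" by simp
    have "\<alpha> * X \<le> \<alpha> * 2" using assms(1,4) a' by (intro mult_left_mono) auto
    then have half: "\<alpha> \<ge> 1/2" unfolding X(2) by simp
    have "0 \<le> (1 - \<alpha>) * (\<alpha> - 1/2)" using half assms(2) by (intro mult_nonneg_nonneg) auto
    also have "\<dots> = 15/10 * \<alpha> - 1/2 - \<alpha> * \<alpha>" by (simp add: field_simps)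
    finally have "165/100 * \<alpha> * \<alpha> + 85/100 \<le> 255/100 * \<alpha>" using half by argo
    then have "(165/100 * \<alpha> * \<alpha> + 85/100) * X \<le> 255/100 * \<alpha> * X" using X by (intro mult_right_mono) auto
    then have "165/100 * \<alpha> * (\<alpha> * X) + 85/100 * X \<le> 255/100 * (\<alpha> * X)" by (simp add: algebra_simps)
    then have "165/100 * \<alpha> + 85/100 * X \<le> 255/100" unfolding X(2) by simp
    then show ?thesis unfolding upper_slope_def a' by argo
  qed
  then have "((1 + \<alpha>)/2 + 115/100 * \<alpha>) * e \<le> upper_slope \<alpha>' * e" using assms by (intro mult_right_mono) auto
  moreover have "((1 + \<alpha>)/2 + 115/100 * \<alpha>) * e = e * ((1 + \<alpha>)/2) + 115/100 * (\<alpha> * e)" by (simp add: algebra_simps)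
  ultimately show ?thesis using l by linarith
qed

text \<open>Left of 1 a concave function lies below the extension of a chord on the right: through 1
  and 2, or through 1 and 1/\<alpha> when \<alpha> > 1/2. \<open>ln_Gamma\<close> enters by its
  second-order bound, and b collects what is left of the slope.\<close>

lemma log_dsine_upper_pos_aux:
  assumes "1/7 \<le> \<alpha>" "\<alpha> < 1" "0 \<le> d" "d \<le> 1432/10000"
    and b: "\<alpha> \<le> 1/2 \<Longrightarrow> upper_slope \<alpha> * \<alpha> - ln (2 * sin (pi * \<alpha>)) \<le> b" "b \<ge> 36/100"
  shows "log_dsine \<alpha> (1 - d) + upper_slope \<alpha> * (\<alpha> * d) \<le> (29/50 + 105/100 * d + b) * d"
proof -
  have al: "0 < \<alpha>" "\<alpha> < 1" using assms by auto
  define X where "X = 1/\<alpha>"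
  have X: "X > 1" "\<alpha> * X = 1" unfolding X_def using assms(1,2) by simp_all
  have "\<exists>\<sigma>. log_dsine_rem \<alpha> (1 - d) \<le> - d * \<sigma> \<and> upper_slope \<alpha> * \<alpha> - \<sigma> \<le> b"
  proof (cases "\<alpha> \<le> 1/2")
    case True
    have "(2 - (1 - d)) * log_dsine_rem \<alpha> 1 \<ge> (2 - 1) * log_dsine_rem \<alpha> (1 - d) + (1 - (1 - d)) * log_dsine_rem \<alpha> 2"
      using assms X by (intro log_dsine_rem_concave al) (auto simp: X_def)
    then have "log_dsine_rem \<alpha> (1 - d) \<le> - d * ln (2 * sin (pi * \<alpha>))"
      by (simp add: log_dsine_rem_at al)
    then show ?thesis using b(1)[OF True] by blast
  next
    case False
    have Xlt: "X < 2" using False by (simp add: X_def field_simps)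
    have "(X - (1 - d)) * log_dsine_rem \<alpha> 1 \<ge> (X - 1) * log_dsine_rem \<alpha> (1 - d) + (1 - (1 - d)) * log_dsine_rem \<alpha> X"
      using assms X by (intro log_dsine_rem_concave al) (auto simp: X_def)
    then have 1: "(X - 1) * log_dsine_rem \<alpha> (1 - d) \<le> - d * (- ln \<alpha> - ln_Gamma X)"
      using log_dsine_rem_at[OF al] by (simp add: X_def)
    have "(2 - 1) * ln_Gamma X \<le> (2 - X) * ln_Gamma 1 + (X - 1) * ln_Gamma 2"
      using Xlt X by (intro convex_on_three_point[OF convex_on_ln_Gamma]) auto
    then have lg: "ln_Gamma X \<le> 0" by simp
    define \<sigma> where "\<sigma> = 2 * \<alpha> / (1 + \<alpha>)"
    have "2 * (X - 1) / (X + 1) = (X - 1) * \<sigma>" using al by (simp add: X_def \<sigma>_def field_simps)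
    then have "- ln \<alpha> \<ge> (X - 1) * \<sigma>" using ln_lower_sym[of X] X al by (simp add: X_def ln_div)
    then have "d * ((X - 1) * \<sigma>) \<le> d * (- ln \<alpha> - ln_Gamma X)" using lg assms by (intro mult_left_mono) auto
    then have "- d * (- ln \<alpha> - ln_Gamma X) \<le> - (d * ((X - 1) * \<sigma>))" by (simp only: mult_minus_left neg_le_iff_le)
    also have "\<dots> = (X - 1) * (- d * \<sigma>)" by simp
    finally have "(X - 1) * log_dsine_rem \<alpha> (1 - d) \<le> (X - 1) * (- d * \<sigma>)" using 1 by (rule_tac order.trans)
    then have s: "log_dsine_rem \<alpha> (1 - d) \<le> - d * \<sigma>" using X by (simp only: mult_le_cancel_left)
    have "upper_slope \<alpha> * \<alpha> - \<sigma> \<le> 36/100"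
    proof -
      have "(upper_slope \<alpha> * \<alpha> - 36/100) * (1 + \<alpha>) \<le> 2 * \<alpha>"
      proof -
        have "0 \<le> (1 - \<alpha>)\<^sup>2 * (35/100 + 85/100 * \<alpha>)" using al by simp
        also have "\<dots> = 35/100 + 15/100 * \<alpha> - 135/100 * (\<alpha>*\<alpha>) + 85/100 * (\<alpha>*\<alpha>*\<alpha>)"
          by (simp add: power2_eq_square field_simps)
        finally have "0 \<le> 35/100 + 15/100 * \<alpha> - 135/100 * (\<alpha>*\<alpha>) + 85/100 * (\<alpha>*\<alpha>*\<alpha>)" .
        moreover have "(upper_slope \<alpha> * \<alpha> - 36/100) * (1 + \<alpha>)
           = 2 * \<alpha> - 36/100 - 16/100 * \<alpha> + 135/100 * (\<alpha>*\<alpha>) - 85/100 * (\<alpha>*\<alpha>*\<alpha>)"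
          by (simp add: upper_slope_def field_simps)
        ultimately show ?thesis using al by argo
      qed
      then show ?thesis using al by (simp add: \<sigma>_def field_simps)
    qed
    then show ?thesis using s b(2) by (intro exI[of _ \<sigma>]) auto
  qed
  then obtain \<sigma> where s: "log_dsine_rem \<alpha> (1 - d) \<le> - d * \<sigma>" "upper_slope \<alpha> * \<alpha> - \<sigma> \<le> b" by blast
  have "(upper_slope \<alpha> * \<alpha> - \<sigma>) * d \<le> b * d" using s assms by (intro mult_right_mono) auto
  moreover have "log_dsine \<alpha> (1 - d) \<le> 29/50 * d + 105/100 * d\<^sup>2 - d * \<sigma>"
    using s ln_Gamma_1_minus_le[of d] assms by (simp add: log_dsine_def)
  moreover have "(29/50 + 105/100 * d + b) * d = 29/50 * d + 105/100 * d\<^sup>2 + b * d"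
    by (simp add: algebra_simps power2_eq_square)
  moreover have "(upper_slope \<alpha> * \<alpha> - \<sigma>) * d = upper_slope \<alpha> * (\<alpha> * d) - d * \<sigma>" by (simp add: algebra_simps)
  ultimately show ?thesis by linarith
qed

lemma log_dsine_upper_pos:
  assumes "1/7 \<le> \<alpha>" "\<alpha> < 1" "0 \<le> d" "d \<le> 725/10000"
  shows "log_dsine \<alpha> (1 - d) + upper_slope \<alpha> * (\<alpha> * d) \<le> 115/100 * d"
proof -
  have "upper_slope \<alpha> * \<alpha> - ln (2 * sin (pi * \<alpha>)) \<le> 45/100" if "\<alpha> \<le> 1/2"
  proof -
    have e: "upper_slope \<alpha> * \<alpha> = 22/10 * \<alpha> - 85/100 * (\<alpha> * \<alpha>)" by (simp add: upper_slope_def algebra_simps)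
    show ?thesis
    proof (cases "\<alpha> \<le> 1/6")
      case True
      have "\<alpha> * \<alpha> \<ge> 1/7 * (1/7)" using assms by (intro mult_mono) auto
      moreover have "1/7 \<le> \<alpha>" using assms by simp
      moreover note ln_two_sin_ge_small[OF this True]
      ultimately show ?thesis using assms(1) unfolding e by argo
    next
      case False
      have "\<alpha> * \<alpha> \<ge> 1/6 * \<alpha>" using False by (intro mult_right_mono) auto
      moreover have "1/6 \<le> \<alpha>" using False by simp
      moreover note ln_two_sin_ge_medium[OF this that]
      ultimately show ?thesis unfolding e by argo
    qed
  qed
  then have "log_dsine \<alpha> (1 - d) + upper_slope \<alpha> * (\<alpha> * d) \<le> (29/50 + 105/100 * d + 45/100) * d"
    using assms by (intro log_dsine_upper_pos_aux) auto
  also have "\<dots> \<le> 115/100 * d" using assms by (intro mult_right_mono) auto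
  finally show ?thesis .
qed

text \<open>7/43 = 1/(6 + 1/7) is the least \<alpha> with digit at most six and tail at most 1/7,
  the situation directly in front of a digit at least seven. The worst case d = 1432/10000 gives the
  constant 157/1000.\<close>

lemma log_dsine_upper_jump:
  assumes "7/43 \<le> \<alpha>" "\<alpha> < 1" "0 \<le> d" "d \<le> 1432/10000"
  shows "log_dsine \<alpha> (1 - d) + upper_slope \<alpha> * (\<alpha> * d) \<le> 157/1000"
proof -
  have "upper_slope \<alpha> * \<alpha> - ln (2 * sin (pi * \<alpha>)) \<le> 361/1000" if "\<alpha> \<le> 1/2"
  proof -
    have e: "upper_slope \<alpha> * \<alpha> = 22/10 * \<alpha> - 85/100 * (\<alpha> * \<alpha>)" by (simp add: upper_slope_def algebra_simps)
    show ?thesis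
    proof (cases "\<alpha> \<le> 1/6")
      case True
      have "\<alpha> * \<alpha> \<ge> 7/43 * (7/43)" using assms by (intro mult_mono) auto
      moreover have "1/7 \<le> \<alpha>" using assms by simp
      moreover note ln_two_sin_ge_small[OF this True]
      ultimately show ?thesis using assms(1) unfolding e by argo
    next
      case False
      have "\<alpha> * \<alpha> \<ge> 1/6 * \<alpha>" using False by (intro mult_right_mono) auto
      moreover have "1/6 \<le> \<alpha>" using False by simp
      moreover note ln_two_sin_ge_medium[OF this that]
      ultimately show ?thesis unfolding e by argo
    qed
  qed
  then have "log_dsine \<alpha> (1 - d) + upper_slope \<alpha> * (\<alpha> * d) \<le> (29/50 + 105/100 * d + 361/1000) * d"
    using assms by (intro log_dsine_upper_pos_aux) auto
  also have "\<dots> \<le> (29/50 + 105/100 * (1432/10000) + 361/1000) * (1432/10000)"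
    using assms by (intro mult_mono) auto
  also have "\<dots> \<le> 157/1000" by simp
  finally show ?thesis .
qed

text \<open>Convexity on [1, 2] and [2, 3], both left of the centre since 1/\<alpha> \<ge> 7. The
  values at 1 and 2 are 0 and ln (2 sin (pi \<alpha>)); the step from 2 to 3 adds at most ln
  2.\<close>

lemma log_dsine_upper_big:
  assumes "0 < \<alpha>" "\<alpha> \<le> 1/7" "0 \<le> d" "d \<le> 1"
  shows "log_dsine \<alpha> (2 - d) \<le> (1 - d) * ln (2 * sin (pi * \<alpha>))"
    and "log_dsine \<alpha> (2 + d) \<le> ln (2 * sin (pi * \<alpha>)) + d * ln 2"
proof -
  have X: "1/\<alpha> \<ge> 7" using assms by (simp add: field_simps)
  have al: "0 < \<alpha>" "\<alpha> < 1" using assms by auto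
  have "(2 - 1) * log_dsine \<alpha> (2 - d) \<le> (2 - (2 - d)) * log_dsine \<alpha> 1 + (2 - d - 1) * log_dsine \<alpha> 2"
    using X assms by (intro log_dsine_convex al) auto
  then show "log_dsine \<alpha> (2 - d) \<le> (1 - d) * ln (2 * sin (pi * \<alpha>))" using al by (simp add: log_dsine_2)
  have "(3 - 2) * log_dsine \<alpha> (2 + d) \<le> (3 - (2 + d)) * log_dsine \<alpha> 2 + (2 + d - 2) * log_dsine \<alpha> 3"
    using X assms by (intro log_dsine_convex al) auto
  moreover have l3: "log_dsine \<alpha> 3 = log_dsine \<alpha> 2 + ln (2 * sin (pi * \<alpha> * 2))"
    using log_dsine_plus_1[OF al, of 2] X by simp
  moreover have "ln (2 * sin (pi * \<alpha> * 2)) \<le> ln 2"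
  proof (rule ln_mono)
    show "0 < 2 * sin (pi * \<alpha> * 2)" using assms by (intro mult_pos_pos sin_gt_zero) (auto simp: field_simps)
  qed auto
  then have "d * ln (2 * sin (pi * \<alpha> * 2)) \<le> d * ln 2" using assms by (intro mult_left_mono) auto
  ultimately show "log_dsine \<alpha> (2 + d) \<le> ln (2 * sin (pi * \<alpha>)) + d * ln 2"
    using al by (simp add: log_dsine_2 algebra_simps)
qed

section \<open>Reciprocity for Sudler products\<close>

lemma sudler_0 [simp]: "sudler 0 \<alpha> = 1"
  by (simp add: sudler_def)

lemma sudler_Suc: "sudler (Suc N) \<alpha> = sudler N \<alpha> * (2 * \<bar>sin (pi * (real (Suc N) * \<alpha>))\<bar>)"
  by (simp add: sudler_def mult.assoc)

lemma sudler_nonneg: "sudler N \<alpha> \<ge> 0"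
  unfolding sudler_def by (intro prod_nonneg) auto

lemma abs_sin_pi_add_nat: "\<bar>sin (pi * (x + real k))\<bar> = \<bar>sin (pi * x)\<bar>"
proof (induction k)
  case (Suc k)
  have "pi * (x + real (Suc k)) = pi * (x + real k) + pi" by (simp add: algebra_simps)
  then show ?case using Suc by simp
qed simp

lemma abs_sin_pi_nat_minus: "\<bar>sin (pi * (real k - x))\<bar> = \<bar>sin (pi * x)\<bar>"
  using abs_sin_pi_add_nat[of "-x" k] by simp

lemma sudler_add_nat: "sudler N (real n + \<alpha>) = sudler N \<alpha>"
proof -
  have "\<bar>sin (pi * real r * (real n + \<alpha>))\<bar> = \<bar>sin (pi * real r * \<alpha>)\<bar>" for r
    using abs_sin_pi_add_nat[of "real r * \<alpha>" "r * n"] by (simp add: algebra_simps)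
  then show ?thesis by (simp add: sudler_def)
qed

text \<open>Strips last factors: for t > 1 the N-th factor on the left matches the unit shift of
  \<open>log_dsine\<close>, for t < 1 the M-th factor on the right matches the shift by 1/\<alpha>.
  Irrationality excludes t = 1 with M > 0, where a sine factor would vanish.\<close>

theorem sudler_reciprocity:
  assumes al: "0 < \<alpha>" "\<alpha> < 1" "\<alpha> \<notin> \<rat>"
    and t: "t = real (Suc N) - real M / \<alpha>" "0 < t" "t < 1 / \<alpha> + 1"
  shows "sudler N \<alpha> = exp (log_dsine \<alpha> t) * sudler M (1 / \<alpha>)"
  using t
proof (induction "N + M" arbitrary: N M t rule: less_induct)
  case less
  show ?case
  proof (cases "t > 1")
    case True
    have "N \<noteq> 0"
    proof
      assume "N = 0"
      moreover have "real M / \<alpha> \<ge> 0" using al by simp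
      ultimately show False using True less.prems by simp
    qed
    then obtain N' where N: "N = Suc N'" by (cases N) auto
    define s where "s = t - 1"
    have s: "0 < s" "s < 1/\<alpha>" "s = real (Suc N') - real M / \<alpha>" using True less.prems N by (simp_all add: s_def)
    have IH: "sudler N' \<alpha> = exp (log_dsine \<alpha> s) * sudler M (1/\<alpha>)"
      using s N by (intro less.hyps) auto
    have as: "0 < \<alpha> * s" "\<alpha> * s < 1" using s(1,2) al(1) by (simp_all add: pos_less_divide_eq mult.commute)
    have sp: "sin (pi * (\<alpha> * s)) > 0" using as by (intro sin_gt_zero) auto
    have "\<alpha> * s = \<alpha> * real (Suc N') - \<alpha> * (real M / \<alpha>)" unfolding s(3) by (rule right_diff_distrib)
    then have "real N * \<alpha> = \<alpha> * s + real M" using N al(1) by (simp add: mult.commute)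
    then have "\<bar>sin (pi * (real N * \<alpha>))\<bar> = sin (pi * (\<alpha> * s))"
      using abs_sin_pi_add_nat[of "\<alpha> * s" M] sp by simp
    then have "sudler N \<alpha> = sudler N' \<alpha> * (2 * sin (pi * (\<alpha> * s)))" using N sudler_Suc[of N' \<alpha>] by simp
    moreover have "exp (log_dsine \<alpha> t) = exp (log_dsine \<alpha> s) * (2 * sin (pi * (\<alpha> * s)))"
      using log_dsine_plus_1[OF al(1,2) s(1,2)] sp by (simp add: s_def exp_add mult.assoc)
    ultimately show ?thesis using IH by simp
  next
    case False
    show ?thesis
    proof (cases "M = 0")
      case True
      then have "N = 0" "t = 1" using False less.prems by auto
      then show ?thesis using True al by simp
    next
      case M0: False
      then obtain M' where M: "M = Suc M'" by (cases M) auto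
      have t1: "t < 1"
      proof (rule ccontr)
        assume "\<not> t < 1"
        then have "t = 1" using False by simp
        then have "real M / \<alpha> = real N" using less.prems(1) by simp
        then have NM: "real N * \<alpha> = real M" using al(1) by (simp add: divide_eq_eq)
        have "N \<noteq> 0"
        proof
          assume "N = 0"
          then show False using NM M0 by simp
        qed
        then have "\<alpha> = real M / real N" using NM by (simp add: field_simps)
        then show False using al by (simp add: Rats_divide)
      qed
      define s where "s = t + 1/\<alpha>"
      have s: "0 < s" "s < 1/\<alpha> + 1" "s = real (Suc N) - real M' / \<alpha>"
      proof -
        have "real M / \<alpha> = real M' / \<alpha> + 1/\<alpha>" using M by (simp add: add_divide_distrib)
        moreover have "1/\<alpha> > 0" using al(1) by simp
        ultimately show "0 < s" "s < 1/\<alpha> + 1" "s = real (Suc N) - real M' / \<alpha>"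
          using t1 less.prems(1,2) unfolding s_def by linarith+
      qed
      have IH: "sudler N \<alpha> = exp (log_dsine \<alpha> s) * sudler M' (1/\<alpha>)"
        using s M by (intro less.hyps) auto
      have sp: "sin (pi * t) > 0" using less.prems t1 by (intro sin_gt_zero) auto
      have "real M / \<alpha> = real (Suc N) - t" using less.prems by simp
      then have "\<bar>sin (pi * (real M * (1/\<alpha>)))\<bar> = sin (pi * t)"
        using abs_sin_pi_nat_minus[of "Suc N" t] sp by simp
      then have "sudler M (1/\<alpha>) = sudler M' (1/\<alpha>) * (2 * sin (pi * t))" using M sudler_Suc[of M' "1/\<alpha>"] by simp
      moreover have "exp (log_dsine \<alpha> s) = exp (log_dsine \<alpha> t) * (2 * sin (pi * t))"
        using log_dsine_plus_period[OF al(1,2) less.prems(2) t1] sp by (simp add: s_def exp_add)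
      ultimately show ?thesis using IH by simp
    qed
  qed
qed

section \<open>The Gauss map and continued fraction digits\<close>

definition gauss_map :: "real \<Rightarrow> real" where
  "gauss_map x = frac (1 / x)"

definition cf_digit :: "real \<Rightarrow> nat" where
  "cf_digit x = nat \<lfloor>1 / x\<rfloor>"

lemma gauss_map:
  assumes "0 < x" "x < 1" "x \<notin> \<rat>"
  shows "0 < gauss_map x" "gauss_map x < 1" "gauss_map x \<notin> \<rat>" "1 / x = real (cf_digit x) + gauss_map x"
    "cf_digit x \<ge> 1" "x = 1 / (real (cf_digit x) + gauss_map x)"
proof -
  have i: "1/x \<notin> \<rat>" using assms Rats_inverse[of "1/x"] by (auto simp: inverse_eq_divide)
  have fl: "\<lfloor>1/x\<rfloor> \<ge> 1" using assms by (simp add: le_floor_iff)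
  show "cf_digit x \<ge> 1" using nat_mono[OF fl] by (simp add: cf_digit_def)
  show e: "1 / x = real (cf_digit x) + gauss_map x"
  proof -
    have "real (cf_digit x) = real_of_int \<lfloor>1/x\<rfloor>" unfolding cf_digit_def using fl by (intro of_nat_nat) linarith
    then show ?thesis by (simp add: gauss_map_def frac_def)
  qed
  then show "x = 1 / (real (cf_digit x) + gauss_map x)" using assms by (metis divide_divide_eq_right div_by_1 mult_1)
  show "gauss_map x \<notin> \<rat>"
  proof
    assume "gauss_map x \<in> \<rat>"
    then have "real (cf_digit x) + gauss_map x \<in> \<rat>" by simp
    then show False using i e by simp
  qed
  then have "gauss_map x \<noteq> 0" by auto
  then show "0 < gauss_map x" using frac_ge_0[of "1/x"] unfolding gauss_map_def by linarith
  show "gauss_map x < 1" by (simp add: gauss_map_def frac_lt_1)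
qed

lemma sudler_gauss_step:
  assumes "0 < \<alpha>" "\<alpha> < 1" "\<alpha> \<notin> \<rat>" "t = real (Suc N) - real M / \<alpha>" "0 < t" "t < 1 / \<alpha> + 1"
  shows "sudler N \<alpha> = exp (log_dsine \<alpha> t) * sudler M (gauss_map \<alpha>)"
  using sudler_reciprocity[OF assms] gauss_map(4)[OF assms(1-3)] by (simp add: sudler_add_nat)

section \<open>Digits at most three\<close>

definition small_digits :: "nat \<Rightarrow> real set" where
  "small_digits b = {x. 0 < x \<and> x < 1 \<and> x \<notin> \<rat> \<and> (\<forall>k. cf_digit ((gauss_map ^^ k) x) \<le> b)}"

lemma small_digits_gauss: "x \<in> small_digits b \<Longrightarrow> gauss_map x \<in> small_digits b"
  using gauss_map(1-3)[of x]
  by (auto simp: small_digits_def funpow_Suc_right[symmetric] simp del: funpow.simps)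
     (metis comp_apply funpow_Suc_right)

text \<open>Bounds l and u valid for all tails improve to 1/(3 + u) and 1/(1 + l). A few rounds from
  [0, 1] come close to the exact extremes (sqrt 21 - 3)/6 and (sqrt 21 - 3)/2, the periodic
  expansions with digits 3, 1 and 1, 3.\<close>

lemma small_digits_bounds:
  assumes "x \<in> small_digits 3"
  shows "2637/10000 \<le> x" "x \<le> 7914/10000"
proof -
  have B: "1 / (3 + u) \<le> z \<and> z \<le> 1 / (1 + l)"
    if "z \<in> small_digits 3" "\<And>w. w \<in> small_digits 3 \<Longrightarrow> l \<le> w \<and> w \<le> u" "l \<ge> 0" for l u z
  proof -
    have z: "0 < z" "z < 1" "z \<notin> \<rat>" using that by (auto simp: small_digits_def)
    note g = gauss_map[OF z]
    have n: "cf_digit z \<le> 3" using that(1) by (auto simp: small_digits_def dest: spec[of _ 0])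
    have w: "l \<le> gauss_map z" "gauss_map z \<le> u" using that(2) small_digits_gauss[OF that(1)] by auto
    have "1 / (3 + u) \<le> 1 / (real (cf_digit z) + gauss_map z)"
      using g n w by (intro divide_left_mono mult_pos_pos) auto
    moreover have "1 / (real (cf_digit z) + gauss_map z) \<le> 1 / (1 + l)"
      using g n w that(3) by (intro divide_left_mono mult_pos_pos) auto
    ultimately show ?thesis using g(6) by simp
  qed
  have 1: "1/4 \<le> z \<and> z \<le> 1" if "z \<in> small_digits 3" for z
    using B[of z 0 1] that by (auto simp: small_digits_def)
  have 2: "26/100 \<le> z \<and> z \<le> 8/10" if "z \<in> small_digits 3" for z
  proof -
    have "1/4 \<le> z \<and> z \<le> 8/10" if "z \<in> small_digits 3" for z using B[OF that, of "1/4" 1] 1 that by auto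
    then show ?thesis using B[OF that, of "1/4" "8/10"] that by auto
  qed
  have 3: "2635/10000 \<le> z \<and> z \<le> 794/1000" if "z \<in> small_digits 3" for z
  proof -
    have "26/100 \<le> z \<and> z \<le> 794/1000" if "z \<in> small_digits 3" for z
      using B[OF that, of "26/100" "8/10"] 2 that by auto
    then show ?thesis using B[OF that, of "26/100" "794/1000"] that by auto
  qed
  have 4: "2637/10000 \<le> z \<and> z \<le> 7915/10000" if "z \<in> small_digits 3" for z
  proof -
    have "2635/10000 \<le> z \<and> z \<le> 7915/10000" if "z \<in> small_digits 3" for z
      using B[OF that, of "2635/10000" "794/1000"] 3 that by auto
    then show ?thesis using B[OF that, of "2635/10000" "7915/10000"] that by auto
  qed
  show "2637/10000 \<le> x" "x \<le> 7914/10000" using 4[OF assms] B[OF assms, of "2637/10000" "7915/10000"] 4 by auto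
qed

lemma small_digitsD:
  assumes "x \<in> small_digits b"
  shows "0 < x" "x < 1" "x \<notin> \<rat>" "cf_digit x \<le> b"
  using assms by (auto simp: small_digits_def dest: spec[of _ 0])

lemma pot_lower_gauss_step:
  assumes x: "\<alpha> \<in> small_digits 3" and t: "1/2 \<le> t" "t \<le> 1 / \<alpha> + 1/2"
    and t': "1/2 \<le> t'" "t' \<le> 1 / gauss_map \<alpha> + 1/2"
    and c: "real_of_int c = t + gauss_map \<alpha> * (t' - 1)"
  shows "log_dsine \<alpha> t \<ge> pot_lower (\<alpha> * (t - 1)) - pot_lower (gauss_map \<alpha> * (t' - 1))"
proof -
  note d = small_digitsD[OF x]
  note g = gauss_map[OF d(1-3)]
  have "gauss_map \<alpha> * (1/2) \<le> gauss_map \<alpha> * t'" using t' g by (intro mult_left_mono) auto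
  moreover have "gauss_map \<alpha> * t' \<le> gauss_map \<alpha> * (1 / gauss_map \<alpha> + 1/2)" using t' g by (intro mult_left_mono) auto
  moreover have "gauss_map \<alpha> * (1 / gauss_map \<alpha> + 1/2) = 1 + gauss_map \<alpha> / 2" using g by (simp add: field_simps)
  moreover have e: "real_of_int c - t = gauss_map \<alpha> * t' - gauss_map \<alpha>" using c by (simp add: algebra_simps)
  ultimately have "- (gauss_map \<alpha> / 2) \<le> real_of_int c - t" "real_of_int c - t \<le> 1 - gauss_map \<alpha> / 2" by linarith+
  then have "log_dsine \<alpha> t \<ge> pot_lower (\<alpha> * (t - 1)) - pot_lower (real_of_int c - t)"
    using small_digits_bounds[OF x] g t by (intro pot_lower_step) auto
  then show ?thesis unfolding e by (simp add: right_diff_distrib)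
qed

text \<open>Chooses M with deviation \<alpha> N - M in (- \<alpha>/2, 1 - \<alpha>/2], so that the
  argument of \<open>log_dsine\<close> falls into (1/2, 1/\<alpha> + 1/2]. \<open>upper_next\<close>
  closes the interval at the other end.\<close>

definition lower_next :: "nat \<Rightarrow> real \<Rightarrow> nat" where
  "lower_next N \<alpha> = nat (\<lceil>\<alpha> * (real N + 1/2)\<rceil> - 1)"

lemma lower_next:
  assumes "0 < \<alpha>"
  shows "real (lower_next N \<alpha>) < \<alpha> * (real N + 1/2)" "\<alpha> * (real N + 1/2) - 1 \<le> real (lower_next N \<alpha>)"
proof -
  have "\<lceil>\<alpha> * (real N + 1/2)\<rceil> \<ge> 1" using assms by (simp add: one_le_ceiling add_nonneg_pos)
  then have "real (lower_next N \<alpha>) = real_of_int \<lceil>\<alpha> * (real N + 1/2)\<rceil> - 1" by (simp add: lower_next_def)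
  then show "real (lower_next N \<alpha>) < \<alpha> * (real N + 1/2)" "\<alpha> * (real N + 1/2) - 1 \<le> real (lower_next N \<alpha>)"
    using ceiling_correct[of "\<alpha> * (real N + 1/2)"] by linarith+
qed

text \<open>The argument t at which reciprocity links the indices N and M; \<alpha> (t - 1) is the
  deviation \<alpha> N - M on which the potential is evaluated.\<close>

definition window_pos :: "nat \<Rightarrow> nat \<Rightarrow> real \<Rightarrow> real" where
  "window_pos N M \<alpha> = real (Suc N) - real M / \<alpha>"

lemma window_pos_lower_next:
  assumes "0 < \<alpha>"
  shows "1/2 < window_pos N (lower_next N \<alpha>) \<alpha>" "window_pos N (lower_next N \<alpha>) \<alpha> \<le> 1 / \<alpha> + 1/2"
proof -
  note l = lower_next[OF assms, of N]
  have "real (lower_next N \<alpha>) / \<alpha> < real N + 1/2" using l(1) assms by (simp add: pos_divide_less_eq mult.commute)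
  then show "1/2 < window_pos N (lower_next N \<alpha>) \<alpha>" by (simp add: window_pos_def)
  have "(\<alpha> * (real N + 1/2) - 1) / \<alpha> \<le> real (lower_next N \<alpha>) / \<alpha>" using l(2) assms by (intro divide_right_mono) auto
  moreover have "(\<alpha> * (real N + 1/2) - 1) / \<alpha> = real N + 1/2 - 1/\<alpha>" using assms by (simp add: diff_divide_distrib)
  ultimately show "window_pos N (lower_next N \<alpha>) \<alpha> \<le> 1 / \<alpha> + 1/2" by (simp add: window_pos_def)
qed

text \<open>Supplies the integer c of \<open>pot_lower_step\<close>: the position on one level plus
  the deviation on the next.\<close>

lemma window_pos_integer:
  assumes "0 < \<alpha>" "\<alpha> < 1" "\<alpha> \<notin> \<rat>"
  shows "window_pos N M \<alpha> + gauss_map \<alpha> * (window_pos M M' (gauss_map \<alpha>) - 1)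
    = real_of_int (int N + 1 - int M * int (cf_digit \<alpha>) - int M')"
proof -
  note g = gauss_map[OF assms]
  have "window_pos N M \<alpha> = real (Suc N) - real M * (real (cf_digit \<alpha>) + gauss_map \<alpha>)"
    unfolding window_pos_def g(4)[symmetric] by simp
  moreover have "gauss_map \<alpha> * (window_pos M M' (gauss_map \<alpha>) - 1) = gauss_map \<alpha> * real M - real M'"
    using g by (simp add: window_pos_def field_simps)
  ultimately show ?thesis by (simp add: algebra_simps)
qed

text \<open>Induction on N along \<open>lower_next\<close>, the potentials cancelling from level to
  level. The descent can stall only at N = 0 and, if \<alpha> > 2/3, at N = 1; in the latter case
  the next tail is below 1/2 and the descent goes on to 0.\<close>

lemma sudler_ge_pot:
  assumes "\<alpha> \<in> small_digits 3"
  shows "sudler N \<alpha> \<ge> exp (pot_lower (\<alpha> * (window_pos N (lower_next N \<alpha>) \<alpha> - 1)))"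
proof -
  define C where "C = (\<lambda>N \<alpha>. sudler N \<alpha> \<ge> exp (pot_lower (\<alpha> * (window_pos N (lower_next N \<alpha>) \<alpha> - 1))))"
  have step: "C N \<alpha>" if x: "\<alpha> \<in> small_digits 3" and IH: "C (lower_next N \<alpha>) (gauss_map \<alpha>)" for N \<alpha>
  proof -
    note d = small_digitsD[OF x]
    note g = gauss_map[OF d(1-3)]
    define M where "M = lower_next N \<alpha>"
    define M' where "M' = lower_next M (gauss_map \<alpha>)"
    define t where "t = window_pos N M \<alpha>"
    define t' where "t' = window_pos M M' (gauss_map \<alpha>)"
    have t: "1/2 < t" "t \<le> 1/\<alpha> + 1/2" using window_pos_lower_next[OF d(1), of N] by (auto simp: t_def M_def)
    have t': "1/2 < t'" "t' \<le> 1/gauss_map \<alpha> + 1/2"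
      using window_pos_lower_next[OF g(1), of M] by (auto simp: t'_def M'_def)
    have "log_dsine \<alpha> t \<ge> pot_lower (\<alpha> * (t - 1)) - pot_lower (gauss_map \<alpha> * (t' - 1))"
      using t t' window_pos_integer[OF d(1-3), of N M M']
      by (intro pot_lower_gauss_step[OF x, where c = "int N + 1 - int M * int (cf_digit \<alpha>) - int M'"])
         (auto simp: t_def t'_def)
    then have "exp (pot_lower (\<alpha> * (t - 1))) \<le> exp (log_dsine \<alpha> t + pot_lower (gauss_map \<alpha> * (t' - 1)))" by simp
    also have "\<dots> \<le> exp (log_dsine \<alpha> t) * sudler M (gauss_map \<alpha>)"
      using IH by (simp add: C_def exp_add M_def M'_def t'_def)
    also have "\<dots> = sudler N \<alpha>"
      using sudler_gauss_step[OF d(1-3), of t N M] t by (simp add: t_def window_pos_def)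
    finally show ?thesis by (simp add: C_def t_def M_def)
  qed
  have z: "lower_next 0 \<alpha> = 0" if "\<alpha> \<in> small_digits 3" for \<alpha>
    using lower_next(1)[of \<alpha> 0] small_digitsD[OF that] by auto
  have C0: "C 0 \<alpha>" if "\<alpha> \<in> small_digits 3" for \<alpha>
    using z[OF that] by (simp add: C_def window_pos_def pot_lower_def)
  have "C N \<alpha>" if "\<alpha> \<in> small_digits 3" for N \<alpha>
    using that
  proof (induction N arbitrary: \<alpha> rule: less_induct)
    case (less N)
    note d = small_digitsD[OF less.prems]
    show ?case
    proof (cases "lower_next N \<alpha> < N")
      case True
      then show ?thesis using less.IH less.prems small_digits_gauss step by blast
    next
      case False
      show ?thesis
      proof (cases "N = 0")
        case True then show ?thesis using C0 less.prems by simp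
      next
        case N0: False
        have "real N < \<alpha> * (real N + 1/2)" using lower_next(1)[OF d(1), of N] False by linarith
        moreover have "\<alpha> * (real N + 1/2) \<le> 7914/10000 * (real N + 1/2)"
          using small_digits_bounds[OF less.prems] by (intro mult_right_mono) auto
        ultimately have "real N < 2" by argo
        then have N1: "N = 1" using N0 by simp
        have L1: "lower_next 1 \<alpha> = 1"
          using False lower_next(1)[OF d(1), of 1] small_digits_bounds[OF less.prems] N1 by auto
        have a23: "\<alpha> > 2/3" using lower_next(1)[OF d(1), of 1] L1 by simp
        define \<beta> where "\<beta> = gauss_map \<alpha>"
        note g = gauss_map[OF d(1-3), folded \<beta>_def]
        have b: "\<beta> \<in> small_digits 3" using small_digits_gauss[OF less.prems] by (simp add: \<beta>_def)
        have "1/\<alpha> < 3/2" using a23 by (simp add: field_simps)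
        then have "\<beta> < 1/2" using g(4,5) by linarith
        then have "lower_next 1 \<beta> = 0" using lower_next(1)[of \<beta> 1] g by auto
        then have "C 1 \<beta>" using step[OF b, of 1] C0[OF small_digits_gauss[OF b]] by simp
        then show ?thesis using step[OF less.prems, of 1] L1 N1 by (simp add: \<beta>_def)
      qed
    qed
  qed
  then show ?thesis using assms by (simp add: C_def)
qed

lemma sudler_le_power: "sudler N \<alpha> \<le> 2 ^ N"
proof (induction N)
  case (Suc N)
  have "sudler N \<alpha> * (2 * \<bar>sin (pi * (real (Suc N) * \<alpha>))\<bar>) \<le> 2 ^ N * (2 * 1)"
    using Suc by (intro mult_mono) (auto simp: sudler_nonneg)
  then show ?case unfolding sudler_Suc by simp
qed simp

definition upper_next :: "nat \<Rightarrow> real \<Rightarrow> nat" where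
  "upper_next N \<alpha> = nat \<lfloor>\<alpha> * (real N + 1/2)\<rfloor>"

lemma upper_next:
  assumes "0 < \<alpha>"
  shows "real (upper_next N \<alpha>) \<le> \<alpha> * (real N + 1/2)" "\<alpha> * (real N + 1/2) < real (upper_next N \<alpha>) + 1"
proof -
  have "\<lfloor>\<alpha> * (real N + 1/2)\<rfloor> \<ge> 0" using assms by simp
  then have "real (upper_next N \<alpha>) = real_of_int \<lfloor>\<alpha> * (real N + 1/2)\<rfloor>" by (simp add: upper_next_def)
  then show "real (upper_next N \<alpha>) \<le> \<alpha> * (real N + 1/2)" "\<alpha> * (real N + 1/2) < real (upper_next N \<alpha>) + 1"
    by linarith+
qed

text \<open>The reflection \<open>t \<mapsto> 1/\<alpha> + 1 - t\<close> turns the inequality behind the lower bound into one for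
  \<open>P\<^sub>N/N\<close>; the shift by two absorbs the rounding errors in \<open>M \<approx> \<alpha>N\<close>.\<close>

lemma sudler_le_pot:
  assumes "\<alpha> \<in> small_digits 3" "N \<ge> 3"
  shows "sudler N \<alpha> \<le> (real N - 2) * exp (10 - pot_lower (\<alpha> * (1 / \<alpha> - window_pos N (upper_next N \<alpha>) \<alpha>)))"
  using assms
proof (induction N arbitrary: \<alpha> rule: less_induct)
  case (less N)
  note d = small_digitsD[OF less.prems(1)]
  note g = gauss_map[OF d(1-3)]
  note bd = small_digits_bounds[OF less.prems(1)]
  define \<beta> where "\<beta> = gauss_map \<alpha>"
  have b: "\<beta> \<in> small_digits 3" using small_digits_gauss[OF less.prems(1)] by (simp add: \<beta>_def)
  have b0: "\<beta> > 0" using g by (simp add: \<beta>_def)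
  define M where "M = upper_next N \<alpha>"
  define M' where "M' = upper_next M \<beta>"
  note uM = upper_next[OF d(1), of N, folded M_def]
  note uM' = upper_next[OF b0, of M, folded M'_def]
  define t where "t = window_pos N M \<alpha>"
  define t' where "t' = window_pos M M' \<beta>"
  define s where "s = 1/\<alpha> + 1 - t"
  define s' where "s' = 1/\<beta> + 1 - t'"
  have win: "1/2 \<le> window_pos K L x" "window_pos K L x < 1/x + 1/2"
    if "0 < x" "real L \<le> x * (real K + 1/2)" "x * (real K + 1/2) < real L + 1" for x K L
  proof -
    have "real L / x \<le> real K + 1/2" using that by (simp add: pos_divide_le_eq mult.commute)
    then show "1/2 \<le> window_pos K L x" by (simp add: window_pos_def)
    have "(x * (real K + 1/2)) / x < (real L + 1) / x" using that by (intro divide_strict_right_mono) auto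
    then have "real K + 1/2 < real L / x + 1/x" using that by (simp add: add_divide_distrib)
    then show "window_pos K L x < 1/x + 1/2" by (simp add: window_pos_def)
  qed
  have t: "1/2 \<le> t" "t < 1/\<alpha> + 1/2" using win[OF d(1) uM] by (auto simp: t_def)
  have t': "1/2 \<le> t'" "t' < 1/\<beta> + 1/2" using win[OF b0 uM'] by (auto simp: t'_def)
  have s: "1/2 \<le> s" "s \<le> 1/\<alpha> + 1/2" "1/2 \<le> s'" "s' \<le> 1/\<beta> + 1/2" using t t' by (auto simp: s_def s'_def)
  \<comment> \<open>The mirror points of both levels again satisfy the integrality condition, with c
    replaced by n + 2 - c where n is the digit, so the same one-level inequality applies to
    them.\<close>
  have "s + \<beta> * (s' - 1) = real_of_int (int (cf_digit \<alpha>) + 2 - (int N + 1 - int M * int (cf_digit \<alpha>) - int M'))"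
  proof -
    have "\<beta> * (s' - 1) = 1 - \<beta> * t'" using b0 by (simp add: s'_def field_simps)
    moreover have "s = real (cf_digit \<alpha>) + \<beta> + 1 - t" using g(4) by (simp add: s_def \<beta>_def)
    moreover have "t + \<beta> * (t' - 1) = real_of_int (int N + 1 - int M * int (cf_digit \<alpha>) - int M')"
      using window_pos_integer[OF d(1-3), of N M M'] by (simp add: t_def t'_def \<beta>_def)
    ultimately show ?thesis by (simp add: algebra_simps)
  qed
  then have pot: "log_dsine \<alpha> s \<ge> pot_lower (\<alpha> * (s - 1)) - pot_lower (\<beta> * (s' - 1))"
    using s pot_lower_gauss_step[OF less.prems(1), of s s', folded \<beta>_def] by metis
  have "log_dsine \<alpha> t + log_dsine \<alpha> s = - ln \<alpha>" unfolding s_def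
    using t d by (intro log_dsine_refl) auto
  then have "exp (log_dsine \<alpha> t) = exp (- ln \<alpha> - log_dsine \<alpha> s)" by (simp add: algebra_simps)
  also have "\<dots> = 1 / \<alpha> * exp (- log_dsine \<alpha> s)" using d by (simp add: exp_diff exp_minus field_simps)
  also have "\<dots> \<le> 1/\<alpha> * exp (pot_lower (\<beta> * (s' - 1)) - pot_lower (\<alpha> * (s - 1)))"
    using pot d by (intro mult_left_mono) auto
  finally have et: "exp (log_dsine \<alpha> t) \<le> 1/\<alpha> * exp (pot_lower (\<beta> * (s' - 1)) - pot_lower (\<alpha> * (s - 1)))" .
  have sud: "sudler N \<alpha> = exp (log_dsine \<alpha> t) * sudler M \<beta>"
    unfolding \<beta>_def using sudler_gauss_step[OF d(1-3), of t N M] t by (simp add: t_def window_pos_def)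
  have goal: "1/\<alpha> - window_pos N (upper_next N \<alpha>) \<alpha> = s - 1" by (simp add: s_def t_def M_def)
  have sgoal: "1/\<beta> - window_pos M (upper_next M \<beta>) \<beta> = s' - 1" by (simp add: s'_def t'_def M'_def)
  show ?case
  proof (cases "M \<ge> 3")
    case True
    have "\<alpha> * (real N + 1/2) \<le> 7914/10000 * (real N + 1/2)" using bd by (intro mult_right_mono) auto
    then have "real M < real N" using uM less.prems(2) by simp
    then have IH: "sudler M \<beta> \<le> (real M - 2) * exp (10 - pot_lower (\<beta> * (s' - 1)))"
      using less.IH[of M \<beta>] True b by (simp add: sgoal)
    have "sudler N \<alpha> \<le> (1/\<alpha> * exp (pot_lower (\<beta> * (s' - 1)) - pot_lower (\<alpha> * (s - 1))))
        * ((real M - 2) * exp (10 - pot_lower (\<beta> * (s' - 1))))"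
      unfolding sud using et IH d by (intro mult_mono) (auto simp: sudler_nonneg)
    also have "\<dots> = (real M - 2) / \<alpha> * exp (10 - pot_lower (\<alpha> * (s - 1)))"
    proof -
      define p p' where "p = pot_lower (\<alpha> * (s - 1))" and "p' = pot_lower (\<beta> * (s' - 1))"
      have "1/\<alpha> * exp (p' - p) * ((real M - 2) * exp (10 - p')) = (real M - 2) / \<alpha> * (exp (p' - p) * exp (10 - p'))"
        by simp
      also have "exp (p' - p) * exp (10 - p') = exp (10 - p)" by (simp flip: exp_add)
      finally show ?thesis by (simp add: p_def p'_def)
    qed
    also have "\<dots> \<le> (real N - 2) * exp (10 - pot_lower (\<alpha> * (s - 1)))"
    proof (intro mult_right_mono)
      \<comment> \<open>From M \<le> \<alpha> (N + 1/2) this needs 5/2 \<alpha> \<le> 2; so the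
        shift by two works because \<alpha> < 4/5.\<close>
      have "real M - 2 \<le> \<alpha> * (real N - 2)" using uM(1) bd by (simp add: algebra_simps)
      then show "(real M - 2) / \<alpha> \<le> real N - 2" using d by (simp add: field_simps)
    qed simp
    finally show ?thesis unfolding goal .
  next
    case False
    \<comment> \<open>M \<le> 2 forces N \<le> 11, where the trivial bound 2^11 \<le> e^9 is enough:
      the 10 in the claim leaves 1 for the potential, which is at most 461/1000 here.\<close>
    have "2637/10000 * (real N + 1/2) \<le> \<alpha> * (real N + 1/2)" using bd by (intro mult_right_mono) auto
    moreover have "real M \<le> 2" using False by simp
    ultimately have "real N < 12" using uM(2) by argo
    then have N: "N \<le> 11" by simp
    have ab: "\<alpha> * (s - 1) \<le> 1"
    proof -
      have "\<alpha> * (s - 1) \<le> \<alpha> * (1/\<alpha> - 1/2)" using s d by (intro mult_left_mono) auto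
      also have "\<dots> = 1 - \<alpha>/2" using d by (simp add: field_simps)
      finally show ?thesis using d by simp
    qed
    have al: "\<alpha> * (s - 1) \<ge> - (1/2)"
    proof -
      have "\<alpha> * (-1/2) \<le> \<alpha> * (s - 1)" using s d by (intro mult_left_mono) auto
      then show ?thesis using d by simp
    qed
    have pm: "pot_lower (\<alpha> * (s - 1)) \<le> 461/1000" using ab al by (auto simp: pot_lower_def)
    have "sudler N \<alpha> \<le> 2 ^ N" by (rule sudler_le_power)
    also have "(2::real) ^ N \<le> 2 ^ 11" using N by (intro power_increasing) auto
    also have "(2::real) ^ 11 \<le> exp 1 ^ 9"
    proof -
      have "(5/2 :: real) \<le> exp 1" using exp_lower_Taylor_quadratic[of 1] by simp
      then have "(5/2 :: real) ^ 9 \<le> exp 1 ^ 9" by (intro power_mono) auto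
      moreover have "(2::real)^11 \<le> (5/2)^9" by (simp add: power_divide)
      ultimately show ?thesis by linarith
    qed
    also have "exp 1 ^ 9 = exp (9::real)" by (simp flip: exp_of_nat_mult)
    also have "exp (9::real) \<le> exp (10 - pot_lower (\<alpha> * (s - 1)))" using pm by simp
    also have "\<dots> \<le> (real N - 2) * exp (10 - pot_lower (\<alpha> * (s - 1)))"
      using less.prems(2) by simp
    finally show ?thesis unfolding goal .
  qed
qed

theorem small_digits_3_in_S:
  assumes "\<alpha> \<in> small_digits 3"
  shows "liminf (\<lambda>N. ereal (sudler N \<alpha>)) > 0" "limsup (\<lambda>N. ereal (sudler N \<alpha> / real N)) < \<infinity>"
proof -
  have "1 \<le> sudler N \<alpha>" for N
  proof -
    have "1 \<le> exp (pot_lower (\<alpha> * (window_pos N (lower_next N \<alpha>) \<alpha> - 1)))" using pot_lower_nonneg by simp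
    then show ?thesis using sudler_ge_pot[OF assms, of N] by linarith
  qed
  then have "ereal 1 \<le> liminf (\<lambda>N. ereal (sudler N \<alpha>))" by (intro Liminf_bounded always_eventually) auto
  then show "liminf (\<lambda>N. ereal (sudler N \<alpha>)) > 0" by (rule less_le_trans[rotated]) simp
  have "\<forall>\<^sub>F N in sequentially. ereal (sudler N \<alpha> / real N) \<le> ereal (exp 10)"
    using eventually_ge_at_top[of 3]
  proof eventually_elim
    case (elim N)
    have "sudler N \<alpha> \<le> (real N - 2) * exp (10 - pot_lower (\<alpha> * (1 / \<alpha> - window_pos N (upper_next N \<alpha>) \<alpha>)))"
      using sudler_le_pot[OF assms elim] .
    also have "\<dots> \<le> real N * exp 10" using elim pot_lower_nonneg by (intro mult_mono) auto
    finally show ?case using elim by (simp add: field_simps)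
  qed
  then have "limsup (\<lambda>N. ereal (sudler N \<alpha> / real N)) \<le> ereal (exp 10)" by (rule Limsup_bounded)
  then show "limsup (\<lambda>N. ereal (sudler N \<alpha> / real N)) < \<infinity>" using le_less_trans by fastforce
qed

section \<open>Digits at least seven\<close>

definition big_digits :: "nat \<Rightarrow> real \<Rightarrow> nat" where
  "big_digits j \<alpha> = card {i. i < j \<and> cf_digit ((gauss_map ^^ i) \<alpha>) \<ge> 7}"

lemma big_digits_Suc:
  "big_digits (Suc j) \<alpha> = (if cf_digit \<alpha> \<ge> 7 then 1 else 0) + big_digits j (gauss_map \<alpha>)"
proof -
  define Q where "Q = (\<lambda>i. cf_digit ((gauss_map ^^ i) \<alpha>) \<ge> 7)"
  have eq: "{i. i < Suc j \<and> Q i} = {i. i = 0 \<and> Q 0} \<union> Suc ` {i. i < j \<and> Q (Suc i)}"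
    by (auto simp: image_iff) (metis less_Suc_eq_0_disj old.nat.exhaust Suc_less_eq)+
  have "card {i. i < Suc j \<and> Q i} = card {i::nat. i = 0 \<and> Q 0} + card (Suc ` {i. i < j \<and> Q (Suc i)})"
    unfolding eq by (subst card_Un_disjoint) auto
  moreover have "card (Suc ` {i. i < j \<and> Q (Suc i)}) = card {i. i < j \<and> Q (Suc i)}" by (rule card_image) simp
  moreover have "card {i. i = (0::nat) \<and> Q 0} = (if Q 0 then 1 else 0)" by (auto simp: card_eq_0_iff)
  ultimately show ?thesis unfolding big_digits_def Q_def by (simp add: funpow_Suc_right del: funpow.simps)
qed

text \<open>\<open>b\<close> counts the digits at least seven met so far. The three alternatives are: the last level
  had a digit at least seven, or \<open>d = \<alpha>N - M\<close> is small and nonnegative, respectively nonpositive.\<close>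

definition upper_inv :: "real \<Rightarrow> nat \<Rightarrow> nat \<Rightarrow> nat \<Rightarrow> bool" where
  "upper_inv \<alpha> N M b \<longleftrightarrow> N \<ge> b \<and> (let d = \<alpha> * real N - real M; w = (\<lambda>x. exp (157/1000 - real b / 2000 - x)) in
     (\<alpha> \<le> 1/7 \<and> 0 \<le> d \<and> d \<le> 1432/10000 \<and> sudler N \<alpha> \<le> w (157/1000)) \<or>
     (\<alpha> \<ge> 1/7 \<and> 0 \<le> d \<and> d \<le> 725/10000 \<and> sudler N \<alpha> \<le> w (115/100 * d)) \<or>
     (\<alpha> \<ge> 1/7 \<and> d \<le> 0 \<and> - d \<le> 1432/10000 * \<alpha> \<and> sudler N \<alpha> \<le> w (upper_slope \<alpha> * (- d))))"

text \<open>The expansion is extended at its front: (N, M) becomes (n N + M + c, N), with c = 1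
  exactly at digits n \<ge> 7. The deviation d turns into \<alpha> (c - d), and the new factor has
  \<open>log_dsine\<close> at 1 + c - d as its logarithm.\<close>

lemma upper_inv_step:
  assumes al: "0 < \<alpha>" "\<alpha> < 1" "\<alpha> \<notin> \<rat>" and inv: "upper_inv (gauss_map \<alpha>) N M b"
  shows "\<exists>N' M'. upper_inv \<alpha> N' M' ((if cf_digit \<alpha> \<ge> 7 then 1 else 0) + b)"
proof -
  define \<beta> where "\<beta> = gauss_map \<alpha>"
  define n where "n = cf_digit \<alpha>"
  note g = gauss_map[OF al, folded \<beta>_def n_def]
  define d where "d = \<beta> * real N - real M"
  define w where "w = (\<lambda>b x. exp (157/1000 - real b / 2000 - x))"
  have w_mult: "exp l * w b x = w b (x - l)" for l b x by (simp add: w_def exp_add[symmetric] algebra_simps)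
  have inv': "N \<ge> b" and cases: "(\<beta> \<le> 1/7 \<and> 0 \<le> d \<and> d \<le> 1432/10000 \<and> sudler N \<beta> \<le> w b (157/1000)) \<or>
     (\<beta> \<ge> 1/7 \<and> 0 \<le> d \<and> d \<le> 725/10000 \<and> sudler N \<beta> \<le> w b (115/100 * d)) \<or>
     (\<beta> \<ge> 1/7 \<and> d \<le> 0 \<and> - d \<le> 1432/10000 * \<beta> \<and> sudler N \<beta> \<le> w b (upper_slope \<beta> * (- d)))"
    using inv unfolding upper_inv_def Let_def d_def w_def \<beta>_def by blast+
  have dr: "- (1432/10000) \<le> d" "d \<le> 1432/10000" using cases g by auto
  have new: "\<alpha> * real (n * N + M + c) - real N = \<alpha> * (real c - d)"
    "sudler (n * N + M + c) \<alpha> = exp (log_dsine \<alpha> (1 + real c - d)) * sudler N \<beta>" if "c = 0 \<or> c = 1 \<and> 1 / \<alpha> \<ge> 7" for c :: nat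
  proof -
    have "real (n * N + M + c) - real N * (1/\<alpha>) = real c - d" unfolding g(4) by (simp add: d_def algebra_simps)
    then have e: "real (n * N + M + c) - real N / \<alpha> = real c - d" by simp
    then show "\<alpha> * real (n * N + M + c) - real N = \<alpha> * (real c - d)" using al by (simp add: field_simps)
    have X1: "1/\<alpha> > 1" using al by simp
    have "0 < 1 + real c - d" "1 + real c - d < 1/\<alpha> + 1" using X1 dr that by auto
    then show "sudler (n * N + M + c) \<alpha> = exp (log_dsine \<alpha> (1 + real c - d)) * sudler N \<beta>"
      unfolding \<beta>_def using e by (intro sudler_gauss_step al) auto
  qed
  have nb: "n * N + M + c \<ge> N" for c using g(5) by (simp add: add.assoc trans_le_add1)
  show ?thesis
  proof (cases "n \<ge> 7")
    case False
    have "real n \<le> 6" using False by simp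
    then have a7: "\<alpha> \<ge> 1/7" using g by (subst g(6)) (intro divide_left_mono, auto)
    have le: "sudler (n * N + M + 0) \<alpha> \<le> w b (x - log_dsine \<alpha> (1 - d))" if "sudler N \<beta> \<le> w b x" for x
    proof -
      have "sudler (n * N + M + 0) \<alpha> \<le> exp (log_dsine \<alpha> (1 - d)) * w b x"
        using new(2)[of 0] that by simp
      then show ?thesis by (simp add: w_mult)
    qed
    have wm: "w b x \<le> w b y" if "y \<le> x" for x y using that by (simp add: w_def)
    have nd: "\<alpha> * real (n * N + M + 0) - real N = - (\<alpha> * d)" using new(1)[of 0] by simp
    \<comment> \<open>With c = 0 the sign of the deviation alternates: the first two alternatives
      lead to the third, and the third leads to the second.\<close>
    have "upper_inv \<alpha> (n * N + M + 0) N b"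
    proof -
      from cases consider (J) "\<beta> \<le> 1/7" "0 \<le> d" "d \<le> 1432/10000" "sudler N \<beta> \<le> w b (157/1000)"
        | (P) "0 \<le> d" "d \<le> 725/10000" "sudler N \<beta> \<le> w b (115/100 * d)"
        | (Ng) "d \<le> 0" "- d \<le> 1432/10000 * \<beta>" "sudler N \<beta> \<le> w b (upper_slope \<beta> * (- d))" by blast
      then show ?thesis
      proof cases
        case J
        have "\<alpha> \<ge> 7/43"
        proof -
          have "7/43 = 1 / (6 + 1/7 :: real)" by simp
          also have "\<dots> \<le> \<alpha>" using g J \<open>real n \<le> 6\<close> by (subst g(6)) (intro divide_left_mono, auto)
          finally show ?thesis .
        qed
        then have "log_dsine \<alpha> (1 - d) + upper_slope \<alpha> * (\<alpha> * d) \<le> 157/1000"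
          using J al by (intro log_dsine_upper_jump) auto
        then have "sudler (n * N + M + 0) \<alpha> \<le> w b (upper_slope \<alpha> * (\<alpha> * d))"
          using le[OF J(4)] wm[of "upper_slope \<alpha> * (\<alpha> * d)" "157/1000 - log_dsine \<alpha> (1 - d)"] by linarith
        moreover have "\<alpha> * d \<le> \<alpha> * (1432/10000)" "0 \<le> \<alpha> * d" using J al by (auto intro!: mult_left_mono)
        ultimately show ?thesis unfolding upper_inv_def Let_def nd
          using a7 inv' nb[of 0] by (auto simp: w_def)
      next
        case P
        then have "log_dsine \<alpha> (1 - d) + upper_slope \<alpha> * (\<alpha> * d) \<le> 115/100 * d"
          using a7 al by (intro log_dsine_upper_pos) auto
        then have "sudler (n * N + M + 0) \<alpha> \<le> w b (upper_slope \<alpha> * (\<alpha> * d))"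
          using le[OF P(3)] wm[of "upper_slope \<alpha> * (\<alpha> * d)" "115/100 * d - log_dsine \<alpha> (1 - d)"] by linarith
        moreover have "\<alpha> * d \<le> \<alpha> * (1432/10000)" "0 \<le> \<alpha> * d" using P al by (auto intro!: mult_left_mono)
        ultimately show ?thesis unfolding upper_inv_def Let_def nd
          using a7 inv' nb[of 0] by (auto simp: w_def)
      next
        case Ng
        have "log_dsine \<alpha> (1 + (- d)) + 115/100 * (\<alpha> * (- d)) \<le> upper_slope \<beta> * (- d)"
          using Ng al g by (intro log_dsine_upper_neg) auto
        then have "sudler (n * N + M + 0) \<alpha> \<le> w b (115/100 * (\<alpha> * (- d)))"
          using le[OF Ng(3)] wm[of "115/100 * (\<alpha> * (- d))" "upper_slope \<beta> * (- d) - log_dsine \<alpha> (1 - d)"] by simp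
        \<comment> \<open>\<alpha> \<beta> = \<beta>/(n + \<beta>) is at most 1/2, and half of
          1432/10000 is 716/10000.\<close>
        moreover have "\<alpha> * (- d) \<le> 725/10000"
        proof -
          have "\<alpha> * \<beta> \<le> 1/2"
          proof -
            have "\<alpha> * (2 * \<beta>) \<le> \<alpha> * (1/\<alpha>)" using g al by (intro mult_left_mono) auto
            then show ?thesis using al by simp
          qed
          moreover have "\<alpha> * (- d) \<le> \<alpha> * (1432/10000 * \<beta>)" using Ng al by (intro mult_left_mono) auto
          ultimately show ?thesis by argo
        qed
        moreover have "0 \<le> \<alpha> * (- d)" using Ng al by (intro mult_nonneg_nonneg) auto
        ultimately show ?thesis unfolding upper_inv_def Let_def nd
          using a7 inv' nb[of 0] by (auto simp: w_def)
      qed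
    qed
    then show ?thesis using False by (auto simp: n_def)
  next
    case True
    have n7: "real n \<ge> 7" using True by simp
    have X7: "1/\<alpha> \<ge> 7 + \<beta>" using g n7 by simp
    then have a7: "\<alpha> * (7 + \<beta>) \<le> 1" using al by (simp add: field_simps)
    have "\<alpha> * 7 \<le> \<alpha> * (7 + \<beta>)" using g al by (intro mult_left_mono) auto
    then have a7': "\<alpha> \<le> 1/7" using a7 by linarith
    have sneg: "ln (2 * sin (pi * \<alpha>)) \<le> - 1/10"
    proof -
      have "2 * sin (pi * \<alpha>) \<le> 2 * (pi * \<alpha>)" using al by (intro mult_left_mono sin_x_le_x) auto
      also have "\<dots> \<le> 2 * (315/100 * (1/7))" using a7' al pi_approx by (intro mult_left_mono mult_mono) auto
      finally have "2 * sin (pi * \<alpha>) \<le> 9/10" by simp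
      moreover have "sin (pi * \<alpha>) > 0" using al by (intro sin_gt_zero) auto
      ultimately have "ln (2 * sin (pi * \<alpha>)) \<le> ln (9/10)" by (intro ln_mono) auto
      also have "\<dots> \<le> 9/10 - 1" by (rule ln_le_minus_one) simp
      finally show ?thesis by simp
    qed
    \<comment> \<open>A next tail of at least 1/7 gives \<alpha> \<le> 1/(7 + 1/7) = 0.14 and a gain
      above 157/1000 + 1/2000. For a smaller tail the old invariant already carries 157/1000, and
      the weaker \<open>sneg\<close> suffices.\<close>
    have s14: "ln (2 * sin (pi * \<alpha>)) \<le> - 158/1000" if "\<beta> \<ge> 1/7"
    proof (rule ln_two_sin_small)
      have "\<alpha> * (7 + 1/7) \<le> \<alpha> * (7 + \<beta>)" using that al by (intro mult_left_mono) auto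
      then show "\<alpha> \<le> 14/100" using a7 by simp
    qed (use al in simp)
    have key: "log_dsine \<alpha> (2 - d) + 157/1000 + 1/2000 \<le> x"
      if "(\<beta> \<le> 1/7 \<and> 0 \<le> d \<and> x = 157/1000) \<or> (\<beta> \<ge> 1/7 \<and> 0 \<le> d \<and> x = 115/100 * d)
         \<or> (\<beta> \<ge> 1/7 \<and> d \<le> 0 \<and> x = upper_slope \<beta> * (- d))" for x
      using that
    proof (elim disjE conjE)
      assume *: "0 \<le> d" "x = 157/1000"
      have "log_dsine \<alpha> (2 - d) \<le> (1 - d) * ln (2 * sin (pi * \<alpha>))"
        using * dr al a7' by (intro log_dsine_upper_big) auto
      also have "\<dots> \<le> (1 - d) * (- 1/10)" using sneg dr by (intro mult_left_mono) auto
      finally show ?thesis using * dr by argo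
    next
      assume *: "\<beta> \<ge> 1/7" "0 \<le> d" "x = 115/100 * d"
      have "log_dsine \<alpha> (2 - d) \<le> (1 - d) * ln (2 * sin (pi * \<alpha>))"
        using * dr al a7' by (intro log_dsine_upper_big) auto
      also have "\<dots> \<le> (1 - d) * (- 158/1000)" using s14[OF *(1)] dr by (intro mult_left_mono) auto
      finally show ?thesis using * dr by argo
    next
      assume *: "\<beta> \<ge> 1/7" "d \<le> 0" "x = upper_slope \<beta> * (- d)"
      have "log_dsine \<alpha> (2 + (- d)) \<le> ln (2 * sin (pi * \<alpha>)) + (- d) * ln 2"
        using * dr al a7' by (intro log_dsine_upper_big) auto
      moreover have "(- d) * ln 2 \<le> (- d) * (69315/100000)" using * ln_2_bounds by (intro mult_left_mono) auto
      moreover have "upper_slope \<beta> * (- d) \<ge> (69315/100000) * (- d)"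
        using * g by (intro mult_right_mono) (auto simp: upper_slope_def)
      ultimately have "log_dsine \<alpha> (2 - d) \<le> - 158/1000 + x" using s14[OF *(1)] * by simp
      then show ?thesis by argo
    qed
    obtain x where x: "sudler N \<beta> \<le> w b x" "log_dsine \<alpha> (2 - d) + 157/1000 + 1/2000 \<le> x"
      using cases key by blast
    have "sudler (n * N + M + 1) \<alpha> \<le> exp (log_dsine \<alpha> (2 - d)) * w b x" using new(2)[of 1] x(1) X7 g by simp
    also have "\<dots> = w b (x - log_dsine \<alpha> (2 - d))" by (rule w_mult)
    also have "\<dots> \<le> w (1 + b) (157/1000)"
      unfolding w_def exp_le_cancel_iff of_nat_add of_nat_1 using x(2) by argo
    finally have sd: "sudler (n * N + M + 1) \<alpha> \<le> w (1 + b) (157/1000)" .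
    have nd: "\<alpha> * real (n * N + M + 1) - real N = \<alpha> * (1 - d)" using new(1)[of 1] X7 g by simp
    have "\<alpha> * (1 - d) \<ge> 0" using al dr by (intro mult_nonneg_nonneg) auto
    moreover have "\<alpha> * (1 - d) \<le> 1432/10000"
    proof (cases "d \<ge> 0")
      case True
      then have "\<alpha> * (1 - d) \<le> 1/7 * 1" using al a7' dr by (intro mult_mono) auto
      then show ?thesis by simp
    next
      case False
      then have "- d \<le> 1432/10000 * \<beta>" using cases by auto
      then have "\<alpha> * (1 - d) \<le> \<alpha> * (1 + 1432/10000 * \<beta>)" using al by (intro mult_left_mono) auto
      \<comment> \<open>Holds because 7 times 1432/10000 exceeds 1; this determines the
        constant.\<close>
      also have "\<dots> \<le> 1432/10000 * (\<alpha> * (7 + \<beta>))" using al by (simp add: field_simps)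
      also have "\<dots> \<le> 1432/10000 * 1" using a7 by (intro mult_left_mono) auto
      finally show ?thesis by simp
    qed
    ultimately have "upper_inv \<alpha> (n * N + M + 1) N (1 + b)"
      unfolding upper_inv_def Let_def nd using sd a7' inv' nb[of 0] by (auto simp: w_def)
    then show ?thesis using True by (auto simp: n_def)
  qed
qed

text \<open>The j-th tail starts with N = M = 0 and deviation 0; the j digits in front of it are
  then added one at a time.\<close>

lemma upper_inv_exists:
  assumes "0 < \<alpha>" "\<alpha> < 1" "\<alpha> \<notin> \<rat>"
  shows "\<exists>N M. upper_inv \<alpha> N M (big_digits j \<alpha>)"
  using assms
proof (induction j arbitrary: \<alpha>)
  case 0
  have "upper_inv \<alpha> 0 0 0" by (auto simp: upper_inv_def Let_def)
  then show ?case by (auto simp: big_digits_def)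
next
  case (Suc j)
  obtain N M where "upper_inv (gauss_map \<alpha>) N M (big_digits j (gauss_map \<alpha>))"
    using Suc.IH gauss_map(1-3)[OF Suc.prems] by blast
  from upper_inv_step[OF Suc.prems this] show ?case unfolding big_digits_Suc .
qed

text \<open>With b big digits among the first j, the invariant yields P_N \<le> exp (157/1000 -
  b/2000) for some N \<ge> b. The clause N \<ge> b makes these N unbounded.\<close>

theorem infinitely_many_big_digits:
  assumes al: "0 < \<alpha>" "\<alpha> < 1" "\<alpha> \<notin> \<rat>" and inf: "infinite {k. cf_digit ((gauss_map ^^ k) \<alpha>) \<ge> 7}"
  shows "\<not> liminf (\<lambda>N. ereal (sudler N \<alpha>)) > 0"
proof
  assume "liminf (\<lambda>N. ereal (sudler N \<alpha>)) > 0"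
  then obtain c where c: "0 < ereal c" "ereal c < liminf (\<lambda>N. ereal (sudler N \<alpha>))"
    using ereal_dense2 by blast
  from less_LiminfD[OF c(2)] obtain n0 where n0: "\<And>N. N \<ge> n0 \<Longrightarrow> c < sudler N \<alpha>"
    by (auto simp: eventually_sequentially)
  obtain m :: nat where m: "real m > 2000 * (157/1000 - ln c)" using reals_Archimedean2 by blast
  define b where "b = max m n0"
  obtain A where A: "A \<subseteq> {k. cf_digit ((gauss_map ^^ k) \<alpha>) \<ge> 7}" "finite A" "card A = b"
    using infinite_arbitrarily_large[OF inf] by blast
  define j where "j = Suc (Max (insert 0 A))"
  have "A \<subseteq> {i. i < j \<and> cf_digit ((gauss_map ^^ i) \<alpha>) \<ge> 7}"
    using A Max_ge[of "insert 0 A"] by (auto simp: j_def less_Suc_eq_le)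
  then have bj: "big_digits j \<alpha> \<ge> b" unfolding big_digits_def A(3)[symmetric] by (intro card_mono) auto
  obtain N M where inv: "upper_inv \<alpha> N M (big_digits j \<alpha>)" using upper_inv_exists[OF al] by blast
  have "sudler N \<alpha> \<le> exp (157/1000 - real (big_digits j \<alpha>) / 2000)"
  proof -
    have mono: "exp (157/1000 - real (big_digits j \<alpha>) / 2000 - x) \<le> exp (157/1000 - real (big_digits j \<alpha>) / 2000)"
      if "x \<ge> 0" for x using that by simp
    have u: "upper_slope \<alpha> \<ge> 0" using al by (simp add: upper_slope_def)
    define d where "d = \<alpha> * real N - real M"
    have "\<exists>x\<ge>0. sudler N \<alpha> \<le> exp (157/1000 - real (big_digits j \<alpha>) / 2000 - x)"
    proof -
      consider "sudler N \<alpha> \<le> exp (157/1000 - real (big_digits j \<alpha>) / 2000 - 157/1000)"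
        | "0 \<le> d" "sudler N \<alpha> \<le> exp (157/1000 - real (big_digits j \<alpha>) / 2000 - 115/100 * d)"
        | "d \<le> 0" "sudler N \<alpha> \<le> exp (157/1000 - real (big_digits j \<alpha>) / 2000 - upper_slope \<alpha> * (- d))"
        using inv unfolding upper_inv_def Let_def d_def by blast
      then show ?thesis
      proof cases
        case 1 then show ?thesis by (intro exI[of _ "157/1000"]) simp
      next
        case 2
        then have "0 \<le> 115/100 * d" by simp
        then show ?thesis using 2 by blast
      next
        case 3
        then have "0 \<le> upper_slope \<alpha> * (- d)" using u by (intro mult_nonneg_nonneg) auto
        then show ?thesis using 3 by blast
      qed
    qed
    then show ?thesis using mono order.trans by blast
  qed
  also have "\<dots> \<le> exp (ln c)"
  proof -
    have "real m \<le> real (big_digits j \<alpha>)" using bj by (simp add: b_def)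
    then show ?thesis using m by simp
  qed
  also have "\<dots> = c" using c by simp
  finally have "sudler N \<alpha> \<le> c" .
  moreover have "N \<ge> n0" using inv bj by (auto simp: upper_inv_def b_def)
  ultimately show False using n0[of N] by simp
qed

section \<open>Hausdorff null sets\<close>

lemma hausdorff_measure_zeroI:
  assumes "\<And>\<delta> \<epsilon>. 0 < \<delta> \<Longrightarrow> 0 < \<epsilon> \<Longrightarrow> \<exists>U :: nat \<Rightarrow> 'a::metric_space set. A \<subseteq> (\<Union>i. U i) \<and>
    (\<forall>i. bounded (U i) \<and> diameter (U i) \<le> \<delta>) \<and> (\<Sum>i. diam_weight s (U i)) \<le> ennreal \<epsilon>"
  shows "hausdorff_measure s A = 0"
proof -
  have "hausdorff_pre_measure s \<delta> A \<le> 0" if "\<delta> > 0" for \<delta>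
  proof (rule ennreal_le_epsilon)
    fix \<epsilon> :: real
    assume "\<epsilon> > 0"
    then obtain U where U: "A \<subseteq> (\<Union>i. U i)" "\<forall>i. bounded (U i) \<and> diameter (U i) \<le> \<delta>"
      "(\<Sum>i. diam_weight s (U i)) \<le> ennreal \<epsilon>" using assms[OF \<open>\<delta> > 0\<close>] by blast
    have "hausdorff_pre_measure s \<delta> A \<le> (\<Sum>i. diam_weight s (U i))"
      unfolding hausdorff_pre_measure_def using U by (intro INF_lower) auto
    then show "hausdorff_pre_measure s \<delta> A \<le> 0 + ennreal \<epsilon>" using U(3) by simp
  qed
  then have "hausdorff_measure s A \<le> 0" unfolding hausdorff_measure_def by (intro SUP_least) auto
  then show ?thesis by simp
qed

lemma hausdorff_measure_zeroD:
  assumes "hausdorff_measure s A = 0" "0 < \<delta>" "0 < \<epsilon>"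
  obtains U :: "nat \<Rightarrow> 'a::metric_space set" where "A \<subseteq> (\<Union>i. U i)" "\<And>i. bounded (U i)"
    "\<And>i. diameter (U i) \<le> \<delta>" "(\<Sum>i. diam_weight s (U i)) < ennreal \<epsilon>"
proof -
  have "hausdorff_pre_measure s \<delta> A \<le> hausdorff_measure s A"
    unfolding hausdorff_measure_def using assms(2) by (intro SUP_upper) auto
  then have "hausdorff_pre_measure s \<delta> A < ennreal \<epsilon>" using assms by simp
  then show ?thesis unfolding hausdorff_pre_measure_def INF_less_iff using that by auto
qed

lemma hausdorff_measure_zero_subset:
  fixes A B :: "'a::metric_space set"
  assumes "hausdorff_measure s B = 0" "A \<subseteq> B"
  shows "hausdorff_measure s A = 0"
proof (rule hausdorff_measure_zeroI)
  fix \<delta> \<epsilon> :: real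
  assume "0 < \<delta>" "0 < \<epsilon>"
  then obtain U :: "nat \<Rightarrow> 'a set" where "B \<subseteq> (\<Union>i. U i)" "\<And>i. bounded (U i)"
    "\<And>i. diameter (U i) \<le> \<delta>" "(\<Sum>i. diam_weight s (U i)) < ennreal \<epsilon>"
    using hausdorff_measure_zeroD[OF assms(1)] by metis
  then show "\<exists>U :: nat \<Rightarrow> 'a set. A \<subseteq> (\<Union>i. U i) \<and>
    (\<forall>i. bounded (U i) \<and> diameter (U i) \<le> \<delta>) \<and> (\<Sum>i. diam_weight s (U i)) \<le> ennreal \<epsilon>"
    using assms(2) by (intro exI[of _ U]) auto
qed

lemma hausdorff_measure_zero_UN:
  fixes A :: "nat \<Rightarrow> 'a::metric_space set"
  assumes "\<And>i. hausdorff_measure s (A i) = 0"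
  shows "hausdorff_measure s (\<Union>i. A i) = 0"
proof (rule hausdorff_measure_zeroI)
  fix \<delta> \<epsilon> :: real
  assume \<delta>\<epsilon>: "0 < \<delta>" "0 < \<epsilon>"
  have "\<exists>U :: nat \<Rightarrow> 'a set. A i \<subseteq> (\<Union>j. U j) \<and> (\<forall>j. bounded (U j) \<and> diameter (U j) \<le> \<delta>) \<and>
      (\<Sum>j. diam_weight s (U j)) \<le> ennreal (\<epsilon> * (1/2) ^ Suc i)" for i
    using hausdorff_measure_zeroD[OF assms[of i] \<delta>\<epsilon>(1), of "\<epsilon> * (1/2) ^ Suc i"] \<delta>\<epsilon>(2)
    by (metis less_imp_le mult_pos_pos zero_less_power half_gt_zero zero_less_one)
  then obtain U :: "nat \<Rightarrow> nat \<Rightarrow> 'a set" where U: "\<And>i. A i \<subseteq> (\<Union>j. U i j)"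
    "\<And>i j. bounded (U i j)" "\<And>i j. diameter (U i j) \<le> \<delta>"
    "\<And>i. (\<Sum>j. diam_weight s (U i j)) \<le> ennreal (\<epsilon> * (1/2) ^ Suc i)" by metis
  define V where "V k = (case prod_decode k of (i, j) \<Rightarrow> U i j)" for k
  have "(\<Sum>k. diam_weight s (V k)) = (\<Sum>i. \<Sum>j. diam_weight s (U i j))"
    using suminf_ennreal_2dimen[of "\<lambda>i. (\<Sum>j. diam_weight s (U i j))" "\<lambda>(i, j). diam_weight s (U i j)"]
    by (simp add: V_def comp_def split_def)
  also have "\<dots> \<le> (\<Sum>i. ennreal (\<epsilon> * (1/2) ^ Suc i))" by (intro suminf_le U) auto
  also have "\<dots> = ennreal \<epsilon>"
  proof (rule suminf_ennreal_eq)
    show "(\<lambda>i. \<epsilon> * (1/2) ^ Suc i) sums \<epsilon>" using sums_mult[OF power_half_series, of \<epsilon>] by simp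
  qed (use \<delta>\<epsilon> in simp)
  finally have "(\<Sum>k. diam_weight s (V k)) \<le> ennreal \<epsilon>" .
  moreover have "(\<Union>i. A i) \<subseteq> (\<Union>k. V k)"
  proof
    fix x assume "x \<in> (\<Union>i. A i)"
    then obtain i j where "x \<in> U i j" using U(1) by blast
    then have "x \<in> V (prod_encode (i, j))" by (simp add: V_def)
    then show "x \<in> (\<Union>k. V k)" by blast
  qed
  ultimately show "\<exists>U :: nat \<Rightarrow> 'a set. (\<Union>i. A i) \<subseteq> (\<Union>i. U i) \<and>
    (\<forall>i. bounded (U i) \<and> diameter (U i) \<le> \<delta>) \<and> (\<Sum>i. diam_weight s (U i)) \<le> ennreal \<epsilon>"
    using U(2,3) by (intro exI[of _ V]) (auto simp: V_def split: prod.split)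
qed

text \<open>The mesh condition is automatic for s > 0: if the s-th powers of the diameters sum to at
  most \<delta>^s, every diameter is at most \<delta>.\<close>

lemma hausdorff_measure_zero_finite_covers:
  fixes A :: "'a::metric_space set" and U :: "'i \<Rightarrow> 'a set"
  assumes s: "s > 0"
    and cov: "\<And>\<epsilon>. 0 < \<epsilon> \<Longrightarrow> \<exists>V. finite V \<and> A \<subseteq> (\<Union>v\<in>V. U v) \<and> (\<forall>v\<in>V. bounded (U v)) \<and>
      (\<Sum>v\<in>V. diameter (U v) powr s) \<le> \<epsilon>"
  shows "hausdorff_measure s A = 0"
proof (rule hausdorff_measure_zeroI)
  fix \<delta> \<epsilon> :: real
  assume \<delta>\<epsilon>: "0 < \<delta>" "0 < \<epsilon>"
  then have "min \<epsilon> (\<delta> powr s) > 0" by simp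
  then obtain V where V: "finite V" "A \<subseteq> (\<Union>v\<in>V. U v)" "\<And>v. v \<in> V \<Longrightarrow> bounded (U v)"
    "(\<Sum>v\<in>V. diameter (U v) powr s) \<le> min \<epsilon> (\<delta> powr s)" using cov by metis
  obtain e where e: "bij_betw e {0..<card V} V" using ex_bij_betw_nat_finite[OF V(1)] by blast
  define W where "W i = (if i < card V then U (e i) else {})" for i
  have eV: "e i \<in> V" if "i < card V" for i using e that by (auto simp: bij_betw_def)
  have "A \<subseteq> (\<Union>i. W i)"
  proof
    fix x assume "x \<in> A"
    then obtain v where v: "v \<in> V" "x \<in> U v" using V(2) by blast
    then obtain i where "i < card V" "v = e i" using e 
      by (metis atLeastLessThan_iff bij_betw_imp_surj_on imageE)
    then show "x \<in> (\<Union>i. W i)" using v by (auto simp: W_def)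
  qed
  moreover have "bounded (W i) \<and> diameter (W i) \<le> \<delta>" for i
  proof (cases "i < card V")
    case True
    have "diameter (U (e i)) powr s \<le> (\<Sum>v\<in>V. diameter (U v) powr s)"
      using V(1) eV[OF True] by (intro member_le_sum) auto
    then have "diameter (U (e i)) powr s \<le> \<delta> powr s" using V(4) by simp
    then have "diameter (U (e i)) \<le> \<delta>" using s \<delta>\<epsilon> by (metis less_le_trans linorder_not_le powr_less_mono2 less_imp_le)
    then show ?thesis using True eV V by (simp add: W_def)
  qed (use \<delta>\<epsilon> in \<open>simp add: W_def\<close>)
  moreover have "(\<Sum>i. diam_weight s (W i)) \<le> ennreal \<epsilon>"
  proof -
    have "(\<Sum>i. diam_weight s (W i)) = (\<Sum>i\<in>{0..<card V}. diam_weight s (W i))"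
      by (rule suminf_finite) (auto simp: W_def diam_weight_def)
    also have "\<dots> \<le> (\<Sum>i\<in>{0..<card V}. ennreal (diameter (U (e i)) powr s))"
      using s by (intro sum_mono) (auto simp: W_def diam_weight_def)
    also have "\<dots> = (\<Sum>v\<in>V. ennreal (diameter (U v) powr s))" by (rule sum.reindex_bij_betw[OF e])
    also have "\<dots> = ennreal (\<Sum>v\<in>V. diameter (U v) powr s)" by (simp add: sum_ennreal)
    also have "\<dots> \<le> ennreal \<epsilon>" using V(4) by (intro ennreal_leI) simp
    finally show ?thesis .
  qed
  ultimately show "\<exists>U :: nat \<Rightarrow> 'a set. A \<subseteq> (\<Union>i. U i) \<and>
    (\<forall>i. bounded (U i) \<and> diameter (U i) \<le> \<delta>) \<and> (\<Sum>i. diam_weight s (U i)) \<le> ennreal \<epsilon>"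
    by (intro exI[of _ W]) auto
qed

lemma sum_UN_le_sum:
  fixes f :: "'b \<Rightarrow> real"
  assumes "finite I" "\<And>i. finite (A i)" "\<And>i x. i \<in> I \<Longrightarrow> x \<in> A i \<Longrightarrow> 0 \<le> f x"
  shows "(\<Sum>x\<in>(\<Union>i\<in>I. A i). f x) \<le> (\<Sum>i\<in>I. \<Sum>x\<in>A i. f x)"
  using assms(1,3)
proof (induction I rule: finite_induct)
  case (insert i I)
  have fin: "finite (\<Union>i\<in>I. A i)" using insert assms(2) by auto
  have "(\<Sum>x\<in>(A i \<union> (\<Union>i\<in>I. A i)). f x) \<le> (\<Sum>x\<in>A i. f x) + (\<Sum>x\<in>(\<Union>i\<in>I. A i). f x)"
    using sum.union_inter[OF assms(2)[of i] fin, of f] sum_nonneg[of "A i \<inter> (\<Union>i\<in>I. A i)" f] insert.prems by fastforce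
  moreover have "(\<Sum>x\<in>(\<Union>i\<in>I. A i). f x) \<le> (\<Sum>i\<in>I. \<Sum>x\<in>A i. f x)" using insert.prems by (intro insert.IH) auto
  ultimately show ?case using insert.hyps by simp
qed simp

section \<open>Inverse branches of the Gauss map\<close>

fun cf_map :: "nat list \<Rightarrow> real \<Rightarrow> real" where
  "cf_map [] x = x"
| "cf_map (a # w) x = 1 / (real a + cf_map w x)"

text \<open>The denominator of the linear fractional map \<open>cf_map w\<close>; its numerator is
  \<open>cf_map w x * cf_den w x\<close>.\<close>

fun cf_den :: "nat list \<Rightarrow> real \<Rightarrow> real" where
  "cf_den [] x = 1"
| "cf_den (a # w) x = (real a + cf_map w x) * cf_den w x"

lemma cf_map_append: "cf_map (v @ w) x = cf_map v (cf_map w x)"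
  by (induction v) auto

lemma cf_map_nonneg: "x \<ge> 0 \<Longrightarrow> cf_map w x \<ge> 0"
  by (induction w) auto

lemma cf_den_ge_1: "0 \<notin> set w \<Longrightarrow> x \<ge> 0 \<Longrightarrow> cf_den w x \<ge> 1"
proof (induction w)
  case (Cons a w)
  have "1 * 1 \<le> (real a + cf_map w x) * cf_den w x"
    using Cons cf_map_nonneg[of x w] by (intro mult_mono) auto
  then show ?case by simp
qed simp

text \<open>The branches are linear fractional maps of determinant 1 or -1, so difference quotients
  are reciprocals of products of two denominators.\<close>

lemma cf_map_diff:
  assumes "0 \<notin> set w" "x \<ge> 0" "y \<ge> 0"
  shows "\<bar>cf_map w x - cf_map w y\<bar> = \<bar>x - y\<bar> / (cf_den w x * cf_den w y)"
  using assms
proof (induction w)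
  case (Cons a w)
  define p q where "p = real a + cf_map w x" and "q = real a + cf_map w y"
  have pq: "p > 0" "q > 0" using Cons cf_map_nonneg[of x w] cf_map_nonneg[of y w] by (auto simp: p_def q_def)
  have "1 / p - 1 / q = (cf_map w y - cf_map w x) / (p * q)" using pq by (simp add: field_simps p_def q_def)
  then have "\<bar>1 / p - 1 / q\<bar> = \<bar>cf_map w x - cf_map w y\<bar> / (p * q)"
    using pq by (simp add: abs_divide abs_mult abs_minus_commute)
  also have "\<dots> = \<bar>x - y\<bar> / (cf_den w x * cf_den w y) / (p * q)" using Cons by simp
  finally show ?case by (simp add: p_def q_def mult_ac)
qed simp

text \<open>The second conjunct compares numerator plus denominator, which makes the induction go through.\<close>

lemma cf_den_distortion_aux:
  assumes "0 \<notin> set w" "0 \<le> x" "x \<le> 1" "0 \<le> y"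
  shows "cf_den w x \<le> 2 * cf_den w y \<and> (1 + cf_map w x) * cf_den w x \<le> 2 * ((1 + cf_map w y) * cf_den w y)"
  using assms
proof (induction w)
  case (Cons a w)
  have a: "real a \<ge> 1" using Cons by (cases a) auto
  have num: "cf_map (a # w) z * cf_den (a # w) z = cf_den w z" if "z \<ge> 0" for z
    using a cf_map_nonneg[OF that, of w] by simp
  have den: "cf_den (a # w) z = (real a - 1) * cf_den w z + (1 + cf_map w z) * cf_den w z" for z
    by (simp add: algebra_simps)
  have sm: "(1 + cf_map (a # w) z) * cf_den (a # w) z
      = real a * cf_den w z + (1 + cf_map w z) * cf_den w z" if "z \<ge> 0" for z
    using num[OF that] unfolding distrib_right[of 1] den by (simp add: algebra_simps)
  have IH: "cf_den w x \<le> 2 * cf_den w y" "(1 + cf_map w x) * cf_den w x \<le> 2 * ((1 + cf_map w y) * cf_den w y)"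
    using Cons by auto
  have "(real a - 1) * cf_den w x \<le> (real a - 1) * (2 * cf_den w y)" "real a * cf_den w x \<le> real a * (2 * cf_den w y)"
    using a IH(1) by (auto intro!: mult_left_mono)
  then show ?case unfolding sm[OF \<open>0 \<le> x\<close>] sm[OF \<open>0 \<le> y\<close>] unfolding den using IH(2) by argo
qed simp

lemma cf_den_distortion:
  assumes "0 \<notin> set w" "0 \<le> x" "x \<le> 1" "0 \<le> y"
  shows "cf_den w x \<le> 2 * cf_den w y"
  using cf_den_distortion_aux[OF assms] by blast

text \<open>Invariant under all branches with digits 1 to b: the right end is the image of the left
  end under the branch of digit 1. Its length below 1 later separates cylinders with different
  digits.\<close>

definition cf_ivl :: "nat \<Rightarrow> real set" where
  "cf_ivl b = {1 / (real b + 1)..(real b + 1) / (real b + 2)}"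

lemma cf_ivlD: "x \<in> cf_ivl b \<Longrightarrow> 0 < x" "x \<in> cf_ivl b \<Longrightarrow> x < 1"
proof -
  assume x: "x \<in> cf_ivl b"
  have "0 < 1 / (real b + 1)" "(real b + 1) / (real b + 2) < 1" by auto
  then show "0 < x" "x < 1" using x unfolding cf_ivl_def atLeastAtMost_iff by linarith+
qed

lemma cf_ivl_branch:
  assumes "1 \<le> a" "a \<le> b" "0 \<le> x" "x \<le> 1"
  shows "1 / (real b + 1) \<le> 1 / (real a + x)"
    and "1 / (real b + 1) \<le> x \<Longrightarrow> 1 / (real a + x) \<le> (real b + 1) / (real b + 2)"
proof -
  show "1 / (real b + 1) \<le> 1 / (real a + x)" using assms by (intro divide_left_mono mult_pos_pos) auto
  assume "1 / (real b + 1) \<le> x"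
  then have "1 / (real a + x) \<le> 1 / (1 + 1 / (real b + 1))"
    using assms by (intro divide_left_mono mult_pos_pos add_mono) (auto simp: add_pos_nonneg)
  also have "1 / (1 + 1 / (real b + 1)) = (real b + 1) / (real b + 2)" by (simp add: divide_simps)
  finally show "1 / (real a + x) \<le> (real b + 1) / (real b + 2)" .
qed

lemma cf_ivl_map:
  assumes "set w \<subseteq> {1..b}" "x \<in> cf_ivl b"
  shows "cf_map w x \<in> cf_ivl b"
  using assms
proof (induction w)
  case (Cons a w)
  then have y: "cf_map w x \<in> cf_ivl b" by auto
  show ?case using Cons cf_ivl_branch[of a b "cf_map w x"] cf_ivlD[OF y] y by (auto simp: cf_ivl_def)
qed simp

lemma small_digits_subset_cf_ivl: "small_digits b \<subseteq> cf_ivl b"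
proof
  fix x assume x: "x \<in> small_digits b"
  have lo: "1 / (real b + 1) \<le> x" if "x \<in> small_digits b" for x
    using gauss_map[OF small_digitsD(1-3)[OF that]] small_digitsD[OF that]
      cf_ivl_branch(1)[of "cf_digit x" b "gauss_map x"] by simp
  note g = gauss_map[OF small_digitsD(1-3)[OF x]]
  have "x \<le> (real b + 1) / (real b + 2)"
    using g cf_ivl_branch(2)[of "cf_digit x" b "gauss_map x"] lo[OF small_digits_gauss[OF x]] small_digitsD[OF x]
    by simp
  then show "x \<in> cf_ivl b" using lo[OF x] by (simp add: cf_ivl_def)
qed

definition cf_words :: "nat \<Rightarrow> nat \<Rightarrow> nat list set" where
  "cf_words b n = {w. set w \<subseteq> {1..b} \<and> length w = n}"

lemma finite_cf_words: "finite (cf_words b n)"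
  unfolding cf_words_def by (rule finite_lists_length_eq) simp

lemma cf_words_0: "cf_words b 0 = {[]}"
  by (auto simp: cf_words_def)

lemma cf_words_not_0: "w \<in> cf_words b n \<Longrightarrow> 0 \<notin> set w"
  by (auto simp: cf_words_def)

lemma sum_cf_words_Suc: "(\<Sum>w\<in>cf_words b (Suc n). f w) = (\<Sum>w\<in>cf_words b n. \<Sum>a=1..b. f (a # w))"
proof -
  have e: "cf_words b (Suc n) = (\<lambda>(w, a). a # w) ` (cf_words b n \<times> {1..b})"
    unfolding cf_words_def by (subst lists_length_Suc_eq) simp
  have "inj_on (\<lambda>(w, a). a # w) (cf_words b n \<times> {1..b})" by (auto simp: inj_on_def)
  then show ?thesis unfolding e by (subst sum.reindex) (auto simp: sum.cartesian_product split_def)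
qed

lemma cf_words_ivl: "w \<in> cf_words b n \<Longrightarrow> x \<in> cf_ivl b \<Longrightarrow> cf_map w x \<in> cf_ivl b"
  using cf_ivl_map by (auto simp: cf_words_def)

lemma small_digits_cf_map:
  assumes "x \<in> small_digits b"
  shows "\<exists>w\<in>cf_words b n. \<exists>y\<in>small_digits b. x = cf_map w y"
  using assms
proof (induction n arbitrary: x)
  case (Suc n)
  note g = gauss_map[OF small_digitsD(1-3)[OF Suc.prems]]
  from Suc.IH[OF small_digits_gauss[OF Suc.prems]] obtain w y
    where w: "w \<in> cf_words b n" "y \<in> small_digits b" "gauss_map x = cf_map w y" by blast
  have "x = cf_map (cf_digit x # w) y" using g(6) w(3) by simp
  moreover have "cf_digit x # w \<in> cf_words b (Suc n)"
    using w g(5) small_digitsD(4)[OF Suc.prems] by (auto simp: cf_words_def)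
  ultimately show ?case using w(2) by blast
qed (auto simp: cf_words_0)

text \<open>A compact set inside \<open>small_digits b\<close>; compactness provides the finite
  subcovers in the lower bound.\<close>

definition cf_limit :: "nat \<Rightarrow> real set" where
  "cf_limit b = (\<Inter>n. \<Union>w\<in>cf_words b n. cf_map w ` cf_ivl b)"

lemma cf_limitE:
  assumes "x \<in> cf_limit b"
  obtains w y where "w \<in> cf_words b n" "y \<in> cf_ivl b" "x = cf_map w y"
  using assms unfolding cf_limit_def by blast

lemma cf_limit_subset_ivl: "cf_limit b \<subseteq> cf_ivl b"
proof
  fix x assume "x \<in> cf_limit b"
  then have "x \<in> (\<Union>w\<in>cf_words b 0. cf_map w ` cf_ivl b)" unfolding cf_limit_def by blast
  then show "x \<in> cf_ivl b" by (simp add: cf_words_0)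
qed

lemma compact_cf_limit: "compact (cf_limit b)"
proof -
  have "continuous_on (cf_ivl b) (cf_map w)" if "0 \<notin> set w" for w
    using that
  proof (induction w)
    case (Cons a w)
    have "real a + cf_map w x \<noteq> 0" if "x \<in> cf_ivl b" for x
      using Cons cf_map_nonneg[of x w] cf_ivlD[OF that] by auto
    then show ?case using Cons by (auto intro!: continuous_intros)
  qed simp
  moreover have "compact (cf_ivl b)" by (simp add: cf_ivl_def)
  ultimately have "compact (\<Union>w\<in>cf_words b n. cf_map w ` cf_ivl b)" for n
    using finite_cf_words cf_words_not_0 by (intro compact_UN compact_continuous_image) auto
  then show ?thesis unfolding cf_limit_def by (intro compact_Inter) auto
qed

lemma cf_limit_branch:
  assumes "x \<in> cf_limit b" "a \<in> {1..b}"
  shows "1 / (real a + x) \<in> cf_limit b"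
  unfolding cf_limit_def
proof
  fix n
  show "1 / (real a + x) \<in> (\<Union>w\<in>cf_words b n. cf_map w ` cf_ivl b)"
  proof (cases n)
    case 0
    then show ?thesis using cf_ivl_map[of "[a]" b x] assms cf_limit_subset_ivl[of b] by (auto simp: cf_words_0)
  next
    case (Suc k)
    obtain w y where w: "w \<in> cf_words b k" "y \<in> cf_ivl b" "x = cf_map w y"
      using cf_limitE[OF assms(1)] by blast
    then have "a # w \<in> cf_words b n" "1 / (real a + x) = cf_map (a # w) y"
      using assms(2) Suc by (auto simp: cf_words_def)
    then show ?thesis using w(2) by blast
  qed
qed

lemma cf_limit_words: "x \<in> cf_limit b \<Longrightarrow> set w \<subseteq> {1..b} \<Longrightarrow> cf_map w x \<in> cf_limit b"
  by (induction w) (auto intro!: cf_limit_branch)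

text \<open>The fixed point of the branch of digit 1 lies in every level. It serves as the base
  point of the mass distribution.\<close>

lemma golden_mean_in_cf_limit:
  assumes "b \<ge> 1"
  shows "(sqrt 5 - 1) / 2 \<in> cf_limit b"
proof -
  define g :: real where "g = (sqrt 5 - 1) / 2"
  have s5: "2 \<le> sqrt 5" by (rule real_le_rsqrt) simp
  have s5': "sqrt 5 \<le> 7/3" by (rule real_le_lsqrt) (simp_all add: power2_eq_square)
  have "g * (1 + g) = 1" unfolding g_def by (simp add: field_simps)
  moreover have g0: "1/2 \<le> g" "g \<le> 2/3" using s5 s5' by (auto simp: g_def)
  ultimately have fp: "1 / (1 + g) = g" by (simp add: field_simps)
  have w: "cf_map (replicate n 1) g = g" for n by (induction n) (auto simp: fp)
  have "1 / (real b + 1) \<le> 1/2" "2/3 \<le> (real b + 1) / (real b + 2)" using assms by (auto simp: divide_simps)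
  then have "g \<in> cf_ivl b" using g0 unfolding cf_ivl_def atLeastAtMost_iff by linarith
  moreover have "replicate n 1 \<in> cf_words b n" for n using assms by (auto simp: cf_words_def)
  ultimately have "g \<in> (\<Union>w\<in>cf_words b n. cf_map w ` cf_ivl b)" for n using w[of n] by (metis UN_I imageI)
  then show ?thesis unfolding cf_limit_def g_def by blast
qed

lemma cf_limit_gauss:
  assumes "x \<in> cf_limit b"
  shows "cf_digit x \<le> b" "gauss_map x \<in> cf_limit b"
proof -
  have E: "cf_digit x \<le> b \<and> gauss_map x \<in> (\<Union>w\<in>cf_words b n. cf_map w ` cf_ivl b)" for n
  proof -
    obtain w y where w: "w \<in> cf_words b (Suc n)" "y \<in> cf_ivl b" "x = cf_map w y"
      using cf_limitE[OF assms(1)] by blast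
    then obtain a v where v: "w = a # v" "v \<in> cf_words b n" "a \<le> b" by (cases w) (auto simp: cf_words_def)
    have t: "0 < cf_map v y" "cf_map v y < 1" using cf_ivlD[OF cf_words_ivl[OF v(2) w(2)]] .
    have e: "1 / x = real a + cf_map v y" using w v by simp
    have fl: "\<lfloor>1 / x\<rfloor> = int a" unfolding e using t by (intro floor_unique) auto
    have "cf_digit x = a" "gauss_map x = cf_map v y"
      unfolding cf_digit_def gauss_map_def frac_def fl using e by auto
    then show ?thesis using v w(2) by blast
  qed
  show "cf_digit x \<le> b" "gauss_map x \<in> cf_limit b" using E unfolding cf_limit_def by blast+
qed

text \<open>Euclid's algorithm as a descent: the Gauss map sends p/q to a fraction with denominator
  p < q and preserves the limit set.\<close>

lemma cf_limit_irrational: "real q * x = real p \<Longrightarrow> 0 < q \<Longrightarrow> x \<notin> cf_limit b"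
proof (induction q arbitrary: x p rule: less_induct)
  case (less q)
  show ?case
  proof
    assume x: "x \<in> cf_limit b"
    then have x01: "0 < x" "x < 1" using cf_ivlD cf_limit_subset_ivl by blast+
    have "real q * x < real q * 1" "0 < real q * x" using x01 less.prems(2) by (auto intro: mult_strict_left_mono)
    then have p: "p < q" "0 < p" unfolding less.prems(1) by auto
    have e: "1 / x = real q / real p" using less.prems p x01 by (simp add: field_simps)
    have "\<lfloor>1 / x\<rfloor> \<ge> 0" using x01 by simp
    then have "real p * gauss_map x = real_of_int (int q - int p * \<lfloor>1 / x\<rfloor>)"
      using p unfolding gauss_map_def frac_def by (simp add: e right_diff_distrib)
    moreover have "real p * gauss_map x \<ge> 0" by (simp add: gauss_map_def)
    ultimately have "real p * gauss_map x = real (nat (int q - int p * \<lfloor>1 / x\<rfloor>))"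
      by (metis of_int_0_le_iff of_nat_nat of_int_of_nat_eq)
    from less.IH[OF p(1) this p(2)] show False using cf_limit_gauss(2)[OF x] by blast
  qed
qed

lemma cf_limit_subset_small_digits: "cf_limit b \<subseteq> small_digits b"
proof
  fix x assume x: "x \<in> cf_limit b"
  then have x01: "0 < x" "x < 1" using cf_ivlD cf_limit_subset_ivl by blast+
  have "(gauss_map ^^ k) x \<in> cf_limit b" for k by (induction k) (auto simp: x cf_limit_gauss(2))
  then have "cf_digit ((gauss_map ^^ k) x) \<le> b" for k using cf_limit_gauss by blast
  moreover have "x \<notin> \<rat>"
  proof
    assume "x \<in> \<rat>"
    then obtain p q :: nat where "q \<noteq> 0" "\<bar>x\<bar> = real p / real q" using Rats_abs_nat_div_natE by metis
    then have "real q * x = real p" "0 < q" using x01 by (auto simp: field_simps)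
    then show False using cf_limit_irrational x by blast
  qed
  ultimately show "x \<in> small_digits b" using x01 by (auto simp: small_digits_def)
qed

section \<open>The transfer operator and Hausdorff dimension\<close>

locale cf_transfer =
  fixes b :: nat and s :: real and h :: "real \<Rightarrow> real" and m M :: real
  assumes s: "s > 0" and b: "b \<ge> 1" and m: "m > 0"
    and h: "\<And>x. x \<in> cf_ivl b \<Longrightarrow> m \<le> h x \<and> h x \<le> M"
begin

text \<open>The branch of digit a has derivative of modulus (a + x)^(-2); its s-th power is the
  weight.\<close>

definition transfer :: "real \<Rightarrow> real" where
  "transfer x = (\<Sum>a=1..b. (real a + x) powr (- 2 * s) * h (1 / (real a + x)))"

lemma cf_den_Cons_powr:
  assumes "x \<in> cf_ivl b" "w \<in> cf_words b n" "a \<in> {1..b}"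
  shows "cf_den (a # w) x powr (- 2 * s) = (real a + cf_map w x) powr (- 2 * s) * cf_den w x powr (- 2 * s)"
proof -
  have "cf_map w x > 0" "cf_den w x \<ge> 1"
    using cf_ivlD[OF cf_words_ivl[OF assms(2,1)]] cf_den_ge_1[OF cf_words_not_0[OF assms(2)]] cf_ivlD[OF assms(1)] by auto
  then show ?thesis by (simp add: powr_mult)
qed

text \<open>Words grow at the front, so summing over the new digit applies the operator at
  \<open>cf_map w x\<close>, which gives one factor l per digit.\<close>

lemma transfer_iterate_le:
  assumes tr: "\<And>x. x \<in> cf_ivl b \<Longrightarrow> transfer x \<le> l * h x" and l: "l \<ge> 0" and x: "x \<in> cf_ivl b"
  shows "(\<Sum>w\<in>cf_words b n. cf_den w x powr (- 2 * s) * h (cf_map w x)) \<le> l ^ n * h x"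
proof (induction n)
  case (Suc n)
  have "(\<Sum>w\<in>cf_words b (Suc n). cf_den w x powr (- 2 * s) * h (cf_map w x))
      = (\<Sum>w\<in>cf_words b n. \<Sum>a=1..b. cf_den (a # w) x powr (- 2 * s) * h (cf_map (a # w) x))"
    by (rule sum_cf_words_Suc)
  also have "\<dots> = (\<Sum>w\<in>cf_words b n. cf_den w x powr (- 2 * s) * transfer (cf_map w x))"
    unfolding transfer_def sum_distrib_left
    by (intro sum.cong refl, subst cf_den_Cons_powr[OF x]) auto
  also have "\<dots> \<le> (\<Sum>w\<in>cf_words b n. cf_den w x powr (- 2 * s) * (l * h (cf_map w x)))"
    using tr[OF cf_words_ivl[OF _ x]] by (intro sum_mono mult_left_mono) auto
  also have "\<dots> = l * (\<Sum>w\<in>cf_words b n. cf_den w x powr (- 2 * s) * h (cf_map w x))"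
    by (simp add: sum_distrib_left mult_ac)
  also have "\<dots> \<le> l * (l ^ n * h x)" using Suc l by (intro mult_left_mono) auto
  finally show ?case by (simp add: mult_ac)
qed (simp add: cf_words_0)

text \<open>The prefix branch \<open>cf_map w0\<close> does not expand, as its denominators are at
  least 1. Cylinders of level n have diameter at most 4 / \<open>cf_den v x0\<close>^2, so their
  s-th powers are bounded by the n-th iterate, which decays like l^n.\<close>

lemma image_small_digits_null:
  assumes tr: "\<And>x. x \<in> cf_ivl b \<Longrightarrow> transfer x \<le> l * h x" and l: "0 \<le> l" "l < 1" and w0: "0 \<notin> set w0"
  shows "hausdorff_measure s (cf_map w0 ` small_digits b) = 0"
proof (rule hausdorff_measure_zero_finite_covers[OF s, where U = "\<lambda>v. cf_map (w0 @ v) ` small_digits b"])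
  fix \<epsilon> :: real
  assume \<epsilon>: "\<epsilon> > 0"
  define x0 where "x0 = 1 / (real b + 1)"
  have x0: "x0 \<in> cf_ivl b"
  proof -
    have "1 * 1 \<le> (real b + 1) * (real b + 1) - (real b + 1)" using b mult_mono[of 1 "real b" 1 "real b"] by (simp add: algebra_simps)
    then show ?thesis unfolding cf_ivl_def x0_def by (simp add: divide_simps)
  qed
  note x0' = cf_ivlD[OF x0]
  have "(\<lambda>n. 4 powr s / m * (l ^ n * h x0)) \<longlonglongrightarrow> 4 powr s / m * (0 * h x0)"
    using l by (intro tendsto_intros LIMSEQ_power_zero) auto
  then have "eventually (\<lambda>n. 4 powr s / m * (l ^ n * h x0) < \<epsilon>) sequentially" using \<epsilon> by (intro order_tendstoD) auto
  then obtain n where n: "4 powr s / m * (l ^ n * h x0) < \<epsilon>" by (auto simp: eventually_sequentially)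
  have dist: "\<bar>x - y\<bar> \<le> 4 * cf_den v x0 powr (- 2)"
    if v: "v \<in> cf_words b n" and xin: "x \<in> cf_map (w0 @ v) ` small_digits b"
      and yin: "y \<in> cf_map (w0 @ v) ` small_digits b" for v x y
  proof -
    obtain x' y' where xy': "x = cf_map (w0 @ v) x'" "y = cf_map (w0 @ v) y'"
      "x' \<in> small_digits b" "y' \<in> small_digits b" using xin yin by blast
    then have xy: "x = cf_map w0 (cf_map v x')" "y = cf_map w0 (cf_map v y')" "x' \<in> cf_ivl b" "y' \<in> cf_ivl b"
      using small_digits_subset_cf_ivl[of b] by (auto simp: cf_map_append)
    note D = cf_ivlD[OF xy(3)] cf_ivlD[OF xy(4)]
    note v0 = cf_words_not_0[OF v]
    have N: "0 \<le> cf_map v x'" "0 \<le> cf_map v y'" using D by (auto intro: cf_map_nonneg)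
    have "\<bar>x - y\<bar> = \<bar>cf_map v x' - cf_map v y'\<bar> / (cf_den w0 (cf_map v x') * cf_den w0 (cf_map v y'))"
      unfolding xy using N by (intro cf_map_diff[OF w0])
    also have "\<dots> \<le> \<bar>cf_map v x' - cf_map v y'\<bar> / (1 * 1)"
      using cf_den_ge_1[OF w0 N(1)] cf_den_ge_1[OF w0 N(2)] by (intro divide_left_mono mult_mono) auto
    also have "\<dots> = \<bar>x' - y'\<bar> / (cf_den v x' * cf_den v y')" using D by (simp add: cf_map_diff[OF v0])
    \<comment> \<open>Bounded distortion moves both denominators to x0 at the cost of a factor 2
      each.\<close>
    also have "\<dots> \<le> 1 / ((cf_den v x0 / 2) * (cf_den v x0 / 2))"
    proof (intro frac_le mult_mono)
      show "\<bar>x' - y'\<bar> \<le> 1" using D by linarith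
      show "cf_den v x0 / 2 \<le> cf_den v x'" "cf_den v x0 / 2 \<le> cf_den v y'"
        using cf_den_distortion[OF v0, of x0 x'] cf_den_distortion[OF v0, of x0 y'] D x0' by auto
      show "0 < cf_den v x0 / 2 * (cf_den v x0 / 2)" "0 \<le> cf_den v x0 / 2" "0 \<le> cf_den v x'"
        using cf_den_ge_1[OF v0, of x0] cf_den_ge_1[OF v0, of x'] D x0' by auto
    qed simp
    also have "\<dots> = 4 * cf_den v x0 powr (- 2)" using cf_den_ge_1[OF v0, of x0] x0'
      by (simp add: powr_minus powr_numeral power2_eq_square divide_simps)
    finally show ?thesis .
  qed
  have "cf_map w0 ` small_digits b \<subseteq> (\<Union>v\<in>cf_words b n. cf_map (w0 @ v) ` small_digits b)"
  proof
    fix x assume "x \<in> cf_map w0 ` small_digits b"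
    then obtain y where y: "y \<in> small_digits b" "x = cf_map w0 y" by blast
    then obtain v y' where "v \<in> cf_words b n" "y' \<in> small_digits b" "y = cf_map v y'"
      using small_digits_cf_map by blast
    then show "x \<in> (\<Union>v\<in>cf_words b n. cf_map (w0 @ v) ` small_digits b)"
      using y(2) by (intro UN_I[of v] image_eqI[of _ _ y']) (auto simp: cf_map_append)
  qed
  moreover have bd: "bounded (cf_map (w0 @ v) ` small_digits b)" if v: "v \<in> cf_words b n" for v
    unfolding bounded_two_points dist_real_def by (intro exI ballI) (rule dist[OF v])
  moreover have "(\<Sum>v\<in>cf_words b n. diameter (cf_map (w0 @ v) ` small_digits b) powr s) \<le> \<epsilon>"
  proof -
    have "diameter (cf_map (w0 @ v) ` small_digits b) powr s
        \<le> 4 powr s / m * (cf_den v x0 powr (- 2 * s) * h (cf_map v x0))" if v: "v \<in> cf_words b n" for v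
    proof -
      have "diameter (cf_map (w0 @ v) ` small_digits b) \<le> 4 * cf_den v x0 powr (- 2)"
        by (rule diameter_le) (auto intro: dist[OF v])
      then have "diameter (cf_map (w0 @ v) ` small_digits b) powr s \<le> (4 * cf_den v x0 powr (- 2)) powr s"
        using s diameter_ge_0[OF bd[OF v]] by (intro powr_mono2) auto
      also have "\<dots> = 4 powr s / m * (cf_den v x0 powr (- 2 * s) * m)" using m by (simp add: powr_mult powr_powr)
      also have "\<dots> \<le> 4 powr s / m * (cf_den v x0 powr (- 2 * s) * h (cf_map v x0))"
        using h[OF cf_words_ivl[OF v x0]] m by (intro mult_left_mono) auto
      finally show ?thesis .
    qed
    then have "(\<Sum>v\<in>cf_words b n. diameter (cf_map (w0 @ v) ` small_digits b) powr s)
        \<le> 4 powr s / m * (\<Sum>v\<in>cf_words b n. cf_den v x0 powr (- 2 * s) * h (cf_map v x0))"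
      unfolding sum_distrib_left by (intro sum_mono) auto
    also have "\<dots> \<le> 4 powr s / m * (l ^ n * h x0)"
      using transfer_iterate_le[OF tr l(1) x0] m by (intro mult_left_mono) auto
    finally show ?thesis using n by simp
  qed
  ultimately show "\<exists>V. finite V \<and> cf_map w0 ` small_digits b \<subseteq> (\<Union>v\<in>V. cf_map (w0 @ v) ` small_digits b) \<and>
      (\<forall>v\<in>V. bounded (cf_map (w0 @ v) ` small_digits b)) \<and>
      (\<Sum>v\<in>V. diameter (cf_map (w0 @ v) ` small_digits b) powr s) \<le> \<epsilon>"
    using finite_cf_words by (intro exI[of _ "cf_words b n"] conjI ballI)
qed


text \<open>Dividing by \<open>transfer z\<close> makes the choice of the digit in front of the tail \<open>z\<close> a probability
  distribution; iterating it gives the mass distribution for the lower bound.\<close>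

definition branch_prob :: "nat \<Rightarrow> real \<Rightarrow> real" where
  "branch_prob a z = (real a + z) powr (- 2 * s) * h (1 / (real a + z)) / transfer z"

fun word_mass :: "nat list \<Rightarrow> real \<Rightarrow> real" where
  "word_mass [] z = 1"
| "word_mass (a # w) z = branch_prob a (cf_map w z) * word_mass w z"

lemma word_mass_append: "word_mass (v @ w) z = word_mass v (cf_map w z) * word_mass w z"
  by (induction v) (auto simp: cf_map_append)

lemma h_branch_pos:
  assumes "z \<in> cf_ivl b" "a \<in> {1..b}"
  shows "0 < (real a + z) powr (- 2 * s) * h (1 / (real a + z))"
  using cf_ivl_map[of "[a]" b z] assms cf_ivlD[OF assms(1)] h[of "1 / (real a + z)"] m
  by (intro mult_pos_pos) (auto intro: add_nonneg_pos less_le_trans)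

lemma branch_prob_nonneg: "z \<in> cf_ivl b \<Longrightarrow> a \<in> {1..b} \<Longrightarrow> 0 \<le> branch_prob a z"
  unfolding branch_prob_def transfer_def
  using h_branch_pos by (intro divide_nonneg_nonneg sum_nonneg) (auto simp: less_imp_le)

lemma sum_branch_prob:
  assumes "z \<in> cf_ivl b"
  shows "(\<Sum>a=1..b. branch_prob a z) = 1"
proof -
  have "transfer z > 0" unfolding transfer_def using b h_branch_pos[OF assms] by (intro sum_pos) auto
  then show ?thesis unfolding branch_prob_def sum_divide_distrib[symmetric] by (simp add: transfer_def)
qed

lemma word_mass_nonneg: "z \<in> cf_ivl b \<Longrightarrow> set w \<subseteq> {1..b} \<Longrightarrow> 0 \<le> word_mass w z"
  by (induction w) (auto intro!: mult_nonneg_nonneg branch_prob_nonneg cf_ivl_map)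

lemma sum_word_mass:
  assumes "z \<in> cf_ivl b"
  shows "(\<Sum>w\<in>cf_words b n. word_mass w z) = 1"
proof (induction n)
  case (Suc n)
  have "(\<Sum>w\<in>cf_words b (Suc n). word_mass w z)
      = (\<Sum>w\<in>cf_words b n. (\<Sum>a=1..b. branch_prob a (cf_map w z)) * word_mass w z)"
    unfolding sum_cf_words_Suc sum_distrib_right by simp
  also have "\<dots> = (\<Sum>w\<in>cf_words b n. word_mass w z)"
    by (intro sum.cong refl, subst sum_branch_prob[OF cf_words_ivl[OF _ assms]]) auto
  finally show ?case using Suc by simp
qed (simp add: cf_words_0)

section \<open>Mass distribution and the lower bound for the dimension\<close>

context
  assumes tr: "\<And>x. x \<in> cf_ivl b \<Longrightarrow> h x \<le> transfer x"
begin

text \<open>As \<open>transfer\<close> is at least h, replacing each denominator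
  \<open>transfer y\<close> by h y only enlarges the product, and then the values of h telescope
  along the word.\<close>

lemma word_mass_le:
  assumes z: "z \<in> cf_ivl b" and "set w \<subseteq> {1..b}"
  shows "word_mass w z \<le> cf_den w z powr (- 2 * s) * h (cf_map w z) / h z"
  using assms(2)
proof (induction w)
  case Nil
  then show ?case using h[OF z] m by simp
next
  case (Cons a w)
  define y where "y = cf_map w z"
  have a: "a \<in> {1..b}" and w: "w \<in> cf_words b (length w)" using Cons by (auto simp: cf_words_def)
  have y: "y \<in> cf_ivl b" using cf_words_ivl[OF w z] by (simp add: y_def)
  have hy: "0 < h y" "h y \<le> transfer y" using h[OF y] m tr[OF y] by auto
  have "branch_prob a y \<le> (real a + y) powr (- 2 * s) * h (1 / (real a + y)) / h y"
    unfolding branch_prob_def using hy h_branch_pos[OF y a] by (intro divide_left_mono) auto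
  moreover have "word_mass w z \<le> cf_den w z powr (- 2 * s) * h y / h z" using Cons by (simp add: y_def)
  ultimately have "word_mass (a # w) z \<le> (real a + y) powr (- 2 * s) * h (1 / (real a + y)) / h y
      * (cf_den w z powr (- 2 * s) * h y / h z)"
    unfolding word_mass.simps y_def[symmetric]
    using hy h_branch_pos[OF y a] word_mass_nonneg[OF z, of w] Cons by (intro mult_mono) auto
  also have "\<dots> = cf_den (a # w) z powr (- 2 * s) * h (cf_map (a # w) z) / h z"
    unfolding cf_den_Cons_powr[OF z w a] using hy(1) by (simp add: y_def)
  finally show ?case .
qed

text \<open>The mass of a cylinder is at most a constant times the s-th power of its size, for every
  length n of the rest: distortion replaces the varying tail by z, and the masses of the rest sum to
  1.\<close>

lemma prefix_mass_le:
  assumes z: "z \<in> cf_ivl b" and v: "set v \<subseteq> {1..b}"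
  shows "(\<Sum>w\<in>cf_words b n. word_mass (v @ w) z) \<le> M / m * 4 powr s * cf_den v z powr (- 2 * s)"
proof -
  define C where "C = M / m * 4 powr s * cf_den v z powr (- 2 * s)"
  have v0: "0 \<notin> set v" using v by auto
  have "word_mass (v @ w) z \<le> C * word_mass w z" if w: "w \<in> cf_words b n" for w
  proof -
    define y where "y = cf_map w z"
    have y: "y \<in> cf_ivl b" using cf_words_ivl[OF w z] by (simp add: y_def)
    have d: "cf_den v z / 2 \<le> cf_den v y" "cf_den v z \<ge> 1"
      using cf_den_distortion[OF v0, of z y] cf_den_ge_1[OF v0, of z] cf_ivlD[OF z] cf_ivlD[OF y] by auto
    have hm: "m \<le> h y" "h (cf_map v y) \<le> M" "m \<le> h (cf_map v y)" using h[OF y] h[OF cf_ivl_map[OF v y]] by auto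
    have "cf_den v y powr (- 2 * s) \<le> (cf_den v z / 2) powr (- 2 * s)" using d s by (intro powr_mono2') auto
    also have "\<dots> = 4 powr s * cf_den v z powr (- 2 * s)"
      using d powr_powr[of "2::real" 2 s] by (simp add: powr_divide powr_minus divide_simps)
    finally have "cf_den v y powr (- 2 * s) * h (cf_map v y) / h y \<le> 4 powr s * cf_den v z powr (- 2 * s) * M / m"
      using hm m by (intro frac_le mult_mono) auto
    then have "word_mass v y \<le> C" using word_mass_le[OF y v] by (simp add: C_def mult_ac)
    then show ?thesis unfolding word_mass_append y_def[symmetric]
      using word_mass_nonneg[OF z, of w] w by (intro mult_right_mono) (auto simp: cf_words_def)
  qed
  then have "(\<Sum>w\<in>cf_words b n. word_mass (v @ w) z) \<le> (\<Sum>w\<in>cf_words b n. C * word_mass w z)" by (intro sum_mono)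
  also have "\<dots> = C" by (simp add: sum_distrib_left[symmetric] sum_word_mass[OF z])
  finally show ?thesis by (simp add: C_def)
qed

text \<open>Tails differ by at most (b + 1)/(b + 2), so distinct digits leave a gap 1/(b + 2)
  between a + y and a' + y'. Inversion costs at most (b + 2)^2, and distortion of the branch of v a
  factor 4.\<close>

lemma cf_map_separated:
  assumes "set v \<subseteq> {1..b}" "a \<in> {1..b}" "a' \<in> {1..b}" "a \<noteq> a'" "y \<in> cf_ivl b" "y' \<in> cf_ivl b" "z \<in> cf_ivl b"
  shows "cf_den v z powr (- 2) \<le> 4 * (real b + 2) ^ 3 * \<bar>cf_map v (1 / (real a + y)) - cf_map v (1 / (real a' + y'))\<bar>"
proof -
  have v0: "0 \<notin> set v" using assms by auto
  define p q where "p = real a + y" and "q = real a' + y'"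
  note D = cf_ivlD[OF assms(5)] cf_ivlD[OF assms(6)] cf_ivlD[OF assms(7)]
  have pq: "0 < p" "p \<le> real b + 2" "0 < q" "q \<le> real b + 2" "1 \<le> p" "1 \<le> q" using assms(2,3) D by (auto simp: p_def q_def)
  have "\<bar>y - y'\<bar> \<le> (real b + 1) / (real b + 2)"
    using assms(5,6) D unfolding cf_ivl_def atLeastAtMost_iff abs_le_iff by (intro conjI) linarith+
  moreover have "\<bar>real a - real a'\<bar> \<ge> 1" using assms(4) by linarith
  ultimately have "\<bar>p - q\<bar> \<ge> 1 - (real b + 1) / (real b + 2)" unfolding p_def q_def by linarith
  also have "1 - (real b + 1) / (real b + 2) = 1 / (real b + 2)" by (simp add: field_simps)
  finally have gap: "1 / (real b + 2) \<le> \<bar>p - q\<bar>" .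
  have "1 / (real b + 2) ^ 3 = 1 / (real b + 2) / ((real b + 2) * (real b + 2))" by (simp add: power3_eq_cube)
  also have "\<dots> \<le> \<bar>p - q\<bar> / (p * q)" using gap pq by (intro frac_le mult_mono) auto
  also have "\<dots> = \<bar>1 / p - 1 / q\<bar>"
  proof -
    have "1 / p - 1 / q = (q - p) / (p * q)" using pq by (simp add: field_simps)
    then show ?thesis using pq by (simp add: abs_mult abs_minus_commute)
  qed
  finally have g: "1 / (real b + 2) ^ 3 \<le> \<bar>1 / p - 1 / q\<bar>" .
  have d: "cf_den v (1 / p) \<le> 2 * cf_den v z" "cf_den v (1 / q) \<le> 2 * cf_den v z"
    "cf_den v (1 / p) \<ge> 1" "cf_den v (1 / q) \<ge> 1" "cf_den v z \<ge> 1"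
    using pq D by (auto intro!: cf_den_distortion[OF v0] cf_den_ge_1[OF v0])
  have "1 / (real b + 2) ^ 3 / ((2 * cf_den v z) * (2 * cf_den v z)) \<le> \<bar>1 / p - 1 / q\<bar> / (cf_den v (1 / p) * cf_den v (1 / q))"
    using g d by (intro frac_le mult_mono) auto
  also have "\<dots> = \<bar>cf_map v (1 / p) - cf_map v (1 / q)\<bar>" using pq by (intro cf_map_diff[symmetric] v0) auto
  finally have "1 / (4 * (real b + 2) ^ 3) * cf_den v z powr (- 2) \<le> \<bar>cf_map v (1 / p) - cf_map v (1 / q)\<bar>"
    using d by (simp add: powr_minus powr_numeral power2_eq_square divide_simps mult_ac)
  then show ?thesis by (simp add: p_def q_def pos_divide_le_eq mult_ac)
qed

lemma cf_den_growth:
  assumes "z \<in> cf_ivl b" "set w \<subseteq> {1..b}"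
  shows "(1 + 1 / (real b + 1)) ^ length w \<le> cf_den w z"
  using assms(2)
proof (induction w)
  case (Cons a w)
  have "1 / (real b + 1) \<le> cf_map w z" using cf_ivl_map[OF _ assms(1), of w] Cons by (auto simp: cf_ivl_def)
  then have "(1 + 1 / (real b + 1)) * (1 + 1 / (real b + 1)) ^ length w \<le> (real a + cf_map w z) * cf_den w z"
    using Cons cf_map_nonneg[of z w] cf_ivlD[OF assms(1)] by (intro mult_mono add_mono) auto
  then show ?case by simp
qed simp

text \<open>Descent along v: if all words landing in the interval share the next digit, append it to
  v. Otherwise two points with different next digits are within 2 r, so separation makes the size of
  the cylinder of v at most 8 (b + 2)^3 r and its whole mass is small. At full length, hypothesis N
  takes over.\<close>

lemma ball_mass_le_aux:
  assumes z: "z \<in> cf_ivl b" and r: "r > 0"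
    and N: "\<And>v. set v \<subseteq> {1..b} \<Longrightarrow> length v = N \<Longrightarrow> cf_den v z powr (- 2) \<le> r"
    and v: "set v \<subseteq> {1..b}" "length v + n = N"
  shows "(\<Sum>w | w \<in> cf_words b n \<and> \<bar>cf_map (v @ w) z - u\<bar> < r. word_mass (v @ w) z)
    \<le> M / m * 4 powr s * (8 * (real b + 2) ^ 3 * r) powr s"
  using v
proof (induction n arbitrary: v)
  case 0
  define R where "R = 8 * (real b + 2) ^ 3 * r"
  define G where "G = {w \<in> cf_words b 0. \<bar>cf_map (v @ w) z - u\<bar> < r}"
  have Mm: "0 \<le> M / m * 4 powr s" using h[OF z] m by (intro mult_nonneg_nonneg divide_nonneg_pos) auto
  have "1 \<le> 8 * (real b + 2) ^ 3" using one_le_power[of "real b + 2" 3] by linarith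
  then have "1 * r \<le> 8 * (real b + 2) ^ 3 * r" using r by (intro mult_right_mono) auto
  then have "cf_den v z powr (- 2) \<le> R" using N[OF 0(1)] 0(2) by (simp add: R_def)
  then have "(cf_den v z powr (- 2)) powr s \<le> R powr s" using s by (intro powr_mono2) auto
  then have le: "cf_den v z powr (- 2 * s) \<le> R powr s" by (simp add: powr_powr)
  have "(\<Sum>w\<in>G. word_mass (v @ w) z) \<le> (\<Sum>w\<in>cf_words b 0. word_mass (v @ w) z)"
    using word_mass_nonneg[OF z 0(1)] by (intro sum_mono2) (auto simp: G_def cf_words_0)
  also have "\<dots> \<le> M / m * 4 powr s * cf_den v z powr (- 2 * s)" by (rule prefix_mass_le[OF z 0(1)])
  also have "\<dots> \<le> M / m * 4 powr s * R powr s" by (rule mult_left_mono[OF le Mm])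
  finally show ?case by (simp add: G_def R_def)
next
  case (Suc n)
  define R where "R = 8 * (real b + 2) ^ 3 * r"
  define G where "G = {w \<in> cf_words b (Suc n). \<bar>cf_map (v @ w) z - u\<bar> < r}"
  have Mm: "0 \<le> M / m * 4 powr s" using h[OF z] m by (intro mult_nonneg_nonneg divide_nonneg_pos) auto
  have Gc: "\<exists>a w'. w = a # w' \<and> a \<in> {1..b} \<and> w' \<in> cf_words b n" if "w \<in> G" for w
    using that by (cases w) (auto simp: G_def cf_words_def)
  have "(\<Sum>w\<in>G. word_mass (v @ w) z) \<le> M / m * 4 powr s * R powr s"
  proof (cases "\<exists>w\<in>G. \<exists>w'\<in>G. hd w \<noteq> hd w'")
    case True
    then obtain w w' where ww: "w \<in> G" "w' \<in> G" "hd w \<noteq> hd w'" by blast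
    obtain a x where w: "w = a # x" "a \<in> {1..b}" "x \<in> cf_words b n" using Gc[OF ww(1)] by blast
    obtain a' x' where w': "w' = a' # x'" "a' \<in> {1..b}" "x' \<in> cf_words b n" using Gc[OF ww(2)] by blast
    define P where "P = cf_map v (1 / (real a + cf_map x z))"
    define Q where "Q = cf_map v (1 / (real a' + cf_map x' z))"
    have "a \<noteq> a'" using ww(3) w w' by simp
    then have "cf_den v z powr (- 2) \<le> 4 * (real b + 2) ^ 3 * \<bar>P - Q\<bar>"
      unfolding P_def Q_def using Suc.prems w w' z by (intro cf_map_separated cf_words_ivl) auto
    also have "\<bar>P - Q\<bar> \<le> 2 * r"
    proof -
      have "\<bar>P - u\<bar> < r" "\<bar>Q - u\<bar> < r" using ww w w' by (auto simp: G_def P_def Q_def cf_map_append)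
      then show ?thesis by linarith
    qed
    finally have "cf_den v z powr (- 2) \<le> R" by (simp add: R_def)
    then have "(cf_den v z powr (- 2)) powr s \<le> R powr s" using s by (intro powr_mono2) auto
    then have le: "cf_den v z powr (- 2 * s) \<le> R powr s" by (simp add: powr_powr)
    have "(\<Sum>w\<in>G. word_mass (v @ w) z) \<le> (\<Sum>w\<in>cf_words b (Suc n). word_mass (v @ w) z)"
    proof (rule sum_mono2[OF finite_cf_words])
      fix w assume "w \<in> cf_words b (Suc n) - G"
      then have "set (v @ w) \<subseteq> {1..b}" using Suc.prems(1) by (simp add: cf_words_def)
      then show "0 \<le> word_mass (v @ w) z" by (rule word_mass_nonneg[OF z])
    qed (auto simp: G_def)
    also have "\<dots> \<le> M / m * 4 powr s * cf_den v z powr (- 2 * s)" by (rule prefix_mass_le[OF z Suc.prems(1)])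
    also have "\<dots> \<le> M / m * 4 powr s * R powr s" by (rule mult_left_mono[OF le Mm])
    finally show ?thesis .
  next
    case False
    show ?thesis
    proof (cases "G = {}")
      case True
      then show ?thesis using mult_nonneg_nonneg[OF Mm, of "R powr s"] by simp
    next
      case nonempty: False
      then obtain a where a: "a \<in> {1..b}" "\<And>w. w \<in> G \<Longrightarrow> hd w = a" using False Gc by (metis all_not_in_conv list.sel(1))
      define G' where "G' = {w \<in> cf_words b n. \<bar>cf_map ((v @ [a]) @ w) z - u\<bar> < r}"
      have "G = (#) a ` G'"
      proof (intro equalityI subsetI)
        fix w assume "w \<in> G"
        moreover obtain a' w' where "w = a' # w'" "w' \<in> cf_words b n" using Gc[OF \<open>w \<in> G\<close>] by blast
        ultimately show "w \<in> (#) a ` G'" using a(2)[OF \<open>w \<in> G\<close>] by (auto simp: G_def G'_def)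
      qed (use a in \<open>auto simp: G_def G'_def cf_words_def\<close>)
      then have "(\<Sum>w\<in>G. word_mass (v @ w) z) = (\<Sum>w\<in>G'. word_mass ((v @ [a]) @ w) z)" by (simp add: sum.reindex)
      also have "\<dots> \<le> M / m * 4 powr s * R powr s"
        using Suc.IH[of "v @ [a]"] Suc.prems a by (simp add: G'_def R_def)
      finally show ?thesis .
    qed
  qed
  then show ?case by (simp add: G_def R_def)
qed

text \<open>A Frostman bound for the discrete masses \<open>word_mass w z\<close> at the points
  \<open>cf_map w z\<close>. No limit measure is formed: a finite cover has finitely many balls, so
  one large level n serves them all.\<close>

lemma ball_mass_le:
  assumes z: "z \<in> cf_ivl b" and r: "r > 0"
  shows "\<forall>\<^sub>F n in sequentially. (\<Sum>w | w \<in> cf_words b n \<and> \<bar>cf_map w z - u\<bar> < r. word_mass w z)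
    \<le> M / m * 4 powr s * (8 * (real b + 2) ^ 3 * r) powr s"
proof -
  define q where "q = 1 + 1 / (real b + 1)"
  have q: "q > 1" by (simp add: q_def)
  have "(\<lambda>n. inverse (q ^ n)) \<longlonglongrightarrow> 0" by (rule LIMSEQ_inverse_realpow_zero[OF q])
  then have "\<forall>\<^sub>F n in sequentially. inverse (q ^ n) < r" using r by (rule order_tendstoD)
  then show ?thesis
  proof eventually_elim
    case (elim n)
    have "cf_den v z powr (- 2) \<le> r" if v: "set v \<subseteq> {1..b}" "length v = n" for v
    proof -
      have g: "q ^ n \<le> cf_den v z" "1 \<le> q ^ n" using cf_den_growth[OF z v(1)] v(2) q by (auto simp: q_def)
      have "cf_den v z powr (- 2) \<le> cf_den v z powr (- 1)" using g by (intro powr_mono) auto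
      also have "\<dots> = inverse (cf_den v z)" using g by (simp add: powr_minus)
      also have "\<dots> \<le> inverse (q ^ n)" using g by (intro le_imp_inverse_le) auto
      finally show ?thesis using elim by simp
    qed
    from ball_mass_le_aux[OF z r this, where v = "[]" and n = n and u = u] show ?case by simp
  qed
qed

text \<open>Mass distribution principle by contradiction: for s' < s, a cover of small s'-weight
  leads to finitely many balls that catch all words of some level but carry mass at most
  1/2.\<close>

lemma hausdorff_dim_ge:
  assumes A: "small_digits b \<subseteq> A"
  shows "ereal s \<le> hausdorff_dim A"
  unfolding hausdorff_dim_def
proof (rule INF_greatest)
  fix s' assume s': "s' \<in> {s. 0 \<le> s \<and> hausdorff_measure s A = 0}"
  show "ereal s \<le> ereal s'"
  proof (rule ccontr)
    assume "\<not> ereal s \<le> ereal s'"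
    then have ss: "s' < s" "0 \<le> s'" using s' by auto
    define z where "z = (sqrt 5 - 1) / 2"
    have zK: "z \<in> cf_limit b" using golden_mean_in_cf_limit[OF b] by (simp add: z_def)
    then have z: "z \<in> cf_ivl b" using cf_limit_subset_ivl by blast
    have Mm: "0 < M" using h[OF z] m by linarith
    define C where "C = M / m * 4 powr s * (8 * (real b + 2) ^ 3) powr s"
    have "8 * (real b + 2) ^ 3 > 0" by simp
    then have C: "C > 0" using Mm m by (simp add: C_def)
    \<comment> \<open>The cover and the enlargement of the radii contribute e each, so the mass is
      at most 2 C e = 1/2.\<close>
    define e where "e = 1 / (4 * C)"
    have e: "e > 0" using C by (simp add: e_def)
    obtain U where U: "A \<subseteq> (\<Union>i. U i)" "\<And>i. bounded (U i)" "\<And>i. diameter (U i) \<le> 1"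
      "(\<Sum>i. diam_weight s' (U i)) < ennreal e"
      using hausdorff_measure_zeroD[of s' A 1 e] s' e by auto
    define d where "d i = diameter (U i) powr s" for i
    \<comment> \<open>The s-th power of the radius exceeds that of the diameter by a summable
      positive amount, which gives open balls around the sets, even those of diameter 0.\<close>
    define r where "r i = (d i + e * (1/2) ^ Suc i) powr (1 / s)" for i
    define c where "c i = (SOME x. x \<in> U i)" for i
    have d0: "0 \<le> d i" for i by (simp add: d_def)
    have pos: "0 < d i + e * (1/2) ^ Suc i" for i using d0[of i] e by (intro add_nonneg_pos) auto
    have r0: "0 < r i" for i using pos[of i] by (simp add: r_def)
    have rs: "r i powr s = d i + e * (1/2) ^ Suc i" for i using pos[of i] s by (simp add: r_def powr_powr)
    \<comment> \<open>Diameters are at most 1, so passing from s to the smaller s' does not decrease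
      the weight; for s' = 0 a nonempty set has weight 1.\<close>
    have dw: "ennreal (d i) \<le> diam_weight s' (U i)" for i
    proof (cases "U i = {}")
      case True
      then show ?thesis by (simp add: d_def diam_weight_def)
    next
      case False
      have D: "0 \<le> diameter (U i)" "diameter (U i) \<le> 1" using diameter_ge_0[OF U(2)] U(3) by auto
      have "d i \<le> diameter (U i) powr s'"
      proof (cases "diameter (U i) = 0")
        case True
        then show ?thesis by (simp add: d_def)
      next
        case False
        then show ?thesis using D ss by (simp add: d_def powr_mono')
      qed
      moreover have "d i \<le> 1" using D s powr_le1 by (simp add: d_def)
      ultimately show ?thesis using False by (auto simp: diam_weight_def intro: ennreal_leI)
    qed
    have "cf_limit b \<subseteq> (\<Union>i\<in>UNIV. ball (c i) (r i))"
    proof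
      fix x assume "x \<in> cf_limit b"
      then obtain i where x: "x \<in> U i" using cf_limit_subset_small_digits A U(1) by blast
      then have "c i \<in> U i" unfolding c_def by (rule someI)
      then have "dist (c i) x \<le> diameter (U i)" using U(2) x by (intro diameter_bounded_bound)
      also have "\<dots> < r i"
      proof (rule ccontr)
        assume "\<not> diameter (U i) < r i"
        then have "r i powr s \<le> d i" unfolding d_def using r0[of i] s by (intro powr_mono2) auto
        moreover have "0 < e * (1/2) ^ Suc i" using e by simp
        ultimately show False using rs[of i] by linarith
      qed
      finally show "x \<in> (\<Union>i\<in>UNIV. ball (c i) (r i))" by auto
    qed
    then obtain I where I: "finite I" "cf_limit b \<subseteq> (\<Union>i\<in>I. ball (c i) (r i))"
      using compactE_image[OF compact_cf_limit, of UNIV "\<lambda>i. ball (c i) (r i)" b] by auto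
    define G where "G n i = {w. w \<in> cf_words b n \<and> \<bar>cf_map w z - c i\<bar> < r i}" for n i
    have "\<forall>\<^sub>F n in sequentially. \<forall>i\<in>I. (\<Sum>w\<in>G n i. word_mass w z) \<le> M / m * 4 powr s * (8 * (real b + 2) ^ 3 * r i) powr s"
      unfolding G_def using ball_mass_le[OF z r0] by (intro eventually_ball_finite[OF I(1)]) auto
    then obtain n where n: "\<And>i. i \<in> I \<Longrightarrow> (\<Sum>w\<in>G n i. word_mass w z) \<le> M / m * 4 powr s * (8 * (real b + 2) ^ 3 * r i) powr s"
      by (auto simp: eventually_sequentially)
    have n': "(\<Sum>w\<in>G n i. word_mass w z) \<le> C * (d i + e * (1/2) ^ Suc i)" if "i \<in> I" for i
    proof -
      have "(8 * (real b + 2) ^ 3 * r i) powr s = (8 * (real b + 2) ^ 3) powr s * (d i + e * (1/2) ^ Suc i)"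
        using r0[of i] rs[of i] powr_mult[of "8 * (real b + 2) ^ 3" "r i" s] by simp
      then show ?thesis using n[OF that] by (simp only: C_def mult.assoc)
    qed
    have nn: "0 \<le> word_mass w z" if "w \<in> cf_words b n" for w
      using that word_mass_nonneg[OF z, of w] by (auto simp: cf_words_def)
    have "cf_words b n \<subseteq> (\<Union>i\<in>I. G n i)"
    proof
      fix w assume w: "w \<in> cf_words b n"
      then have "cf_map w z \<in> cf_limit b" using cf_limit_words[OF zK] by (auto simp: cf_words_def)
      then obtain i where "i \<in> I" "dist (c i) (cf_map w z) < r i" using I(2) by (auto simp: subset_iff)
      then show "w \<in> (\<Union>i\<in>I. G n i)" using w by (auto simp: G_def dist_real_def abs_minus_commute)
    qed
    moreover have fG: "finite (G n i)" for i using finite_cf_words[of b n] by (auto simp: G_def intro: finite_subset)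
    ultimately have "(\<Sum>w\<in>cf_words b n. word_mass w z) \<le> (\<Sum>w\<in>(\<Union>i\<in>I. G n i). word_mass w z)"
      using I(1) nn by (intro sum_mono2) (auto simp: G_def)
    then have "1 \<le> (\<Sum>w\<in>(\<Union>i\<in>I. G n i). word_mass w z)" by (simp only: sum_word_mass[OF z])
    also have "\<dots> \<le> (\<Sum>i\<in>I. \<Sum>w\<in>G n i. word_mass w z)"
      using nn by (intro sum_UN_le_sum[OF I(1) fG]) (auto simp: G_def)
    also have "\<dots> \<le> (\<Sum>i\<in>I. C * (d i + e * (1/2) ^ Suc i))" by (intro sum_mono n')
    also have "\<dots> = C * ((\<Sum>i\<in>I. d i) + (\<Sum>i\<in>I. e * (1/2) ^ Suc i))"
      by (simp add: sum_distrib_left sum.distrib distrib_left)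
    also have "\<dots> \<le> C * (e + e)"
    proof -
      have S: "(\<lambda>i. e * (1/2) ^ Suc i) sums e" using sums_mult[OF power_half_series, of e] by simp
      have "(\<Sum>i\<in>I. e * (1/2) ^ Suc i) \<le> (\<Sum>i. e * (1/2) ^ Suc i)"
        using e I(1) sums_summable[OF S] by (intro sum_le_suminf) auto
      then have a: "(\<Sum>i\<in>I. e * (1/2) ^ Suc i) \<le> e" using sums_unique[OF S] by simp
      have "ennreal (\<Sum>i\<in>I. d i) = (\<Sum>i\<in>I. ennreal (d i))" using d0 by (simp add: sum_ennreal)
      also have "\<dots> \<le> (\<Sum>i\<in>I. diam_weight s' (U i))" by (intro sum_mono dw)
      also have "\<dots> \<le> (\<Sum>i. diam_weight s' (U i))" using I(1) by (intro sum_le_suminf) auto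
      also have "\<dots> \<le> ennreal e" using U(4) by simp
      finally have "(\<Sum>i\<in>I. d i) \<le> e" using e by simp
      then show ?thesis using a C by (intro mult_left_mono add_mono) auto
    qed
    also have "\<dots> = 1/2" using C by (simp add: e_def)
    finally show False by simp
  qed
qed

end

end

section \<open>Rational enclosures of powers\<close>

text \<open>Every prime after 2 is reached through a quotient of neighbouring integers whose
  remaining prime factors are already treated. These quotients are near 1, so few terms of the
  series suffice.\<close>

lemma ln_prime_bounds:
  shows "ln (2::real) \<in> {693147178/1000000000..693147183/1000000000}"
    "ln (3::real) \<in> {1098612286/1000000000..1098612291/1000000000}"
    "ln (5::real) \<in> {1609437910/1000000000..1609437915/1000000000}"
    "ln (7::real) \<in> {1945910147/1000000000..1945910152/1000000000}"
    "ln (11::real) \<in> {2397895270/1000000000..2397895275/1000000000}"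
    "ln (13::real) \<in> {2564949355/1000000000..2564949360/1000000000}"
    "ln (17::real) \<in> {2833213342/1000000000..2833213347/1000000000}"
    "ln (19::real) \<in> {2944438977/1000000000..2944438982/1000000000}"
    "ln (23::real) \<in> {3135494213/1000000000..3135494218/1000000000}"
    "ln (29::real) \<in> {3367295827/1000000000..3367295832/1000000000}"
    "ln (31::real) \<in> {3433987202/1000000000..3433987207/1000000000}"
proof -
  have L2: "69314718045/100000000000 \<le> ln (2::real)" "ln (2::real) \<le> 69314718057/100000000000"
    using ln_approx_bounds[of "2" 9] by (simp_all add: lessThan_nat_numeral lessThan_Suc power_divide)
  have L3: "40546510810/100000000000 \<le> ln (3/2::real)" "ln (3/2::real) \<le> 40546510811/100000000000"
    using ln_approx_bounds[of "3/2" 7] by (simp_all add: lessThan_nat_numeral lessThan_Suc power_divide)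
  have L5: "22314355130/100000000000 \<le> ln (5/4::real)" "ln (5/4::real) \<le> 22314355132/100000000000"
    using ln_approx_bounds[of "5/4" 5] by (simp_all add: lessThan_nat_numeral lessThan_Suc power_divide)
  have L7: "15415067980/100000000000 \<le> ln (7/6::real)" "ln (7/6::real) \<le> 15415067983/100000000000"
    using ln_approx_bounds[of "7/6" 4] by (simp_all add: lessThan_nat_numeral lessThan_Suc power_divide)
  have L11: "9531017980/100000000000 \<le> ln (11/10::real)" "ln (11/10::real) \<le> 9531017981/100000000000"
    using ln_approx_bounds[of "11/10" 4] by (simp_all add: lessThan_nat_numeral lessThan_Suc power_divide)
  have L13: "8004270767/100000000000 \<le> ln (13/12::real)" "ln (13/12::real) \<le> 8004270768/100000000000"
    using ln_approx_bounds[of "13/12" 4] by (simp_all add: lessThan_nat_numeral lessThan_Suc power_divide)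
  have L17: "6062462180/100000000000 \<le> ln (17/16::real)" "ln (17/16::real) \<le> 6062462182/100000000000"
    using ln_approx_bounds[of "17/16" 3] by (simp_all add: lessThan_nat_numeral lessThan_Suc power_divide)
  have L19: "5406722126/100000000000 \<le> ln (19/18::real)" "ln (19/18::real) \<le> 5406722128/100000000000"
    using ln_approx_bounds[of "19/18" 3] by (simp_all add: lessThan_nat_numeral lessThan_Suc power_divide)
  have L23: "4255961441/100000000000 \<le> ln (24/23::real)" "ln (24/23::real) \<le> 4255961442/100000000000"
    using ln_approx_bounds[of "24/23" 3] by (simp_all add: lessThan_nat_numeral lessThan_Suc power_divide)
  have L29: "3509131981/100000000000 \<le> ln (29/28::real)" "ln (29/28::real) \<le> 3509131982/100000000000"
    using ln_approx_bounds[of "29/28" 3] by (simp_all add: lessThan_nat_numeral lessThan_Suc power_divide)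
  have L31: "3278982282/100000000000 \<le> ln (31/30::real)" "ln (31/30::real) \<le> 3278982283/100000000000"
    using ln_approx_bounds[of "31/30" 3] by (simp_all add: lessThan_nat_numeral lessThan_Suc power_divide)
  have composite: "ln (4::real) = 2 * ln 2" "ln (6::real) = ln 2 + ln 3" "ln (10::real) = ln 2 + ln 5"
    "ln (12::real) = 2 * ln 2 + ln 3" "ln (16::real) = 4 * ln 2" "ln (18::real) = ln 2 + 2 * ln 3"
    "ln (24::real) = 3 * ln 2 + ln 3" "ln (28::real) = 2 * ln 2 + ln 7" "ln (30::real) = ln 2 + ln 3 + ln 5"
    using ln_realpow[of "2::real" 2] ln_realpow[of "2::real" 3] ln_realpow[of "2::real" 4] ln_realpow[of "3::real" 2]
      ln_mult[of "2::real" 3] ln_mult[of "2::real" 5] ln_mult[of "4::real" 3] ln_mult[of "2::real" 9]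
      ln_mult[of "8::real" 3] ln_mult[of "4::real" 7] ln_mult[of "6::real" 5] by simp_all
  have D3: "ln (3/2::real) = ln 3 - ln 2" by (simp add: ln_div)
  have D5: "ln (5/4::real) = ln 5 - ln 4" by (simp add: ln_div)
  have D7: "ln (7/6::real) = ln 7 - ln 6" by (simp add: ln_div)
  have D11: "ln (11/10::real) = ln 11 - ln 10" by (simp add: ln_div)
  have D13: "ln (13/12::real) = ln 13 - ln 12" by (simp add: ln_div)
  have D17: "ln (17/16::real) = ln 17 - ln 16" by (simp add: ln_div)
  have D19: "ln (19/18::real) = ln 19 - ln 18" by (simp add: ln_div)
  have D23: "ln (24/23::real) = ln 24 - ln 23" by (simp add: ln_div)
  have D29: "ln (29/28::real) = ln 29 - ln 28" by (simp add: ln_div)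
  have D31: "ln (31/30::real) = ln 31 - ln 30" by (simp add: ln_div)
  show "ln (2::real) \<in> {693147178/1000000000..693147183/1000000000}" unfolding atLeastAtMost_iff using L2 composite by (intro conjI) linarith+
  show "ln (3::real) \<in> {1098612286/1000000000..1098612291/1000000000}" unfolding atLeastAtMost_iff using L2 L3 D3 composite by (intro conjI) linarith+
  show "ln (5::real) \<in> {1609437910/1000000000..1609437915/1000000000}" unfolding atLeastAtMost_iff using L2 L5 D5 composite by (intro conjI) linarith+
  show "ln (7::real) \<in> {1945910147/1000000000..1945910152/1000000000}" unfolding atLeastAtMost_iff using L2 L3 D3 L7 D7 composite by (intro conjI) linarith+
  show "ln (11::real) \<in> {2397895270/1000000000..2397895275/1000000000}" unfolding atLeastAtMost_iff using L2 L5 D5 L11 D11 composite by (intro conjI) linarith+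
  show "ln (13::real) \<in> {2564949355/1000000000..2564949360/1000000000}" unfolding atLeastAtMost_iff using L2 L3 D3 L13 D13 composite by (intro conjI) linarith+
  show "ln (17::real) \<in> {2833213342/1000000000..2833213347/1000000000}" unfolding atLeastAtMost_iff using L2 L17 D17 composite by (intro conjI) linarith+
  show "ln (19::real) \<in> {2944438977/1000000000..2944438982/1000000000}" unfolding atLeastAtMost_iff using L2 L3 D3 L19 D19 composite by (intro conjI) linarith+
  show "ln (23::real) \<in> {3135494213/1000000000..3135494218/1000000000}" unfolding atLeastAtMost_iff using L2 L3 D3 L23 D23 composite by (intro conjI) linarith+
  show "ln (29::real) \<in> {3367295827/1000000000..3367295832/1000000000}" unfolding atLeastAtMost_iff using L2 L3 D3 L7 D7 L29 D29 composite by (intro conjI) linarith+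
  show "ln (31::real) \<in> {3433987202/1000000000..3433987207/1000000000}" unfolding atLeastAtMost_iff using L2 L3 D3 L5 D5 L31 D31 composite by (intro conjI) linarith+
qed

definition powr_approx :: "real \<Rightarrow> real \<Rightarrow> real \<Rightarrow> bool" where
  "powr_approx c q v \<longleftrightarrow> \<bar>q powr (- c) - v\<bar> \<le> 1/1000000"

lemma ln_smooth:
  assumes "p > (0::real)"
  shows "ln (2 powi i * 3 powi j * 5 powi k * p) = of_int i * ln 2 + of_int j * ln 3 + of_int k * ln 5 + ln p"
proof -
  have "ln (x powi n) = of_int n * ln x" if "x > 0" for x :: real and n
    using that ln_powr[of x "of_int n"] by (simp add: powr_real_of_int')
  then show ?thesis using assms by (simp add: ln_mult)
qed

text \<open>The bounds \<open>v \<plusminus> 10\<^sup>-\<^sup>6\<close> are written as a 5-smooth number times a factor slightly above 1,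
  whose logarithm is enclosed by the trapezoidal and the midpoint rule.\<close>

lemma powr_approxI:
  fixes i j k i' j' k' :: int
  assumes q: "q = 2 powi i * 3 powi j * 5 powi k * p" "p > 0"
    and r: "v - 1/1000000 = 2 powi i' * 3 powi j' * 5 powi k' * r" "v + 1/1000000 = 2 powi i' * 3 powi j' * 5 powi k' * r'"
    and r1: "1 \<le> r" "1 \<le> r'"
    and l: "of_int i' * ln 2 + of_int j' * ln 3 + of_int k' * ln 5 + (r - 1) * (r + 1) / (2 * r)
      \<le> - c * (of_int i * ln 2 + of_int j * ln 3 + of_int k * ln 5 + ln p)"
    and u: "- c * (of_int i * ln 2 + of_int j * ln 3 + of_int k * ln 5 + ln p)
      \<le> of_int i' * ln 2 + of_int j' * ln 3 + of_int k' * ln 5 + 2 * (r' - 1) / (r' + 1)"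
  shows "powr_approx c q v"
proof -
  have q0: "q > 0" using q by simp
  have lnq: "ln q = of_int i * ln 2 + of_int j * ln 3 + of_int k * ln 5 + ln p" unfolding q(1) by (rule ln_smooth[OF q(2)])
  have pos: "v - 1/1000000 > 0" "v + 1/1000000 > 0" unfolding r using r1 by simp_all
  have "ln (v - 1/1000000) \<le> - c * ln q"
    unfolding r lnq using r1 ln_smooth[of r i' j' k'] ln_upper_sym[OF r1(1)] l by linarith
  then have "v - 1/1000000 \<le> q powr (- c)" using pos q0 exp_le_cancel_iff[of "ln (v - 1/1000000)" "- c * ln q"] by (simp add: powr_def)
  moreover have "- c * ln q \<le> ln (v + 1/1000000)"
    unfolding r lnq using r1 ln_smooth[of r' i' j' k'] ln_lower_sym[OF r1(2)] u by linarith
  then have "q powr (- c) \<le> v + 1/1000000" using pos q0 exp_le_cancel_iff[of "- c * ln q" "ln (v + 1/1000000)"] by (simp add: powr_def)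
  ultimately show ?thesis unfolding powr_approx_def by linarith
qed

text \<open>The exponent is 2s for s = 0.8677. The bases are the values of x + a, x + a + 1/4, x + a
  + 1/2, (x + 2)/2 and (x + 4)/4 that \<open>trial_6\<close> needs at its expansion points 1/4, 1/2
  and 3/4.\<close>

lemma powr_approx_6:
  shows "powr_approx (8677/5000) (17/16) (900137/1000000)"
    "powr_approx (8677/5000) (9/8) (25473/31250)"
    "powr_approx (8677/5000) (19/16) (742131/1000000)"
    "powr_approx (8677/5000) (5/4) (339463/500000)"
    "powr_approx (8677/5000) (11/8) (287713/500000)"
    "powr_approx (8677/5000) (3/2) (494779/1000000)"
    "powr_approx (8677/5000) (7/4) (75729/200000)"
    "powr_approx (8677/5000) (2) (150163/500000)"
    "powr_approx (8677/5000) (9/4) (122403/500000)"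
    "powr_approx (8677/5000) (5/2) (203899/1000000)"
    "powr_approx (8677/5000) (11/4) (34563/200000)"
    "powr_approx (8677/5000) (3) (29719/200000)"
    "powr_approx (8677/5000) (13/4) (32331/250000)"
    "powr_approx (8677/5000) (7/2) (113717/1000000)"
    "powr_approx (8677/5000) (15/4) (20177/200000)"
    "powr_approx (8677/5000) (4) (22549/250000)"
    "powr_approx (8677/5000) (17/4) (20297/250000)"
    "powr_approx (8677/5000) (9/2) (36761/500000)"
    "powr_approx (8677/5000) (19/4) (66937/1000000)"
    "powr_approx (8677/5000) (5) (15309/250000)"
    "powr_approx (8677/5000) (21/4) (11253/200000)"
    "powr_approx (8677/5000) (11/2) (51901/1000000)"
    "powr_approx (8677/5000) (23/4) (3003/62500)"
    "powr_approx (8677/5000) (6) (44627/1000000)"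
    "powr_approx (8677/5000) (25/4) (1663/40000)"
    "powr_approx (8677/5000) (13/2) (38839/1000000)"
    "powr_approx (8677/5000) (27/4) (36377/1000000)"
    "powr_approx (8677/5000) (7) (4269/125000)"
    "powr_approx (8677/5000) (29/4) (16067/500000)"
    "powr_approx (8677/5000) (15/2) (15149/500000)"
    "powr_approx (8677/5000) (31/4) (14311/500000)"
proof -
  show "powr_approx (8677/5000) (17/16) (900137/1000000)"
    by (rule powr_approxI[where i = "-4" and j = "0" and k = "0" and p = 17 and i' = "-1" and j' = "2" and k' = "-1"
        and r = "112517/112500" and r' = "150023/150000"])
      (use ln_prime_bounds(1,2,3,7) in \<open>simp_all add: power_int_minus field_simps\<close>)
  show "powr_approx (8677/5000) (9/8) (25473/31250)"
    by (rule powr_approxI[where i = "-3" and j = "2" and k = "0" and p = 1 and i' = "-2" and j' = "4" and k' = "-2"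
        and r = "163027/162000" and r' = "815137/810000"])
      (use ln_prime_bounds(1,2,3) in \<open>simp_all add: power_int_minus field_simps\<close>)
  show "powr_approx (8677/5000) (19/16) (742131/1000000)"
    by (rule powr_approxI[where i = "-4" and j = "0" and k = "0" and p = 19 and i' = "2" and j' = "-3" and k' = "1"
        and r = "2003751/2000000" and r' = "5009391/5000000"])
      (use ln_prime_bounds(1,2,3,8) in \<open>simp_all add: power_int_minus field_simps\<close>)
  show "powr_approx (8677/5000) (5/4) (339463/500000)"
    by (rule powr_approxI[where i = "-2" and j = "0" and k = "1" and p = 1 and i' = "-3" and j' = "3" and k' = "-1"
        and r = "27157/27000" and r' = "226309/225000"])
      (use ln_prime_bounds(1,2,3) in \<open>simp_all add: power_int_minus field_simps\<close>)
  show "powr_approx (8677/5000) (11/8) (287713/500000)"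
    by (rule powr_approxI[where i = "-3" and j = "0" and k = "0" and p = 11 and i' = "7" and j' = "-2" and k' = "-2"
        and r = "207153/204800" and r' = "5178843/5120000"])
      (use ln_prime_bounds(1,2,3,5) in \<open>simp_all add: power_int_minus field_simps\<close>)
  show "powr_approx (8677/5000) (3/2) (494779/1000000)"
    by (rule powr_approxI[where i = "-1" and j = "1" and k = "0" and p = 1 and i' = "3" and j' = "-4" and k' = "1"
        and r = "20038509/20000000" and r' = "2003859/2000000"])
      (use ln_prime_bounds(1,2,3) in \<open>simp_all add: power_int_minus field_simps\<close>)
  show "powr_approx (8677/5000) (7/4) (75729/200000)"
    by (rule powr_approxI[where i = "-2" and j = "0" and k = "0" and p = 7 and i' = "-3" and j' = "1" and k' = "0"
        and r = "94661/93750" and r' = "189323/187500"])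
      (use ln_prime_bounds(1,2,3,4) in \<open>simp_all add: power_int_minus field_simps\<close>)
  show "powr_approx (8677/5000) (2) (150163/500000)"
    by (rule powr_approxI[where i = "1" and j = "0" and k = "0" and p = 1 and i' = "-1" and j' = "1" and k' = "-1"
        and r = "12013/12000" and r' = "100109/100000"])
      (use ln_prime_bounds(1,2,3) in \<open>simp_all add: power_int_minus field_simps\<close>)
  show "powr_approx (8677/5000) (9/4) (122403/500000)"
    by (rule powr_approxI[where i = "-2" and j = "2" and k = "0" and p = 1 and i' = "-9" and j' = "0" and k' = "3"
        and r = "391688/390625" and r' = "1958456/1953125"])
      (use ln_prime_bounds(1,2,3) in \<open>simp_all add: power_int_minus field_simps\<close>)
  show "powr_approx (8677/5000) (5/2) (203899/1000000)"
    by (rule powr_approxI[where i = "-1" and j = "0" and k = "1" and p = 1 and i' = "-4" and j' = "4" and k' = "-2"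
        and r = "33983/33750" and r' = "2039/2025"])
      (use ln_prime_bounds(1,2,3) in \<open>simp_all add: power_int_minus field_simps\<close>)
  show "powr_approx (8677/5000) (11/4) (34563/200000)"
    by (rule powr_approxI[where i = "-2" and j = "0" and k = "0" and p = 11 and i' = "6" and j' = "-1" and k' = "-3"
        and r = "259221/256000" and r' = "32403/32000"])
      (use ln_prime_bounds(1,2,3,5) in \<open>simp_all add: power_int_minus field_simps\<close>)
  show "powr_approx (8677/5000) (3) (29719/200000)"
    by (rule powr_approxI[where i = "0" and j = "1" and k = "0" and p = 1 and i' = "2" and j' = "-3" and k' = "0"
        and r = "2006019/2000000" and r' = "1003023/1000000"])
      (use ln_prime_bounds(1,2,3) in \<open>simp_all add: power_int_minus field_simps\<close>)
  show "powr_approx (8677/5000) (13/4) (32331/250000)"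
    by (rule powr_approxI[where i = "-2" and j = "0" and k = "0" and p = 13 and i' = "4" and j' = "0" and k' = "-3"
        and r = "129323/128000" and r' = "5173/5120"])
      (use ln_prime_bounds(1,2,3,6) in \<open>simp_all add: power_int_minus field_simps\<close>)
  show "powr_approx (8677/5000) (7/2) (113717/1000000)"
    by (rule powr_approxI[where i = "-1" and j = "0" and k = "0" and p = 7 and i' = "0" and j' = "-2" and k' = "0"
        and r = "255861/250000" and r' = "511731/500000"])
      (use ln_prime_bounds(1,2,3,4) in \<open>simp_all add: power_int_minus field_simps\<close>)
  show "powr_approx (8677/5000) (15/4) (20177/200000)"
    by (rule powr_approxI[where i = "-2" and j = "1" and k = "1" and p = 1 and i' = "-1" and j' = "0" and k' = "-1"
        and r = "25221/25000" and r' = "50443/50000"])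
      (use ln_prime_bounds(1,2,3) in \<open>simp_all add: power_int_minus field_simps\<close>)
  show "powr_approx (8677/5000) (4) (22549/250000)"
    by (rule powr_approxI[where i = "2" and j = "0" and k = "0" and p = 1 and i' = "2" and j' = "-2" and k' = "-1"
        and r = "162351/160000" and r' = "811773/800000"])
      (use ln_prime_bounds(1,2,3) in \<open>simp_all add: power_int_minus field_simps\<close>)
  show "powr_approx (8677/5000) (17/4) (20297/250000)"
    by (rule powr_approxI[where i = "-2" and j = "0" and k = "0" and p = 17 and i' = "1" and j' = "0" and k' = "-2"
        and r = "81187/80000" and r' = "81189/80000"])
      (use ln_prime_bounds(1,2,3,7) in \<open>simp_all add: power_int_minus field_simps\<close>)
  show "powr_approx (8677/5000) (9/2) (36761/500000)"
    by (rule powr_approxI[where i = "-1" and j = "2" and k = "0" and p = 1 and i' = "0" and j' = "2" and k' = "-3"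
        and r = "8169/8000" and r' = "73523/72000"])
      (use ln_prime_bounds(1,2,3) in \<open>simp_all add: power_int_minus field_simps\<close>)
  show "powr_approx (8677/5000) (19/4) (66937/1000000)"
    by (rule powr_approxI[where i = "-2" and j = "0" and k = "0" and p = 19 and i' = "0" and j' = "-1" and k' = "-1"
        and r = "25101/25000" and r' = "100407/100000"])
      (use ln_prime_bounds(1,2,3,8) in \<open>simp_all add: power_int_minus field_simps\<close>)
  show "powr_approx (8677/5000) (5) (15309/250000)"
    by (rule powr_approxI[where i = "0" and j = "0" and k = "1" and p = 1 and i' = "-1" and j' = "1" and k' = "-2"
        and r = "12247/12000" and r' = "61237/60000"])
      (use ln_prime_bounds(1,2,3) in \<open>simp_all add: power_int_minus field_simps\<close>)
  show "powr_approx (8677/5000) (21/4) (11253/200000)"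
    by (rule powr_approxI[where i = "-2" and j = "1" and k = "0" and p = 7 and i' = "-1" and j' = "-2" and k' = "0"
        and r = "63297/62500" and r' = "253197/250000"])
      (use ln_prime_bounds(1,2,3,4) in \<open>simp_all add: power_int_minus field_simps\<close>)
  show "powr_approx (8677/5000) (11/2) (51901/1000000)"
    by (rule powr_approxI[where i = "-1" and j = "0" and k = "0" and p = 11 and i' = "-1" and j' = "-5" and k' = "2"
        and r = "126117/125000" and r' = "6306093/6250000"])
      (use ln_prime_bounds(1,2,3,5) in \<open>simp_all add: power_int_minus field_simps\<close>)
  show "powr_approx (8677/5000) (23/4) (3003/62500)"
    by (rule powr_approxI[where i = "-2" and j = "0" and k = "0" and p = 23 and i' = "-6" and j' = "1" and k' = "0"
        and r = "48047/46875" and r' = "48049/46875"])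
      (use ln_prime_bounds(1,2,3,9) in \<open>simp_all add: power_int_minus field_simps\<close>)
  show "powr_approx (8677/5000) (6) (44627/1000000)"
    by (rule powr_approxI[where i = "1" and j = "1" and k = "0" and p = 1 and i' = "1" and j' = "-2" and k' = "-1"
        and r = "200817/200000" and r' = "100413/100000"])
      (use ln_prime_bounds(1,2,3) in \<open>simp_all add: power_int_minus field_simps\<close>)
  show "powr_approx (8677/5000) (25/4) (1663/40000)"
    by (rule powr_approxI[where i = "-2" and j = "0" and k = "2" and p = 1 and i' = "1" and j' = "-5" and k' = "1"
        and r = "5051241/5000000" and r' = "1262871/1250000"])
      (use ln_prime_bounds(1,2,3) in \<open>simp_all add: power_int_minus field_simps\<close>)
  show "powr_approx (8677/5000) (13/2) (38839/1000000)"
    by (rule powr_approxI[where i = "-1" and j = "0" and k = "0" and p = 13 and i' = "-3" and j' = "-4" and k' = "2"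
        and r = "1572939/1562500" and r' = "78651/78125"])
      (use ln_prime_bounds(1,2,3,6) in \<open>simp_all add: power_int_minus field_simps\<close>)
  show "powr_approx (8677/5000) (27/4) (36377/1000000)"
    by (rule powr_approxI[where i = "-2" and j = "3" and k = "0" and p = 1 and i' = "3" and j' = "-2" and k' = "-2"
        and r = "40923/40000" and r' = "163701/160000"])
      (use ln_prime_bounds(1,2,3) in \<open>simp_all add: power_int_minus field_simps\<close>)
  show "powr_approx (8677/5000) (7) (4269/125000)"
    by (rule powr_approxI[where i = "0" and j = "0" and k = "0" and p = 7 and i' = "-1" and j' = "-1" and k' = "-1"
        and r = "102453/100000" and r' = "102459/100000"])
      (use ln_prime_bounds(1,2,3,4) in \<open>simp_all add: power_int_minus field_simps\<close>)
  show "powr_approx (8677/5000) (29/4) (16067/500000)"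
    by (rule powr_approxI[where i = "-2" and j = "0" and k = "0" and p = 29 and i' = "-5" and j' = "0" and k' = "0"
        and r = "32133/31250" and r' = "6427/6250"])
      (use ln_prime_bounds(1,2,3,10) in \<open>simp_all add: power_int_minus field_simps\<close>)
  show "powr_approx (8677/5000) (15/2) (15149/500000)"
    by (rule powr_approxI[where i = "-1" and j = "1" and k = "1" and p = 1 and i' = "-2" and j' = "1" and k' = "-2"
        and r = "10099/10000" and r' = "30299/30000"])
      (use ln_prime_bounds(1,2,3) in \<open>simp_all add: power_int_minus field_simps\<close>)
  show "powr_approx (8677/5000) (31/4) (14311/500000)"
    by (rule powr_approxI[where i = "-2" and j = "0" and k = "0" and p = 31 and i' = "-2" and j' = "-2" and k' = "0"
        and r = "257589/250000" and r' = "257607/250000"])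
      (use ln_prime_bounds(1,2,3,11) in \<open>simp_all add: power_int_minus field_simps\<close>)
qed

text \<open>The corresponding table for \<open>trial_3\<close>, with exponent 2s for s =
  0.7056.\<close>

lemma powr_approx_3:
  shows "powr_approx (882/625) (17/16) (229501/250000)"
    "powr_approx (882/625) (9/8) (52929/62500)"
    "powr_approx (882/625) (19/16) (196163/250000)"
    "powr_approx (882/625) (5/4) (364931/500000)"
    "powr_approx (882/625) (11/8) (63801/100000)"
    "powr_approx (882/625) (3/2) (564287/1000000)"
    "powr_approx (882/625) (7/4) (453967/1000000)"
    "powr_approx (882/625) (2) (375999/1000000)"
    "powr_approx (882/625) (9/4) (15921/50000)"
    "powr_approx (882/625) (5/2) (274427/1000000)"
    "powr_approx (882/625) (11/4) (239891/1000000)"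
    "powr_approx (882/625) (3) (212171/1000000)"
    "powr_approx (882/625) (13/4) (189509/1000000)"
    "powr_approx (882/625) (7/2) (170691/1000000)"
    "powr_approx (882/625) (15/4) (19357/125000)"
    "powr_approx (882/625) (4) (1131/8000)"
    "powr_approx (882/625) (17/4) (129783/1000000)"
    "powr_approx (882/625) (9/2) (4789/40000)"
    "powr_approx (882/625) (19/4) (11093/100000)"
proof -
  show "powr_approx (882/625) (17/16) (229501/250000)"
    by (rule powr_approxI[where i = "-4" and j = "0" and k = "0" and p = 17 and i' = "-5" and j' = "6" and k' = "-2"
        and r = "306001/303750" and r' = "183601/182250"])
      (use ln_prime_bounds(1,2,3,7) in \<open>simp_all add: power_int_minus field_simps\<close>)
  show "powr_approx (882/625) (9/8) (52929/62500)"
    by (rule powr_approxI[where i = "-3" and j = "2" and k = "0" and p = 1 and i' = "-5" and j' = "3" and k' = "0"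
        and r = "846863/843750" and r' = "169373/168750"])
      (use ln_prime_bounds(1,2,3) in \<open>simp_all add: power_int_minus field_simps\<close>)
  show "powr_approx (882/625) (19/16) (196163/250000)"
    by (rule powr_approxI[where i = "-4" and j = "0" and k = "0" and p = 19 and i' = "-5" and j' = "0" and k' = "2"
        and r = "784651/781250" and r' = "784653/781250"])
      (use ln_prime_bounds(1,2,3,8) in \<open>simp_all add: power_int_minus field_simps\<close>)
  show "powr_approx (882/625) (5/4) (364931/500000)"
    by (rule powr_approxI[where i = "-2" and j = "0" and k = "1" and p = 1 and i' = "-5" and j' = "-3" and k' = "4"
        and r = "19706247/19531250" and r' = "19706301/19531250"])
      (use ln_prime_bounds(1,2,3) in \<open>simp_all add: power_int_minus field_simps\<close>)
  show "powr_approx (882/625) (11/8) (63801/100000)"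
    by (rule powr_approxI[where i = "-3" and j = "0" and k = "0" and p = 11 and i' = "-7" and j' = "4" and k' = "0"
        and r = "1276018/1265625" and r' = "1276022/1265625"])
      (use ln_prime_bounds(1,2,3,5) in \<open>simp_all add: power_int_minus field_simps\<close>)
  show "powr_approx (882/625) (3/2) (564287/1000000)"
    by (rule powr_approxI[where i = "-1" and j = "1" and k = "0" and p = 1 and i' = "-4" and j' = "2" and k' = "0"
        and r = "282143/281250" and r' = "47024/46875"])
      (use ln_prime_bounds(1,2,3) in \<open>simp_all add: power_int_minus field_simps\<close>)
  show "powr_approx (882/625) (7/4) (453967/1000000)"
    by (rule powr_approxI[where i = "-2" and j = "0" and k = "0" and p = 7 and i' = "-2" and j' = "2" and k' = "-1"
        and r = "75661/75000" and r' = "28373/28125"])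
      (use ln_prime_bounds(1,2,3,4) in \<open>simp_all add: power_int_minus field_simps\<close>)
  show "powr_approx (882/625) (2) (375999/1000000)"
    by (rule powr_approxI[where i = "1" and j = "0" and k = "0" and p = 1 and i' = "-3" and j' = "1" and k' = "0"
        and r = "187999/187500" and r' = "376/375"])
      (use ln_prime_bounds(1,2,3) in \<open>simp_all add: power_int_minus field_simps\<close>)
  show "powr_approx (882/625) (9/4) (15921/50000)"
    by (rule powr_approxI[where i = "-2" and j = "2" and k = "0" and p = 1 and i' = "-8" and j' = "4" and k' = "0"
        and r = "1273676/1265625" and r' = "1273684/1265625"])
      (use ln_prime_bounds(1,2,3) in \<open>simp_all add: power_int_minus field_simps\<close>)
  show "powr_approx (882/625) (5/2) (274427/1000000)"
    by (rule powr_approxI[where i = "-1" and j = "0" and k = "1" and p = 1 and i' = "-2" and j' = "3" and k' = "-2"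
        and r = "137213/135000" and r' = "2541/2500"])
      (use ln_prime_bounds(1,2,3) in \<open>simp_all add: power_int_minus field_simps\<close>)
  show "powr_approx (882/625) (11/4) (239891/1000000)"
    by (rule powr_approxI[where i = "-2" and j = "0" and k = "0" and p = 11 and i' = "5" and j' = "-3" and k' = "-1"
        and r = "647703/640000" and r' = "1619271/1600000"])
      (use ln_prime_bounds(1,2,3,5) in \<open>simp_all add: power_int_minus field_simps\<close>)
  show "powr_approx (882/625) (3) (212171/1000000)"
    by (rule powr_approxI[where i = "0" and j = "1" and k = "0" and p = 1 and i' = "-3" and j' = "-1" and k' = "1"
        and r = "63651/62500" and r' = "159129/156250"])
      (use ln_prime_bounds(1,2,3) in \<open>simp_all add: power_int_minus field_simps\<close>)
  show "powr_approx (882/625) (13/4) (189509/1000000)"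
    by (rule powr_approxI[where i = "-2" and j = "0" and k = "0" and p = 13 and i' = "-4" and j' = "1" and k' = "0"
        and r = "47377/46875" and r' = "6317/6250"])
      (use ln_prime_bounds(1,2,3,6) in \<open>simp_all add: power_int_minus field_simps\<close>)
  show "powr_approx (882/625) (7/2) (170691/1000000)"
    by (rule powr_approxI[where i = "-1" and j = "0" and k = "0" and p = 7 and i' = "-5" and j' = "3" and k' = "-1"
        and r = "17069/16875" and r' = "85346/84375"])
      (use ln_prime_bounds(1,2,3,4) in \<open>simp_all add: power_int_minus field_simps\<close>)
  show "powr_approx (882/625) (15/4) (19357/125000)"
    by (rule powr_approxI[where i = "-2" and j = "1" and k = "1" and p = 1 and i' = "-1" and j' = "-4" and k' = "2"
        and r = "2508651/2500000" and r' = "12543417/12500000"])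
      (use ln_prime_bounds(1,2,3) in \<open>simp_all add: power_int_minus field_simps\<close>)
  show "powr_approx (882/625) (4) (1131/8000)"
    by (rule powr_approxI[where i = "2" and j = "0" and k = "0" and p = 1 and i' = "-2" and j' = "-2" and k' = "1"
        and r = "636183/625000" and r' = "79524/78125"])
      (use ln_prime_bounds(1,2,3) in \<open>simp_all add: power_int_minus field_simps\<close>)
  show "powr_approx (882/625) (17/4) (129783/1000000)"
    by (rule powr_approxI[where i = "-2" and j = "0" and k = "0" and p = 17 and i' = "4" and j' = "0" and k' = "-3"
        and r = "64891/64000" and r' = "16223/16000"])
      (use ln_prime_bounds(1,2,3,7) in \<open>simp_all add: power_int_minus field_simps\<close>)
  show "powr_approx (882/625) (9/2) (4789/40000)"
    by (rule powr_approxI[where i = "-1" and j = "2" and k = "0" and p = 1 and i' = "-7" and j' = "1" and k' = "1"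
        and r = "79816/78125" and r' = "239452/234375"])
      (use ln_prime_bounds(1,2,3) in \<open>simp_all add: power_int_minus field_simps\<close>)
  show "powr_approx (882/625) (19/4) (11093/100000)"
    by (rule powr_approxI[where i = "-2" and j = "0" and k = "0" and p = 19 and i' = "4" and j' = "-6" and k' = "1"
        and r = "80867241/80000000" and r' = "80868699/80000000"])
      (use ln_prime_bounds(1,2,3,8) in \<open>simp_all add: power_int_minus field_simps\<close>)
qed


section \<open>Approximate eigenfunctions of the transfer operators\<close>

text \<open>Maclaurin's formula with Lagrange remainder; (10/9)^7 bounds (1 + t)^(- c - 5), because
  1 + t \<ge> 9/10 and c \<le> 2.\<close>

lemma powr_taylor4:
  fixes z c :: real
  assumes c: "0 < c" "c \<le> 2" and z: "\<bar>z\<bar> \<le> 1/10"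
  shows "\<bar>(1 + z) powr (- c) - (1 - c * z + c * (c + 1) / 2 * z ^ 2 - c * (c + 1) * (c + 2) / 6 * z ^ 3
      + c * (c + 1) * (c + 2) * (c + 3) / 24 * z ^ 4)\<bar>
    \<le> c * (c + 1) * (c + 2) * (c + 3) * (c + 4) / 120 * (10/9) ^ 7 * \<bar>z\<bar> ^ 5"
proof -
  define f where "f = (\<lambda>m t. (-1) ^ m * pochhammer c m * (1 + t) powr (- c - real m))"
  have "\<exists>t. \<bar>t\<bar> \<le> \<bar>z\<bar> \<and> (1 + z) powr (- c) = (\<Sum>m<5. f m 0 / fact m * z ^ m) + f 5 t / fact 5 * z ^ 5"
  proof (rule Maclaurin_bi_le)
    show "f 0 = (\<lambda>z. (1 + z) powr (- c))" by (auto simp: f_def)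
    show "\<forall>m t. m < 5 \<and> \<bar>t\<bar> \<le> \<bar>z\<bar> \<longrightarrow> (f m has_real_derivative f (Suc m) t) (at t)"
    proof (intro allI impI)
      fix m :: nat and t :: real
      assume "m < 5 \<and> \<bar>t\<bar> \<le> \<bar>z\<bar>"
      then have t: "1 + t > 0" using z by auto
      show "(f m has_real_derivative f (Suc m) t) (at t)"
        unfolding f_def using t
        by (auto intro!: derivative_eq_intros simp: pochhammer_Suc algebra_simps)
    qed
  qed
  then obtain t where t: "\<bar>t\<bar> \<le> \<bar>z\<bar>" "(1 + z) powr (- c) = (\<Sum>m<5. f m 0 / fact m * z ^ m) + f 5 t / fact 5 * z ^ 5"
    by blast
  have sm: "(\<Sum>m<5. f m 0 / fact m * z ^ m) = 1 - c * z + c * (c + 1) / 2 * z ^ 2 - c * (c + 1) * (c + 2) / 6 * z ^ 3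
      + c * (c + 1) * (c + 2) * (c + 3) / 24 * z ^ 4"
    by (simp add: f_def eval_nat_numeral pochhammer_Suc fact_numeral)
  have t9: "1 + t \<ge> 9/10" using t(1) z by linarith
  have "(1 + t) powr (- c - 5) \<le> (9/10) powr (- c - 5)" using t9 c by (intro powr_mono2') auto
  also have "(9/10 :: real) powr (- c - 5) \<le> (9/10) powr (- 7)" using c by (intro powr_mono') auto
  also have "(9/10 :: real) powr (- 7) = (10/9) ^ 7" by (simp add: powr_minus powr_numeral power_divide)
  finally have p: "(1 + t) powr (- c - 5) \<le> (10/9) ^ 7" .
  have "\<bar>f 5 t / fact 5 * z ^ 5\<bar> = c * (c + 1) * (c + 2) * (c + 3) * (c + 4) / 120 * (1 + t) powr (- c - 5) * \<bar>z\<bar> ^ 5"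
    using c by (simp add: f_def eval_nat_numeral pochhammer_Suc fact_numeral abs_mult)
  also have "\<dots> \<le> c * (c + 1) * (c + 2) * (c + 3) * (c + 4) / 120 * (10/9) ^ 7 * \<bar>z\<bar> ^ 5"
    using c p by (intro mult_right_mono mult_left_mono) auto
  finally show ?thesis using t(2) sm by simp
qed

text \<open>A tuple \<open>(C, \<beta>, \<gamma>, v)\<close> stands for the term \<open>C ((x + \<beta>) / \<gamma>) powr (- c)\<close>, and \<open>v\<close> approximates
  \<open>((x\<^sub>0 + \<beta>) / \<gamma>) powr (- c)\<close>.\<close>

definition powr_sum :: "real \<Rightarrow> (real \<times> real \<times> real \<times> real) list \<Rightarrow> real \<Rightarrow> real" where
  "powr_sum c ts x = (\<Sum>(C, \<beta>, \<gamma>, v)\<leftarrow>ts. C * ((x + \<beta>) / \<gamma>) powr (- c))"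

text \<open>The k-th Taylor coefficient of the whole sum without its sign and binomial factor, which
  \<open>powr_sum_ge\<close> restores.\<close>

definition taylor_sum :: "real \<Rightarrow> (real \<times> real \<times> real \<times> real) list \<Rightarrow> nat \<Rightarrow> real" where
  "taylor_sum x\<^sub>0 ts k = (\<Sum>(C, \<beta>, \<gamma>, v)\<leftarrow>ts. C * v / (x\<^sub>0 + \<beta>) ^ k)"

definition rem_sum :: "real \<Rightarrow> (real \<times> real \<times> real \<times> real) list \<Rightarrow> real" where
  "rem_sum x\<^sub>0 ts = (\<Sum>(C, \<beta>, \<gamma>, v)\<leftarrow>ts. \<bar>C\<bar> * v / (x\<^sub>0 + \<beta>) ^ 5)"

text \<open>Expansion in z = y / B, where |z| \<le> 1/10. The last term is the tolerance 1/1000000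
  of the tabulated v times 5/4, a bound for (1 + z)^(- c).\<close>

lemma powr_term_ge:
  assumes c: "0 < c" "c \<le> 2" and y: "\<bar>y\<bar> \<le> 1/8" and b: "5/4 \<le> B" "0 < \<gamma>" "0 \<le> v"
    and v: "powr_approx c (B / \<gamma>) v"
  shows "C * ((B + y) / \<gamma>) powr (- c) \<ge> C * v / B ^ 0 - c * y * (C * v / B ^ 1) + c * (c + 1) / 2 * y ^ 2 * (C * v / B ^ 2)
     - c * (c + 1) * (c + 2) / 6 * y ^ 3 * (C * v / B ^ 3) + c * (c + 1) * (c + 2) * (c + 3) / 24 * y ^ 4 * (C * v / B ^ 4)
     - c * (c + 1) * (c + 2) * (c + 3) * (c + 4) / 120 * (10/9) ^ 7 / 8 ^ 5 * (\<bar>C\<bar> * v / B ^ 5) - \<bar>C\<bar> * (5/4000000)"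
proof -
  define z where "z = y / B"
  define P where "P = 1 - c * z + c * (c + 1) / 2 * z ^ 2 - c * (c + 1) * (c + 2) / 6 * z ^ 3
      + c * (c + 1) * (c + 2) * (c + 3) / 24 * z ^ 4"
  define K where "K = c * (c + 1) * (c + 2) * (c + 3) * (c + 4) / 120 * (10/9) ^ 7"
  define X where "X = (1 + z) powr (- c)"
  have B0: "B > 0" using b by linarith
  have zb: "\<bar>z\<bar> \<le> 1/8 / B" unfolding z_def abs_divide using divide_right_mono[OF y, of B] B0 by simp
  also have "1/8 / B \<le> 1/8 / (5/4)" using b by (intro divide_left_mono) auto
  finally have z: "\<bar>z\<bar> \<le> 1/10" by simp
  have K0: "K \<ge> 0" using c by (simp add: K_def)
  have tl: "\<bar>X - P\<bar> \<le> K * \<bar>z\<bar> ^ 5" unfolding X_def P_def K_def by (rule powr_taylor4[OF c z])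
  also have "\<dots> \<le> K * (1/8 / B) ^ 5" using zb K0 by (intro mult_left_mono power_mono) auto
  finally have tl: "\<bar>X - P\<bar> \<le> K / 8 ^ 5 / B ^ 5" by (simp add: power_divide)
  have X: "0 \<le> X" "X \<le> 5/4"
  proof -
    have "X \<le> (9/10) powr (- c)" unfolding X_def using z c by (intro powr_mono2') auto
    also have "(9/10 :: real) powr (- c) \<le> (9/10) powr (- 2)" using c by (intro powr_mono') auto
    also have "(9/10 :: real) powr (- 2) \<le> 5/4" by (simp add: powr_minus powr_numeral power_divide)
    finally show "X \<le> 5/4" .
  qed (simp add: X_def)
  have "(B + y) / \<gamma> = (B / \<gamma>) * (1 + z)" using B0 b by (simp add: z_def field_simps)
  moreover have "((B / \<gamma>) * (1 + z)) powr (- c) = (B / \<gamma>) powr (- c) * X"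
    unfolding X_def by (subst powr_mult) (use B0 b z in auto)
  ultimately have e: "((B + y) / \<gamma>) powr (- c) = (B / \<gamma>) powr (- c) * X" by (simp only:)
  have "\<bar>((B + y) / \<gamma>) powr (- c) - v * X\<bar> = \<bar>(B / \<gamma>) powr (- c) - v\<bar> * X"
    unfolding e left_diff_distrib[symmetric] abs_mult using X by simp
  also have "\<dots> \<le> 1/1000000 * (5/4)" using v X unfolding powr_approx_def by (intro mult_mono) auto
  finally have 1: "\<bar>((B + y) / \<gamma>) powr (- c) - v * X\<bar> \<le> 5/4000000" by simp
  have "\<bar>v * X - v * P\<bar> = v * \<bar>X - P\<bar>" unfolding right_diff_distrib[symmetric] abs_mult using b by simp
  also have "\<dots> \<le> v * (K / 8 ^ 5 / B ^ 5)" using tl b by (intro mult_left_mono) auto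
  finally have "\<bar>((B + y) / \<gamma>) powr (- c) - v * P\<bar> \<le> v * (K / 8 ^ 5 / B ^ 5) + 5/4000000" using 1 by linarith
  then have "\<bar>C\<bar> * \<bar>((B + y) / \<gamma>) powr (- c) - v * P\<bar> \<le> \<bar>C\<bar> * (v * (K / 8 ^ 5 / B ^ 5) + 5/4000000)"
    by (intro mult_left_mono) auto
  then have "\<bar>C * ((B + y) / \<gamma>) powr (- c) - C * (v * P)\<bar> \<le> \<bar>C\<bar> * (v * (K / 8 ^ 5 / B ^ 5) + 5/4000000)"
    unfolding abs_mult[symmetric] right_diff_distrib .
  then have "C * ((B + y) / \<gamma>) powr (- c) \<ge> C * (v * P) - \<bar>C\<bar> * (v * (K / 8 ^ 5 / B ^ 5) + 5/4000000)" by linarith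
  moreover have "C * (v * P) = C * v / B ^ 0 - c * y * (C * v / B ^ 1) + c * (c + 1) / 2 * y ^ 2 * (C * v / B ^ 2)
     - c * (c + 1) * (c + 2) / 6 * y ^ 3 * (C * v / B ^ 3) + c * (c + 1) * (c + 2) * (c + 3) / 24 * y ^ 4 * (C * v / B ^ 4)"
    unfolding P_def z_def by (simp add: power_divide distrib_left right_diff_distrib add_divide_distrib diff_divide_distrib mult_ac)
  moreover have "\<bar>C\<bar> * (v * (K / 8 ^ 5 / B ^ 5) + 5/4000000) = K / 8 ^ 5 * (\<bar>C\<bar> * v / B ^ 5) + \<bar>C\<bar> * (5/4000000)"
    by (simp add: distrib_left mult_ac)
  ultimately show ?thesis unfolding K_def by linarith
qed

text \<open>Absolute values are taken only after each Taylor order has been summed over the list, so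
  that cancellation between terms of opposite sign is kept; the margins are too small without
  it.\<close>

lemma powr_sum_ge:
  assumes c: "0 < c" "c \<le> 2" and x: "\<bar>x - x\<^sub>0\<bar> \<le> 1/8"
    and ts: "\<forall>(C, \<beta>, \<gamma>, v)\<in>set ts. 5/4 \<le> x\<^sub>0 + \<beta> \<and> 0 < \<gamma> \<and> 0 \<le> v \<and> powr_approx c ((x\<^sub>0 + \<beta>) / \<gamma>) v"
  shows "powr_sum c ts x \<ge> taylor_sum x\<^sub>0 ts 0 - c / 8 * \<bar>taylor_sum x\<^sub>0 ts 1\<bar> - c * (c + 1) / 2 / 64 * \<bar>taylor_sum x\<^sub>0 ts 2\<bar>
     - c * (c + 1) * (c + 2) / 6 / 512 * \<bar>taylor_sum x\<^sub>0 ts 3\<bar> - c * (c + 1) * (c + 2) * (c + 3) / 24 / 4096 * \<bar>taylor_sum x\<^sub>0 ts 4\<bar>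
     - c * (c + 1) * (c + 2) * (c + 3) * (c + 4) / 120 * (10/9) ^ 7 / 8 ^ 5 * rem_sum x\<^sub>0 ts
     - (\<Sum>(C, \<beta>, \<gamma>, v)\<leftarrow>ts. \<bar>C\<bar>) * (5/4000000)"
proof -
  define y where "y = x - x\<^sub>0"
  define c2 c3 c4 c5 where "c2 = c * (c + 1) / 2" and "c3 = c * (c + 1) * (c + 2) / 6"
    and "c4 = c * (c + 1) * (c + 2) * (c + 3) / 24"
    and "c5 = c * (c + 1) * (c + 2) * (c + 3) * (c + 4) / 120 * (10/9) ^ 7 / 8 ^ 5"
  note cs = c2_def c3_def c4_def c5_def
  have y: "\<bar>y\<bar> \<le> 1/8" using x by (simp add: y_def)
  have "powr_sum c ts x \<ge> taylor_sum x\<^sub>0 ts 0 - c * y * taylor_sum x\<^sub>0 ts 1 + c2 * y ^ 2 * taylor_sum x\<^sub>0 ts 2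
     - c3 * y ^ 3 * taylor_sum x\<^sub>0 ts 3 + c4 * y ^ 4 * taylor_sum x\<^sub>0 ts 4
     - c5 * rem_sum x\<^sub>0 ts - (\<Sum>(C, \<beta>, \<gamma>, v)\<leftarrow>ts. \<bar>C\<bar>) * (5/4000000)"
    using ts
  proof (induction ts)
    case Nil
    then show ?case by (simp add: powr_sum_def taylor_sum_def rem_sum_def)
  next
    case (Cons t ts)
    obtain C \<beta> \<gamma> v where t: "t = (C, \<beta>, \<gamma>, v)" by (cases t) auto
    have x_eq: "x + \<beta> = x\<^sub>0 + \<beta> + y" by (simp add: y_def)
    have term_ge: "C * ((x + \<beta>) / \<gamma>) powr (- c) \<ge> C * v / (x\<^sub>0 + \<beta>) ^ 0 - c * y * (C * v / (x\<^sub>0 + \<beta>) ^ 1) + c2 * y ^ 2 * (C * v / (x\<^sub>0 + \<beta>) ^ 2)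
     - c3 * y ^ 3 * (C * v / (x\<^sub>0 + \<beta>) ^ 3) + c4 * y ^ 4 * (C * v / (x\<^sub>0 + \<beta>) ^ 4)
     - c5 * (\<bar>C\<bar> * v / (x\<^sub>0 + \<beta>) ^ 5) - \<bar>C\<bar> * (5/4000000)"
      unfolding cs x_eq using Cons.prems t y c by (intro powr_term_ge) auto
    have eqs: "powr_sum c (t # ts) x = C * ((x + \<beta>) / \<gamma>) powr (- c) + powr_sum c ts x"
      "taylor_sum x\<^sub>0 (t # ts) k = C * v / (x\<^sub>0 + \<beta>) ^ k + taylor_sum x\<^sub>0 ts k"
      "rem_sum x\<^sub>0 (t # ts) = \<bar>C\<bar> * v / (x\<^sub>0 + \<beta>) ^ 5 + rem_sum x\<^sub>0 ts"
      "(\<Sum>(C, \<beta>, \<gamma>, v)\<leftarrow>t # ts. \<bar>C\<bar>) = \<bar>C\<bar> + (\<Sum>(C, \<beta>, \<gamma>, v)\<leftarrow>ts. \<bar>C\<bar>)" for k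
      by (simp_all add: t powr_sum_def taylor_sum_def rem_sum_def)
    have "\<forall>(C, \<beta>, \<gamma>, v)\<in>set ts. 5/4 \<le> x\<^sub>0 + \<beta> \<and> 0 < \<gamma> \<and> 0 \<le> v \<and> powr_approx c ((x\<^sub>0 + \<beta>) / \<gamma>) v"
      using Cons.prems by simp
    from add_mono[OF term_ge Cons.IH[OF this]] show ?case unfolding eqs distrib_left distrib_right by argo
  qed
  moreover have A: "\<bar>b * y ^ k * s\<bar> \<le> b / 8 ^ k * \<bar>s\<bar>" if "b \<ge> 0" for b s k
  proof -
    have "\<bar>y\<bar> ^ k \<le> (1/8) ^ k" using y by (intro power_mono) auto
    then have "b * \<bar>y\<bar> ^ k * \<bar>s\<bar> \<le> b * (1/8) ^ k * \<bar>s\<bar>" using that by (intro mult_right_mono mult_left_mono) auto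
    then show ?thesis using that by (simp add: abs_mult power_abs power_divide)
  qed
  have "\<bar>c * y * taylor_sum x\<^sub>0 ts 1\<bar> \<le> c / 8 * \<bar>taylor_sum x\<^sub>0 ts 1\<bar>"
    "\<bar>c2 * y ^ 2 * taylor_sum x\<^sub>0 ts 2\<bar> \<le> c2 / 64 * \<bar>taylor_sum x\<^sub>0 ts 2\<bar>"
    "\<bar>c3 * y ^ 3 * taylor_sum x\<^sub>0 ts 3\<bar> \<le> c3 / 512 * \<bar>taylor_sum x\<^sub>0 ts 3\<bar>"
    "\<bar>c4 * y ^ 4 * taylor_sum x\<^sub>0 ts 4\<bar> \<le> c4 / 4096 * \<bar>taylor_sum x\<^sub>0 ts 4\<bar>"
    using A[of c 1 "taylor_sum x\<^sub>0 ts 1"] A[of c2 2 "taylor_sum x\<^sub>0 ts 2"] A[of c3 3 "taylor_sum x\<^sub>0 ts 3"]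
      A[of c4 4 "taylor_sum x\<^sub>0 ts 4"] c by (simp_all add: cs)
  ultimately show ?thesis unfolding cs[symmetric] abs_le_iff[of "_ * _"] by linarith
qed

text \<open>Such powers are closed under the operator: (a + x)^(- c) times ((1/(a + x) + j)/j)^(- c)
  is (x + a + 1/j)^(- c). With j = 1, 2, 4 and a constant for infinite j, the difference between the
  function and its image is again a short sum of powers.\<close>

definition trial :: "real \<Rightarrow> real \<Rightarrow> real \<Rightarrow> real \<Rightarrow> real \<Rightarrow> real \<Rightarrow> real" where
  "trial c k\<^sub>1 k\<^sub>2 k\<^sub>4 k\<^sub>0 x =
    k\<^sub>1 * (x + 1) powr (- c) + k\<^sub>2 * ((x + 2) / 2) powr (- c) + k\<^sub>4 * ((x + 4) / 4) powr (- c) + k\<^sub>0"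

lemma sum_up_3: "(\<Sum>a=1..3. f a) = f 1 + f 2 + (f (3::nat)::real)"
  and sum_up_6: "(\<Sum>a=1..6. f a) = f 1 + f 2 + f 3 + f 4 + f 5 + (f (6::nat)::real)"
  by (simp_all add: eval_nat_numeral)

lemma trial_bounds:
  assumes "0 \<le> k\<^sub>1" "0 \<le> k\<^sub>2" "0 \<le> k\<^sub>4" "0 \<le> c" "0 \<le> x"
  shows "k\<^sub>0 \<le> trial c k\<^sub>1 k\<^sub>2 k\<^sub>4 k\<^sub>0 x \<and> trial c k\<^sub>1 k\<^sub>2 k\<^sub>4 k\<^sub>0 x \<le> k\<^sub>1 + k\<^sub>2 + k\<^sub>4 + k\<^sub>0"
proof -
  have p: "k * q powr (- c) \<le> k" if "k \<ge> 0" "q \<ge> 1" for k q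
    using that assms(4) powr_mono2'[of "- c" 1 q] mult_left_mono[of "q powr (- c)" 1 k] by simp
  have "k\<^sub>1 * (x + 1) powr (- c) \<le> k\<^sub>1" "k\<^sub>2 * ((x + 2) / 2) powr (- c) \<le> k\<^sub>2" "k\<^sub>4 * ((x + 4) / 4) powr (- c) \<le> k\<^sub>4"
    using assms by (auto intro!: p)
  moreover have "0 \<le> k\<^sub>1 * (x + 1) powr (- c)" "0 \<le> k\<^sub>2 * ((x + 2) / 2) powr (- c)" "0 \<le> k\<^sub>4 * ((x + 4) / 4) powr (- c)"
    using assms by auto
  ultimately show ?thesis unfolding trial_def by linarith
qed

lemma trial_branch:
  assumes "0 < a + x"
  shows "(a + x) powr (- c) * trial c k\<^sub>1 k\<^sub>2 k\<^sub>4 k\<^sub>0 (1 / (a + x))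
    = k\<^sub>1 * (x + (a + 1)) powr (- c) + k\<^sub>2 * (x + (a + 1/2)) powr (- c) + k\<^sub>4 * (x + (a + 1/4)) powr (- c) + k\<^sub>0 * (x + a) powr (- c)"
proof -
  have e: "x + (a + 1) = (a + x) * (1 / (a + x) + 1)" "x + (a + 1/2) = (a + x) * ((1 / (a + x) + 2) / 2)"
    "x + (a + 1/4) = (a + x) * ((1 / (a + x) + 4) / 4)"
    using assms by (auto simp: field_simps)
  have "0 < 1 / (a + x)" using assms by simp
  then show ?thesis unfolding e trial_def powr_mult using assms
    by (simp add: powr_mult distrib_left mult_ac add.commute)
qed

text \<open>Equal bases are merged in the lists: 219/1000 = k1 - k0 and 323/1000 = k1 + k0, while
  the constant k0 = 13/250 stays outside. Three expansions of radius 1/8 cover [1/8, 7/8]; the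
  margin 1/20000 later yields a factor below 1.\<close>

lemma trial_6:
  assumes "1/8 \<le> x" "x \<le> 7/8"
  shows "(\<Sum>a=1..6. (real a + x) powr (- (8677/5000)) * trial (8677/5000) (271/1000) (287/250) (343/1000) (13/250) (1 / (real a + x))) \<le> trial (8677/5000) (271/1000) (287/250) (343/1000) (13/250) x - 1/20000"
proof -
  define t0 :: "(real \<times> real \<times> real \<times> real) list" where "t0 =
    [(219/1000, 1, 1, 339463/500000), ((- 343/1000), 5/4, 1, 494779/1000000), ((- 287/250), 3/2, 1, 75729/200000), ((- 323/1000), 2, 1, 122403/500000), ((- 343/1000), 9/4, 1, 203899/1000000),
     ((- 287/250), 5/2, 1, 34563/200000), ((- 323/1000), 3, 1, 32331/250000), ((- 343/1000), 13/4, 1, 113717/1000000), ((- 287/250), 7/2, 1, 20177/200000), ((- 323/1000), 4, 1, 20297/250000),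
     ((- 343/1000), 17/4, 1, 36761/500000), ((- 287/250), 9/2, 1, 66937/1000000), ((- 323/1000), 5, 1, 11253/200000), ((- 343/1000), 21/4, 1, 51901/1000000), ((- 287/250), 11/2, 1, 3003/62500),
     ((- 323/1000), 6, 1, 1663/40000), ((- 343/1000), 25/4, 1, 38839/1000000), ((- 287/250), 13/2, 1, 36377/1000000), ((- 271/1000), 7, 1, 16067/500000), (287/250, 2, 2, 25473/31250),
     (343/1000, 4, 4, 900137/1000000)]"
  define t1 :: "(real \<times> real \<times> real \<times> real) list" where "t1 =
    [(219/1000, 1, 1, 494779/1000000), ((- 343/1000), 5/4, 1, 75729/200000), ((- 287/250), 3/2, 1, 150163/500000), ((- 323/1000), 2, 1, 203899/1000000), ((- 343/1000), 9/4, 1, 34563/200000),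
     ((- 287/250), 5/2, 1, 29719/200000), ((- 323/1000), 3, 1, 113717/1000000), ((- 343/1000), 13/4, 1, 20177/200000), ((- 287/250), 7/2, 1, 22549/250000), ((- 323/1000), 4, 1, 36761/500000),
     ((- 343/1000), 17/4, 1, 66937/1000000), ((- 287/250), 9/2, 1, 15309/250000), ((- 323/1000), 5, 1, 51901/1000000), ((- 343/1000), 21/4, 1, 3003/62500), ((- 287/250), 11/2, 1, 44627/1000000),
     ((- 323/1000), 6, 1, 38839/1000000), ((- 343/1000), 25/4, 1, 36377/1000000), ((- 287/250), 13/2, 1, 4269/125000), ((- 271/1000), 7, 1, 15149/500000), (287/250, 2, 2, 339463/500000),
     (343/1000, 4, 4, 25473/31250)]"
  define t2 :: "(real \<times> real \<times> real \<times> real) list" where "t2 =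
    [(219/1000, 1, 1, 75729/200000), ((- 343/1000), 5/4, 1, 150163/500000), ((- 287/250), 3/2, 1, 122403/500000), ((- 323/1000), 2, 1, 34563/200000), ((- 343/1000), 9/4, 1, 29719/200000),
     ((- 287/250), 5/2, 1, 32331/250000), ((- 323/1000), 3, 1, 20177/200000), ((- 343/1000), 13/4, 1, 22549/250000), ((- 287/250), 7/2, 1, 20297/250000), ((- 323/1000), 4, 1, 66937/1000000),
     ((- 343/1000), 17/4, 1, 15309/250000), ((- 287/250), 9/2, 1, 11253/200000), ((- 323/1000), 5, 1, 3003/62500), ((- 343/1000), 21/4, 1, 44627/1000000), ((- 287/250), 11/2, 1, 1663/40000),
     ((- 323/1000), 6, 1, 36377/1000000), ((- 343/1000), 25/4, 1, 4269/125000), ((- 287/250), 13/2, 1, 16067/500000), ((- 271/1000), 7, 1, 14311/500000), (287/250, 2, 2, 287713/500000),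
     (343/1000, 4, 4, 742131/1000000)]"
  have eq: "trial (8677/5000) (271/1000) (287/250) (343/1000) (13/250) x - (\<Sum>a=1..6. (real a + x) powr (- (8677/5000)) * trial (8677/5000) (271/1000) (287/250) (343/1000) (13/250) (1 / (real a + x))) = powr_sum (8677/5000) t x + 13/250" if "t \<in> {t0, t1, t2}" for t
    using that assms unfolding sum_up_6 by (auto simp: t0_def t1_def t2_def powr_sum_def trial_branch) (simp_all add: trial_def algebra_simps)
  have p0: "powr_sum (8677/5000) t0 x \<ge> 1/20000 - 13/250" if "\<bar>x - 1/4\<bar> \<le> 1/8"
  proof -
    have "\<forall>(C, \<beta>, \<gamma>, v)\<in>set t0. 5/4 \<le> 1/4 + \<beta> \<and> 0 < \<gamma> \<and> 0 \<le> v \<and> powr_approx (8677/5000) ((1/4 + \<beta>) / \<gamma>) v"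
      by (simp add: t0_def powr_approx_6)
    from powr_sum_ge[OF _ _ that this] show ?thesis
      by (rule order_trans[rotated]) (simp_all add: t0_def taylor_sum_def rem_sum_def power_divide)
  qed
  have p1: "powr_sum (8677/5000) t1 x \<ge> 1/20000 - 13/250" if "\<bar>x - 1/2\<bar> \<le> 1/8"
  proof -
    have "\<forall>(C, \<beta>, \<gamma>, v)\<in>set t1. 5/4 \<le> 1/2 + \<beta> \<and> 0 < \<gamma> \<and> 0 \<le> v \<and> powr_approx (8677/5000) ((1/2 + \<beta>) / \<gamma>) v"
      by (simp add: t1_def powr_approx_6)
    from powr_sum_ge[OF _ _ that this] show ?thesis
      by (rule order_trans[rotated]) (simp_all add: t1_def taylor_sum_def rem_sum_def power_divide)
  qed
  have p2: "powr_sum (8677/5000) t2 x \<ge> 1/20000 - 13/250" if "\<bar>x - 3/4\<bar> \<le> 1/8"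
  proof -
    have "\<forall>(C, \<beta>, \<gamma>, v)\<in>set t2. 5/4 \<le> 3/4 + \<beta> \<and> 0 < \<gamma> \<and> 0 \<le> v \<and> powr_approx (8677/5000) ((3/4 + \<beta>) / \<gamma>) v"
      by (simp add: t2_def powr_approx_6)
    from powr_sum_ge[OF _ _ that this] show ?thesis
      by (rule order_trans[rotated]) (simp_all add: t2_def taylor_sum_def rem_sum_def power_divide)
  qed
  have "\<bar>x - 1/4\<bar> \<le> 1/8 \<or> \<bar>x - 1/2\<bar> \<le> 1/8 \<or> \<bar>x - 3/4\<bar> \<le> 1/8" using assms unfolding abs_le_iff by argo
  then show ?thesis using p0 p1 p2 eq[of t0] eq[of t1] eq[of t2] by auto
qed

text \<open>The merged coefficients are now k0 - k1 = -41/250 and k0 + k1 = 21/100; the inequality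
  without margin is what the mass distribution requires.\<close>

lemma trial_3:
  assumes "1/8 \<le> x" "x \<le> 7/8"
  shows "trial (882/625) (187/1000) (651/500) (13/125) (23/1000) x \<le> (\<Sum>a=1..3. (real a + x) powr (- (882/625)) * trial (882/625) (187/1000) (651/500) (13/125) (23/1000) (1 / (real a + x)))"
proof -
  define t0 :: "(real \<times> real \<times> real \<times> real) list" where "t0 =
    [((- 41/250), 1, 1, 364931/500000), (13/125, 5/4, 1, 564287/1000000), (651/500, 3/2, 1, 453967/1000000), (21/100, 2, 1, 15921/50000), (13/125, 9/4, 1, 274427/1000000),
     (651/500, 5/2, 1, 239891/1000000), (21/100, 3, 1, 189509/1000000), (13/125, 13/4, 1, 170691/1000000), (651/500, 7/2, 1, 19357/125000), (187/1000, 4, 1, 129783/1000000),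
     ((- 651/500), 2, 2, 52929/62500), ((- 13/125), 4, 4, 229501/250000)]"
  define t1 :: "(real \<times> real \<times> real \<times> real) list" where "t1 =
    [((- 41/250), 1, 1, 564287/1000000), (13/125, 5/4, 1, 453967/1000000), (651/500, 3/2, 1, 375999/1000000), (21/100, 2, 1, 274427/1000000), (13/125, 9/4, 1, 239891/1000000),
     (651/500, 5/2, 1, 212171/1000000), (21/100, 3, 1, 170691/1000000), (13/125, 13/4, 1, 19357/125000), (651/500, 7/2, 1, 1131/8000), (187/1000, 4, 1, 4789/40000),
     ((- 651/500), 2, 2, 364931/500000), ((- 13/125), 4, 4, 52929/62500)]"
  define t2 :: "(real \<times> real \<times> real \<times> real) list" where "t2 =
    [((- 41/250), 1, 1, 453967/1000000), (13/125, 5/4, 1, 375999/1000000), (651/500, 3/2, 1, 15921/50000), (21/100, 2, 1, 239891/1000000), (13/125, 9/4, 1, 212171/1000000),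
     (651/500, 5/2, 1, 189509/1000000), (21/100, 3, 1, 19357/125000), (13/125, 13/4, 1, 1131/8000), (651/500, 7/2, 1, 129783/1000000), (187/1000, 4, 1, 11093/100000),
     ((- 651/500), 2, 2, 63801/100000), ((- 13/125), 4, 4, 196163/250000)]"
  have eq: "(\<Sum>a=1..3. (real a + x) powr (- (882/625)) * trial (882/625) (187/1000) (651/500) (13/125) (23/1000) (1 / (real a + x))) - trial (882/625) (187/1000) (651/500) (13/125) (23/1000) x = powr_sum (882/625) t x - 23/1000" if "t \<in> {t0, t1, t2}" for t
    using that assms unfolding sum_up_3 by (auto simp: t0_def t1_def t2_def powr_sum_def trial_branch) (simp_all add: trial_def algebra_simps)
  have p0: "powr_sum (882/625) t0 x \<ge> 23/1000" if "\<bar>x - 1/4\<bar> \<le> 1/8"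
  proof -
    have "\<forall>(C, \<beta>, \<gamma>, v)\<in>set t0. 5/4 \<le> 1/4 + \<beta> \<and> 0 < \<gamma> \<and> 0 \<le> v \<and> powr_approx (882/625) ((1/4 + \<beta>) / \<gamma>) v"
      by (simp add: t0_def powr_approx_3)
    from powr_sum_ge[OF _ _ that this] show ?thesis
      by (rule order_trans[rotated]) (simp_all add: t0_def taylor_sum_def rem_sum_def power_divide)
  qed
  have p1: "powr_sum (882/625) t1 x \<ge> 23/1000" if "\<bar>x - 1/2\<bar> \<le> 1/8"
  proof -
    have "\<forall>(C, \<beta>, \<gamma>, v)\<in>set t1. 5/4 \<le> 1/2 + \<beta> \<and> 0 < \<gamma> \<and> 0 \<le> v \<and> powr_approx (882/625) ((1/2 + \<beta>) / \<gamma>) v"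
      by (simp add: t1_def powr_approx_3)
    from powr_sum_ge[OF _ _ that this] show ?thesis
      by (rule order_trans[rotated]) (simp_all add: t1_def taylor_sum_def rem_sum_def power_divide)
  qed
  have p2: "powr_sum (882/625) t2 x \<ge> 23/1000" if "\<bar>x - 3/4\<bar> \<le> 1/8"
  proof -
    have "\<forall>(C, \<beta>, \<gamma>, v)\<in>set t2. 5/4 \<le> 3/4 + \<beta> \<and> 0 < \<gamma> \<and> 0 \<le> v \<and> powr_approx (882/625) ((3/4 + \<beta>) / \<gamma>) v"
      by (simp add: t2_def powr_approx_3)
    from powr_sum_ge[OF _ _ that this] show ?thesis
      by (rule order_trans[rotated]) (simp_all add: t2_def taylor_sum_def rem_sum_def power_divide)
  qed
  have "\<bar>x - 1/4\<bar> \<le> 1/8 \<or> \<bar>x - 1/2\<bar> \<le> 1/8 \<or> \<bar>x - 3/4\<bar> \<le> 1/8" using assms unfolding abs_le_iff by argo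
  then show ?thesis using p0 p1 p2 eq[of t0] eq[of t1] eq[of t2] by auto
qed

section \<open>The dimension bounds\<close>

lemma sudler_rational_liminf:
  assumes "\<alpha> \<in> \<rat>"
  shows "\<not> liminf (\<lambda>N. ereal (sudler N \<alpha>)) > 0"
proof -
  obtain p r :: int where r: "r > 0" "\<alpha> = real_of_int p / real_of_int r"
    using assms by (auto elim!: Rats_cases')
  define q where "q = nat r"
  have q: "q > 0" "\<alpha> = real_of_int p / real q" using r by (auto simp: q_def)
  have "sudler N \<alpha> = 0" if "N \<ge> q" for N
  proof -
    have "sin (pi * real q * \<alpha>) = 0" using q sin_zero_iff_int2[of "pi * real q * \<alpha>"] by auto
    then show ?thesis unfolding sudler_def using that q(1) by (auto simp: prod_zero_iff intro!: bexI[of _ q])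
  qed
  then have "\<forall>\<^sub>F N in sequentially. ereal (sudler N \<alpha>) = 0"
    by (auto simp: eventually_sequentially zero_ereal_def)
  then have "liminf (\<lambda>N. ereal (sudler N \<alpha>)) = liminf (\<lambda>N. 0)" by (rule Liminf_eq)
  then show ?thesis by (simp add: Liminf_const)
qed

lemma cf_map_gauss_iterate:
  assumes "0 < x" "x < 1" "x \<notin> \<rat>"
  shows "\<exists>w. 0 \<notin> set w \<and> x = cf_map w ((gauss_map ^^ k) x)"
  using assms
proof (induction k arbitrary: x)
  case 0
  show ?case by (rule exI[of _ "[]"]) simp
next
  case (Suc k)
  note g = gauss_map[OF Suc.prems]
  obtain w where w: "0 \<notin> set w" "gauss_map x = cf_map w ((gauss_map ^^ k) (gauss_map x))"
    using Suc.IH[OF g(1-3)] by blast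
  have "x = 1 / (real (cf_digit x) + cf_map w ((gauss_map ^^ k) (gauss_map x)))" using g(6) w(2) by simp
  then have "x = cf_map (cf_digit x # w) ((gauss_map ^^ Suc k) x)" by (simp add: funpow_Suc_right del: funpow.simps)
  then show ?case using w(1) g(5) by (intro exI[of _ "cf_digit x # w"]) auto
qed

lemma gauss_iterate_irrational:
  assumes "0 < x" "x < 1" "x \<notin> \<rat>"
  shows "0 < (gauss_map ^^ k) x \<and> (gauss_map ^^ k) x < 1 \<and> (gauss_map ^^ k) x \<notin> \<rat>"
  by (induction k) (use assms gauss_map(1-3) in auto)

text \<open>Beyond the last big digit the tail has only small ones. As there are countably many
  words w, the remaining candidates form a countable union of branch images.\<close>

lemma eventually_small_digits:
  assumes "0 < x" "x < 1" "x \<notin> \<rat>" "finite {k. cf_digit ((gauss_map ^^ k) x) \<ge> Suc b}"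
  shows "\<exists>w. 0 \<notin> set w \<and> x \<in> cf_map w ` small_digits b"
proof -
  obtain k where k: "\<And>j. cf_digit ((gauss_map ^^ j) x) \<ge> Suc b \<Longrightarrow> j < k"
    using assms(4) unfolding finite_nat_set_iff_bounded by auto
  have "cf_digit ((gauss_map ^^ j) ((gauss_map ^^ k) x)) \<le> b" for j
    using k[of "j + k"] by (auto simp: funpow_add not_less_eq_eq[symmetric])
  then have "(gauss_map ^^ k) x \<in> small_digits b"
    using gauss_iterate_irrational[OF assms(1-3), of k] by (simp add: small_digits_def)
  then show ?thesis using cf_map_gauss_iterate[OF assms(1-3), of k] by blast
qed

theorem theorem2:
  fixes S :: "real set"
  defines "S \<equiv> {\<alpha> \<in> {0..<1}.
      liminf (\<lambda>N. ereal (sudler N \<alpha>)) > 0 \<and>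
      limsup (\<lambda>N. ereal (sudler N \<alpha> / real N)) < \<infinity>}"
  shows "ereal 0.7056 \<le> hausdorff_dim S \<and> hausdorff_dim S \<le> ereal 0.8677"
proof
  define h3 where "h3 = trial (882/625) (187/1000) (651/500) (13/125) (23/1000)"
  have ivl3: "1/8 \<le> x \<and> x \<le> 7/8" if "x \<in> cf_ivl 3" for x using that by (auto simp: cf_ivl_def)
  interpret E3: cf_transfer 3 "7056/10000" h3 "23/1000" 2
  proof
    fix x assume "x \<in> cf_ivl 3"
    then have "0 \<le> x" using cf_ivlD(1)[of x 3] by simp
    then show "23/1000 \<le> h3 x \<and> h3 x \<le> 2"
      using trial_bounds[of "187/1000" "651/500" "13/125" "882/625" x "23/1000"] unfolding h3_def by simp
  qed simp_all
  have "small_digits 3 \<subseteq> S"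
    unfolding S_def using small_digits_3_in_S small_digitsD(1,2)[of _ 3] by (auto simp: less_imp_le)
  then have "ereal (7056/10000) \<le> hausdorff_dim S"
  proof (rule E3.hausdorff_dim_ge[rotated])
    fix x assume "x \<in> cf_ivl 3"
    from trial_3[of x] ivl3[OF this] show "h3 x \<le> E3.transfer x" unfolding E3.transfer_def unfolding h3_def by simp
  qed
  then show "ereal 0.7056 \<le> hausdorff_dim S" by simp
next
  define h6 where "h6 = trial (8677/5000) (271/1000) (287/250) (343/1000) (13/250)"
  have ivl6: "1/8 \<le> x \<and> x \<le> 7/8" if "x \<in> cf_ivl 6" for x using that by (auto simp: cf_ivl_def)
  have h6: "13/250 \<le> h6 x \<and> h6 x \<le> 2" if "x \<in> cf_ivl 6" for x
  proof -
    have "0 \<le> x" using cf_ivlD(1)[OF that] by simp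
    then show ?thesis
      using trial_bounds[of "271/1000" "287/250" "343/1000" "8677/5000" x "13/250"] unfolding h6_def by simp
  qed
  interpret E6: cf_transfer 6 "8677/10000" h6 "13/250" 2
    using h6 by unfold_locales simp_all
  \<comment> \<open>Since \<open>h6\<close> is at most 2, subtracting 1/20000 gains at least the
    factor 1 - 1/40000.\<close>
  have tr: "E6.transfer x \<le> 39999/40000 * h6 x" if x: "x \<in> cf_ivl 6" for x
  proof -
    have "E6.transfer x \<le> h6 x - 1/20000"
      using trial_6[of x] ivl6[OF x] unfolding E6.transfer_def unfolding h6_def by simp
    then show ?thesis using h6[OF x] by argo
  qed
  have null: "hausdorff_measure (8677/10000) (cf_map w ` small_digits 6) = 0" if "0 \<notin> set w" for w
    using that tr by (intro E6.image_small_digits_null[where l = "39999/40000"]) simp_all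
  \<comment> \<open>Enumerates all words by their natural number codes; words with a zero digit are
    not covered by \<open>null\<close> and are assigned the empty set.\<close>
  define A where "A i = (if 0 \<notin> set (from_nat i :: nat list) then cf_map (from_nat i) ` small_digits 6 else {})" for i
  have "hausdorff_measure (8677/10000) (A i) = 0" for i
    using null[of "from_nat i"] hausdorff_measure_zero_subset[OF null[of "[]"], of "{}"] by (auto simp: A_def)
  then have "hausdorff_measure (8677/10000) (\<Union>i. A i) = 0" by (rule hausdorff_measure_zero_UN)
  moreover have "S \<subseteq> (\<Union>i. A i)"
  proof
    fix \<alpha> assume "\<alpha> \<in> S"
    then have a: "0 \<le> \<alpha>" "\<alpha> < 1" "liminf (\<lambda>N. ereal (sudler N \<alpha>)) > 0" by (auto simp: S_def)
    have irr: "\<alpha> \<notin> \<rat>" using sudler_rational_liminf a(3) by blast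
    then have "0 < \<alpha>" using a(1) by (cases "\<alpha> = 0") auto
    then have "finite {k. cf_digit ((gauss_map ^^ k) \<alpha>) \<ge> Suc 6}"
      using infinitely_many_big_digits[of \<alpha>] a irr by auto
    then obtain w where w: "0 \<notin> set w" "\<alpha> \<in> cf_map w ` small_digits 6"
      using eventually_small_digits[OF \<open>0 < \<alpha>\<close> a(2) irr] by blast
    then have "\<alpha> \<in> A (to_nat w)" by (simp add: A_def)
    then show "\<alpha> \<in> (\<Union>i. A i)" by blast
  qed
  ultimately have "hausdorff_measure (8677/10000) S = 0" by (rule hausdorff_measure_zero_subset)
  then have "hausdorff_dim S \<le> ereal (8677/10000)" unfolding hausdorff_dim_def by (intro INF_lower) simp
  then show "hausdorff_dim S \<le> ereal 0.8677" by simp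
qed

end
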